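(* Let $T\in(0,\infty)$, let $\mu,\sigma\colon[0,T]\times\mathbb{R}\to\mathbb{R}$ be measurable functions and let $X\colon[0,T]\times\Omega\to\mathbb{R}$ be an adapted process with continuous paths such that $$X_t=X_0+\int_0^t\mu(s,X_s)\,ds+\int_0^t\sigma(s,X_s)\,dW_s,\qquad t\in[0,T].$$ Assume that there exist $t_0\in[0,T)$, $T_0\in(t_0,T]$, $\delta\in(0,\infty)$ and $\xi\in\mathbb{R}$ such that (local Lip) $\mu,\sigma$ are Lipschitz continuous on $[t_0,T_0]\times[\xi-\delta,\xi+\delta]$; (non-deg) $\inf_{(t,x)\in[t_0,T_0]\times B_\delta(\xi)}|\sigma(t,x)|>0$; (reach) $\mathbb{P}(X_{t_0}\in B_\delta(\xi))>0$. Then there exists a constant $c\in(0,\infty)$ such that for all $n\in\mathbb{N}$, $$\inf_{\substack{t_1,\dots,t_n\in[0,T]\\ g\colon\mathbb{R}^n\to L^1([0,T])\text{ measurable}}}\mathbb{E}\bigl[\|X-g(W_{t_1},\dots,W_{t_n})\|_{L^1([0,T])}\bigr]\ge\frac{c}{n^{1/2}}.$$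
   Context: $(\Omega,\mathcal{F},(\mathcal{F}_t)_{t\ge0},\mathbb{P})$ is a filtered probability space satisfying the usual conditions and $W$ is a standard one-dimensional Brownian motion on it (with respect to the filtration). $B_\delta(\xi)$ is the open ball in $\mathbb{R}$ around $\xi$ with radius $\delta$. $L^1([0,T])$ is the space of measurable $f\colon[0,T]\to\mathbb{R}$ with $\|f\|_{L^1([0,T])}=\int_0^T|f(x)|\,dx<\infty$, with its Borel $\sigma$-algebra. *)

theory Defs
  imports "HOL-Probability.Probability"
begin

subsection \<open>Filtered probability spaces and Brownian motion\<close>

text \<open>Times are real numbers; only the values \<open>F t\<close>, \<open>W t\<close> with \<open>0 \<le> t\<close> are ever constrained.\<close>

locale usual_filtered_prob_space = prob_space M + complete_measure M
  for M :: "'a measure" +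
  fixes F :: "real \<Rightarrow> 'a measure"
  assumes subalgebra_F: "\<And>t. 0 \<le> t \<Longrightarrow> subalgebra M (F t)"
    and mono_F: "\<And>s t. 0 \<le> s \<Longrightarrow> s \<le> t \<Longrightarrow> sets (F s) \<subseteq> sets (F t)"
    and null_sets_F: "null_sets M \<subseteq> sets (F 0)"
    and right_continuous_F: "\<And>t. 0 \<le> t \<Longrightarrow> sets (F t) = (\<Inter>s\<in>{t<..}. sets (F s))"

text \<open>\<open>normal_density\<close> takes the standard deviation, not the variance, as its second argument.\<close>

definition standard_brownian_motion ::
  "'a measure \<Rightarrow> (real \<Rightarrow> 'a measure) \<Rightarrow> (real \<Rightarrow> 'a \<Rightarrow> real) \<Rightarrow> bool" where
  "standard_brownian_motion M F W \<longleftrightarrow>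
    (\<forall>t\<ge>0. W t \<in> borel_measurable (F t)) \<and>
    (AE \<omega> in M. W 0 \<omega> = 0) \<and>
    (AE \<omega> in M. continuous_on {0..} (\<lambda>t. W t \<omega>)) \<and>
    (\<forall>s t. 0 \<le> s \<longrightarrow> s < t \<longrightarrow>
      distributed M lborel (\<lambda>\<omega>. W t \<omega> - W s \<omega>) (normal_density 0 (sqrt (t - s))) \<and>
      prob_space.indep_set M (sets (F s))
        (sets (vimage_algebra (space M) (\<lambda>\<omega>. W t \<omega> - W s \<omega>) borel)))"

definition adapted_on ::
  "(real \<Rightarrow> 'a measure) \<Rightarrow> real \<Rightarrow> (real \<Rightarrow> 'a \<Rightarrow> real) \<Rightarrow> bool" where
  "adapted_on F T X \<longleftrightarrow> (\<forall>t\<in>{0..T}. X t \<in> borel_measurable (F t))"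

definition continuous_paths_on ::
  "'a measure \<Rightarrow> real \<Rightarrow> (real \<Rightarrow> 'a \<Rightarrow> real) \<Rightarrow> bool" where
  "continuous_paths_on M T X \<longleftrightarrow> (\<forall>\<omega>\<in>space M. continuous_on {0..T} (\<lambda>t. X t \<omega>))"

definition progressively_measurable_on ::
  "(real \<Rightarrow> 'a measure) \<Rightarrow> real \<Rightarrow> (real \<Rightarrow> 'a \<Rightarrow> real) \<Rightarrow> bool" where
  "progressively_measurable_on F T H \<longleftrightarrow>
    (\<forall>t\<in>{0..T}. (\<lambda>(s, \<omega>). H s \<omega>) \<in> borel_measurable (restrict_space borel {0..t} \<Otimes>\<^sub>M F t))"


subsection \<open>The Ito integral\<close>

text \<open>A list of triples \<open>(a, b, \<eta>)\<close> stands for the simple process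
  \<open>(s, \<omega>) \<mapsto> \<Sum> \<eta> \<omega> * 1_{(a, b]}(s)\<close>; the intervals may overlap, so that these are exactly
  the finite linear combinations of elementary processes.\<close>

type_synonym 'a simple_process = "(real \<times> real \<times> ('a \<Rightarrow> real)) list"

definition simple_processes ::
  "'a measure \<Rightarrow> (real \<Rightarrow> 'a measure) \<Rightarrow> real \<Rightarrow> 'a simple_process set" where
  "simple_processes M F T =
    {S. \<forall>(a, b, \<eta>)\<in>set S. 0 \<le> a \<and> a \<le> b \<and> b \<le> T \<and>
      \<eta> \<in> borel_measurable (F a) \<and> (\<exists>C. \<forall>\<omega>\<in>space M. \<bar>\<eta> \<omega>\<bar> \<le> C)}"

definition simple_value :: "'a simple_process \<Rightarrow> real \<Rightarrow> 'a \<Rightarrow> real" where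
  "simple_value S s \<omega> = (\<Sum>(a, b, \<eta>)\<leftarrow>S. \<eta> \<omega> * indicator {a<..b} s)"

definition simple_integral ::
  "(real \<Rightarrow> 'a \<Rightarrow> real) \<Rightarrow> 'a simple_process \<Rightarrow> real \<Rightarrow> 'a \<Rightarrow> real" where
  "simple_integral W S t \<omega> = (\<Sum>(a, b, \<eta>)\<leftarrow>S. \<eta> \<omega> * (W (min b t) \<omega> - W (min a t) \<omega>))"

definition null_in_probability :: "'a measure \<Rightarrow> (nat \<Rightarrow> 'a \<Rightarrow> ennreal) \<Rightarrow> bool" where
  "null_in_probability M Z \<longleftrightarrow>
    (\<forall>k. Z k \<in> borel_measurable M) \<and>
    (\<forall>\<epsilon>>0. (\<lambda>k. measure M {\<omega>\<in>space M. \<epsilon> < Z k \<omega>}) \<longlonglongrightarrow> 0)"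

text \<open>\<open>Y\<close> is (a continuous version of) the process \<open>t \<mapsto> \<integral>\<^sub>0\<^sup>t H dW\<close> on \<open>[0, T]\<close>, for \<open>H\<close> progressively
  measurable with almost surely square integrable paths: the limit, uniformly on \<open>[0, T]\<close> in
  probability, of the integrals of simple processes \<open>S k\<close> with
  \<open>\<integral>\<^sub>0\<^sup>T (S k - H)\<^sup>2 ds \<rightarrow> 0\<close> in probability. Such a sequence always exists, and \<open>Y\<close> does not depend
  on it up to indistinguishability. The measurability required in \<open>null_in_probability\<close> is
  automatic here, since \<open>M\<close> is complete.\<close>

definition has_ito_integral ::
  "'a measure \<Rightarrow> (real \<Rightarrow> 'a measure) \<Rightarrow> (real \<Rightarrow> 'a \<Rightarrow> real) \<Rightarrow> real \<Rightarrow>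
    (real \<Rightarrow> 'a \<Rightarrow> real) \<Rightarrow> (real \<Rightarrow> 'a \<Rightarrow> real) \<Rightarrow> bool" where
  "has_ito_integral M F W T H Y \<longleftrightarrow>
    progressively_measurable_on F T H \<and>
    (AE \<omega> in M. (\<integral>\<^sup>+s\<in>{0..T}. ennreal ((H s \<omega>)\<^sup>2) \<partial>lborel) < \<infinity>) \<and>
    adapted_on F T Y \<and> continuous_paths_on M T Y \<and>
    (\<exists>S. (\<forall>k. S k \<in> simple_processes M F T) \<and>
      null_in_probability M
        (\<lambda>k \<omega>. \<integral>\<^sup>+s\<in>{0..T}. ennreal ((simple_value (S k) s \<omega> - H s \<omega>)\<^sup>2) \<partial>lborel) \<and>
      null_in_probability M
        (\<lambda>k \<omega>. SUP t\<in>{0..T}. ennreal \<bar>simple_integral W (S k) t \<omega> - Y t \<omega>\<bar>))"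

text \<open>\<open>X\<^sub>t = X\<^sub>0 + \<integral>\<^sub>0\<^sup>t \<mu>(s, X\<^sub>s) ds + \<integral>\<^sub>0\<^sup>t \<sigma>(s, X\<^sub>s) dW\<^sub>s\<close> for \<open>t \<in> [0, T]\<close>, almost surely.\<close>

definition sde_solution ::
  "'a measure \<Rightarrow> (real \<Rightarrow> 'a measure) \<Rightarrow> (real \<Rightarrow> 'a \<Rightarrow> real) \<Rightarrow> real \<Rightarrow>
    (real \<times> real \<Rightarrow> real) \<Rightarrow> (real \<times> real \<Rightarrow> real) \<Rightarrow> (real \<Rightarrow> 'a \<Rightarrow> real) \<Rightarrow> bool" where
  "sde_solution M F W T \<mu> \<sigma> X \<longleftrightarrow>
    adapted_on F T X \<and> continuous_paths_on M T X \<and>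
    (AE \<omega> in M. set_integrable lborel {0..T} (\<lambda>s. \<mu> (s, X s \<omega>))) \<and>
    (\<exists>Y. has_ito_integral M F W T (\<lambda>s \<omega>. \<sigma> (s, X s \<omega>)) Y \<and>
      (AE \<omega> in M. \<forall>t\<in>{0..T}.
        X t \<omega> = X 0 \<omega> + (LBINT s:{0..t}. \<mu> (s, X s \<omega>)) + Y t \<omega>))"


subsection \<open>The space \<open>L\<^sup>1([0, T])\<close>\<close>

text \<open>Elements are functions, not equivalence classes, and their values outside \<open>[0, T]\<close> are
  irrelevant. The Borel sets are generated by the topology of the seminorm.\<close>

definition L1_norm :: "real \<Rightarrow> (real \<Rightarrow> real) \<Rightarrow> ennreal" where
  "L1_norm T f = (\<integral>\<^sup>+s\<in>{0..T}. ennreal \<bar>f s\<bar> \<partial>lborel)"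

definition L1_space :: "real \<Rightarrow> (real \<Rightarrow> real) set" where
  "L1_space T = {f \<in> borel_measurable (restrict_space borel {0..T}). L1_norm T f < \<infinity>}"

definition L1_borel :: "real \<Rightarrow> (real \<Rightarrow> real) measure" where
  "L1_borel T = sigma (L1_space T)
    {U. U \<subseteq> L1_space T \<and>
      (\<forall>f\<in>U. \<exists>\<epsilon>>0. \<forall>h\<in>L1_space T. L1_norm T (\<lambda>s. h s - f s) < \<epsilon> \<longrightarrow> h \<in> U)}"

end

theory Submission
  imports Defs
begin

text \<open>
  Observing \<open>W\<close> at \<open>n\<close> times leaves intervals of length of order \<open>1 / n\<close> in which nothing is seen. Let
  \<open>[a, a + 2 * h]\<close> be such a window, and let \<open>U\<close> and \<open>V\<close> be the increments of \<open>W\<close> over its two halves.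
  The observations depend on \<open>U\<close> and \<open>V\<close> only through \<open>U + V\<close>, and exchanging \<open>U\<close> and \<open>V\<close> does not
  change their joint law with the past of \<open>a\<close> and the increments after the window
  (\<open>exchange_increments\<close>). A predictor therefore does equally well for \<open>x + \<eta> * U\<close> and for
  \<open>x + \<eta> * V\<close>, whatever \<open>x\<close> and \<open>\<eta>\<close> are known at time \<open>a\<close>. If \<open>\<bar>\<eta>\<bar>\<close> is bounded below, these two
  numbers are typically \<open>sqrt h\<close> apart, so the error is of order \<open>sqrt h\<close>
  (\<open>midpoint_unpredictable\<close>).

  At the midpoint of the window, \<open>X\<close> is such a number up to an error that is small compared with
  \<open>sqrt h\<close>, namely with \<open>x = X a\<close> and \<open>\<eta> = \<sigma> (a, X a)\<close>: as long as \<open>X\<close> stays near \<open>\<xi>\<close>, the drift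
  contributes \<open>O(h)\<close> and \<open>\<sigma>\<close> hardly changes along the path (\<open>sde_increment_linear\<close>). The stochastic
  integral is compared with its frozen version in probability only (\<open>ito_increment_deviation\<close>), as
  \<open>X\<close> and \<open>\<sigma> (s, X s)\<close> may have no moments. For that reason all errors are truncated at \<open>sqrt h\<close>.

  To obtain errors on a set of times whose measure does not shrink with \<open>n\<close>, the window is shifted in
  steps of \<open>\<theta> = h / m\<close>, with a large \<open>m\<close> that does not depend on \<open>n\<close>. Each of the \<open>4 * m * n\<close>
  windows is responsible for the cell of length \<open>\<theta>\<close> that starts at its midpoint, in which \<open>W\<close> moves
  by much less than \<open>sqrt h\<close> (\<open>cell_error\<close>). With \<open>h\<close> of order \<open>1 / n\<close> all windows fit into a fixed
  interval, and at least half of them contain no observation in their interior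
  (\<open>many_unobserved_cells\<close>). Each of these cells contributes \<open>\<theta> * sqrt h\<close> up to a constant, and the sum
  is of order \<open>n * h * sqrt h\<close>, that is, \<open>1 / sqrt n\<close> (\<open>observation_error\<close>).
\<close>

section \<open>Functions that are measurable in one variable and continuous in the other\<close>

text \<open>Rounding the second argument down to a multiple of \<open>1 / k\<close> leaves countably many values of it.\<close>

lemma borel_measurable_Caratheodory:
  fixes f :: "'a \<Rightarrow> real \<Rightarrow> real"
  assumes meas: "\<And>x. (\<lambda>w. f w x) \<in> borel_measurable N"
    and cont: "\<And>w. w \<in> space N \<Longrightarrow> continuous_on UNIV (f w)"
  shows "(\<lambda>(w, x). f w x) \<in> borel_measurable (N \<Otimes>\<^sub>M borel)"
proof (rule borel_measurable_LIMSEQ_real)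
  let ?a = "\<lambda>k x::real. real_of_int \<lfloor>real (Suc k) * x\<rfloor> / real (Suc k)"
  show "(\<lambda>p. f (fst p) (?a k (snd p))) \<in> borel_measurable (N \<Otimes>\<^sub>M borel)" for k :: nat
  proof -
    have "(\<lambda>p. (\<lambda>i p. f (fst p) (real_of_int i / real (Suc k)))
        \<lfloor>real (Suc k) * snd p\<rfloor> p) \<in> borel_measurable (N \<Otimes>\<^sub>M borel)"
    proof (rule measurable_compose_countable[where
        f = "\<lambda>i p. f (fst p) (real_of_int i / real (Suc k))" and g = "\<lambda>p. \<lfloor>real (Suc k) * snd p\<rfloor>"])
      show "(\<lambda>p. f (fst p) (real_of_int i / real (Suc k))) \<in> borel_measurable (N \<Otimes>\<^sub>M borel)" for i :: int
        by (rule measurable_compose[OF measurable_fst meas])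
    qed measurable
    then show ?thesis by simp
  qed
next
  let ?a = "\<lambda>k x::real. real_of_int \<lfloor>real (Suc k) * x\<rfloor> / real (Suc k)"
  fix p assume p: "p \<in> space (N \<Otimes>\<^sub>M (borel :: real measure))"
  obtain w x where [simp]: "p = (w, x)" by (cases p)
  have "w \<in> space N" using p by (simp add: space_pair_measure)
  have "(\<lambda>k. ?a k x) \<longlonglongrightarrow> x"
  proof (rule tendsto_sandwich)
    show "(\<lambda>k. x - 1 / real (Suc k)) \<longlonglongrightarrow> x" "(\<lambda>k. x) \<longlonglongrightarrow> x"
      using tendsto_diff[OF tendsto_const LIMSEQ_Suc[OF lim_const_over_n], of x "1::real"] by auto
    show "\<forall>\<^sub>F k in sequentially. x - 1 / real (Suc k) \<le> ?a k x"
    proof (rule always_eventually, rule allI)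
      fix k
      have "real (Suc k) * x - 1 \<le> real_of_int \<lfloor>real (Suc k) * x\<rfloor>" by linarith
      then have "(real (Suc k) * x - 1) / real (Suc k) \<le> ?a k x"
        by (intro divide_right_mono) auto
      then show "x - 1 / real (Suc k) \<le> ?a k x" by (simp add: diff_divide_distrib)
    qed
    show "\<forall>\<^sub>F k in sequentially. ?a k x \<le> x"
      by (intro always_eventually allI, subst pos_divide_le_eq) (auto simp: mult.commute)
  qed
  moreover have "isCont (f w) x"
    using cont[OF \<open>w \<in> space N\<close>] by (simp add: continuous_on_eq_continuous_at)
  ultimately show "(\<lambda>k. f (fst p) (?a k (snd p))) \<longlonglongrightarrow> (case p of (w, x) \<Rightarrow> f w x)"
    using isCont_tendsto_compose by auto
qed

section \<open>Brownian increments given the past\<close>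

locale brownian_motion = usual_filtered_prob_space M F
  for M :: "'a measure" and F +
  fixes W :: "real \<Rightarrow> 'a \<Rightarrow> real"
  assumes standard_brownian: "standard_brownian_motion M F W"
begin

lemma space_F: "0 \<le> t \<Longrightarrow> space (F t) = space M"
  using subalgebra_F[of t] by (simp add: subalgebra_def)

lemma measurable_F_imp_M: "0 \<le> t \<Longrightarrow> f \<in> measurable (F t) N \<Longrightarrow> f \<in> measurable M N"
  using measurable_from_subalg[OF subalgebra_F] by blast

lemma measurable_F_mono:
  assumes "0 \<le> s" "s \<le> t" "f \<in> measurable (F s) N" shows "f \<in> measurable (F t) N"
  using assms mono_F[of s t] space_F[of s] space_F[of t]
  by (auto simp: measurable_def)

lemma W_F: "0 \<le> s \<Longrightarrow> s \<le> t \<Longrightarrow> W s \<in> borel_measurable (F t)"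
  using standard_brownian measurable_F_mono[of s t] unfolding standard_brownian_motion_def by auto

lemma W_M: "0 \<le> s \<Longrightarrow> W s \<in> borel_measurable M"
  using W_F measurable_F_imp_M by blast

lemma increment_distributed:
  "0 \<le> s \<Longrightarrow> s < t \<Longrightarrow> distributed M lborel (\<lambda>\<omega>. W t \<omega> - W s \<omega>) (normal_density 0 (sqrt (t - s)))"
  using standard_brownian unfolding standard_brownian_motion_def by blast

lemma prob_past_increment:
  assumes "0 \<le> s" "s < t" "A \<in> sets (F s)" "B \<in> sets borel"
  shows "prob (A \<inter> ((\<lambda>\<omega>. W t \<omega> - W s \<omega>) -` B \<inter> space M)) =
    prob A * prob ((\<lambda>\<omega>. W t \<omega> - W s \<omega>) -` B \<inter> space M)"
proof -
  have "indep_set (sets (F s)) (sets (vimage_algebra (space M) (\<lambda>\<omega>. W t \<omega> - W s \<omega>) borel))"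
    using standard_brownian assms unfolding standard_brownian_motion_def by blast
  then show ?thesis
    by (rule indep_setD) (use assms in \<open>auto intro: in_vimage_algebra\<close>)
qed

text \<open>Conditioning on \<open>F s\<close>. The whole sample point serves as the \<open>F s\<close>-measurable coordinate, so
  \<open>f\<close> may depend on the past in any way; independence says that the point and the increment have a
  product law on \<open>F s \<Otimes>\<^sub>M borel\<close>.\<close>

lemma nn_integral_increment:
  assumes st: "0 \<le> s" "s < t" and f: "f \<in> borel_measurable (F s \<Otimes>\<^sub>M borel)"
  shows "(\<integral>\<^sup>+\<omega>. f (\<omega>, W t \<omega> - W s \<omega>) \<partial>M) =
    (\<integral>\<^sup>+\<omega>. (\<integral>\<^sup>+z. ennreal (normal_density 0 (sqrt (t - s)) z) * f (\<omega>, z) \<partial>lborel) \<partial>M)"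
proof -
  let ?Z = "\<lambda>\<omega>. W t \<omega> - W s \<omega>"
  let ?N = "density lborel (\<lambda>z. ennreal (normal_density 0 (sqrt (t - s)) z))"
  have id: "(\<lambda>\<omega>. \<omega>) \<in> measurable M (F s)"
    using st by (intro measurable_F_imp_M[of s]) auto
  have Z: "?Z \<in> borel_measurable M" using st W_M by auto
  have joint: "distr M (F s) (\<lambda>\<omega>. \<omega>) \<Otimes>\<^sub>M distr M borel ?Z = distr M (F s \<Otimes>\<^sub>M borel) (\<lambda>\<omega>. (\<omega>, ?Z \<omega>))"
  proof (rule pair_measure_eqI)
    show "sigma_finite_measure (distr M (F s) (\<lambda>\<omega>. \<omega>))" "sigma_finite_measure (distr M borel ?Z)"
      using prob_space_distr[OF id] prob_space_distr[OF Z] prob_space_imp_sigma_finite by auto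
    fix A B assume AB: "A \<in> sets (distr M (F s) (\<lambda>\<omega>. \<omega>))" "B \<in> sets (distr M borel ?Z)"
    then have A: "A \<subseteq> space M" using sets.sets_into_space[of A "F s"] space_F[OF st(1)] by auto
    have "(\<lambda>\<omega>. (\<omega>, ?Z \<omega>)) -` (A \<times> B) \<inter> space M = A \<inter> (?Z -` B \<inter> space M)" by auto
    moreover have "(\<lambda>\<omega>. \<omega>) -` A \<inter> space M = A" using A by auto
    moreover have "(\<lambda>\<omega>. (\<omega>, ?Z \<omega>)) \<in> measurable M (F s \<Otimes>\<^sub>M borel)" using id Z by measurable
    ultimately show "emeasure (distr M (F s) (\<lambda>\<omega>. \<omega>)) A * emeasure (distr M borel ?Z) B =
        emeasure (distr M (F s \<Otimes>\<^sub>M borel) (\<lambda>\<omega>. (\<omega>, ?Z \<omega>))) (A \<times> B)"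
      using AB id Z prob_past_increment[OF st, of A B]
      by (simp add: emeasure_distr emeasure_eq_measure ennreal_mult')
  qed simp
  have law: "distr M borel ?Z = ?N"
    using increment_distributed[OF st] by (auto simp: distributed_def intro!: measure_eqI)
       (metis distr_cong sets_lborel)
  interpret N: prob_space "distr M borel ?Z" by (rule prob_space_distr[OF Z])
  have f': "f \<in> borel_measurable (distr M (F s) (\<lambda>\<omega>. \<omega>) \<Otimes>\<^sub>M distr M borel ?Z)"
    using f by (simp cong: measurable_cong_sets)
  have inner: "(\<integral>\<^sup>+z. f (\<omega>, z) \<partial>distr M borel ?Z) =
      (\<integral>\<^sup>+z. ennreal (normal_density 0 (sqrt (t - s)) z) * f (\<omega>, z) \<partial>lborel)"
    if "\<omega> \<in> space (F s)" for \<omega>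
    unfolding law using that f by (subst nn_integral_density) auto
  have "(\<integral>\<^sup>+\<omega>. f (\<omega>, ?Z \<omega>) \<partial>M) = (\<integral>\<^sup>+p. f p \<partial>distr M (F s \<Otimes>\<^sub>M borel) (\<lambda>\<omega>. (\<omega>, ?Z \<omega>)))"
    using id Z f by (subst nn_integral_distr) auto
  also have "\<dots> = (\<integral>\<^sup>+\<omega>. (\<integral>\<^sup>+z. f (\<omega>, z) \<partial>distr M borel ?Z) \<partial>distr M (F s) (\<lambda>\<omega>. \<omega>))"
    unfolding joint[symmetric] using N.nn_integral_fst[OF f'] by simp
  also have "\<dots> = (\<integral>\<^sup>+\<omega>. (\<integral>\<^sup>+z. f (\<omega>, z) \<partial>distr M borel ?Z) \<partial>M)"
  proof (rule nn_integral_distr[OF id])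
    show "(\<lambda>\<omega>. \<integral>\<^sup>+z. f (\<omega>, z) \<partial>distr M borel ?Z) \<in> borel_measurable (distr M (F s) (\<lambda>\<omega>. \<omega>))"
      using f' N.borel_measurable_nn_integral_fst[of f "F s"] f
      by (simp cong: measurable_cong_sets)
  qed
  also have "\<dots> = (\<integral>\<^sup>+\<omega>. (\<integral>\<^sup>+z. ennreal (normal_density 0 (sqrt (t - s)) z) * f (\<omega>, z) \<partial>lborel) \<partial>M)"
    using inner space_F[OF st(1)] by (intro nn_integral_cong) auto
  finally show ?thesis .
qed

lemma increment_moments:
  assumes "0 \<le> s" "s \<le> t"
  shows "integrable M (\<lambda>\<omega>. W t \<omega> - W s \<omega>)" "expectation (\<lambda>\<omega>. W t \<omega> - W s \<omega>) = 0"
    "integrable M (\<lambda>\<omega>. (W t \<omega> - W s \<omega>)\<^sup>2)" "expectation (\<lambda>\<omega>. (W t \<omega> - W s \<omega>)\<^sup>2) = t - s"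
proof -
  let ?Z = "\<lambda>\<omega>. W t \<omega> - W s \<omega>"
  have "integrable M ?Z \<and> expectation ?Z = 0 \<and> integrable M (\<lambda>\<omega>. (?Z \<omega>)\<^sup>2) \<and> expectation (\<lambda>\<omega>. (?Z \<omega>)\<^sup>2) = t - s"
  proof (cases "s = t")
    case False
    then have st: "s < t" using assms by auto
    note D = increment_distributed[OF assms(1) st]
    have sq: "0 < sqrt (t - s)" using st by simp
    have m1: "integrable lborel (\<lambda>z. normal_density 0 (sqrt (t - s)) z * z)"
      using integrable_normal_moment[OF sq, of 0 1] by simp
    have m2: "integrable lborel (\<lambda>z. normal_density 0 (sqrt (t - s)) z * z\<^sup>2)"
      using integrable_normal_moment[OF sq, of 0 2] by simp
    have i1: "integrable M ?Z" using distributed_integrable[OF D, of "\<lambda>z. z"] m1 by simp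
    have e1: "expectation ?Z = 0" using normal_distributed_expectation[OF _ D] sq by simp
    have i2: "integrable M (\<lambda>\<omega>. (?Z \<omega>)\<^sup>2)"
      using distributed_integrable[OF D, of "\<lambda>z. z\<^sup>2"] m2 by simp
    have "variance ?Z = (sqrt (t - s))\<^sup>2" using normal_distributed_variance[OF sq D] .
    then show ?thesis using i1 e1 i2 st by simp
  qed simp
  then show "integrable M ?Z" "expectation ?Z = 0"
    "integrable M (\<lambda>\<omega>. (?Z \<omega>)\<^sup>2)" "expectation (\<lambda>\<omega>. (?Z \<omega>)\<^sup>2) = t - s" by auto
qed

lemma integral_mult_increment:
  assumes st: "0 \<le> s" "s \<le> t" and V: "V \<in> borel_measurable (F s)" "integrable M V"
  shows "integrable M (\<lambda>\<omega>. V \<omega> * (W t \<omega> - W s \<omega>))"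
    "expectation (\<lambda>\<omega>. V \<omega> * (W t \<omega> - W s \<omega>)) = 0"
    "integrable M (\<lambda>\<omega>. V \<omega> * (W t \<omega> - W s \<omega>)\<^sup>2)"
    "expectation (\<lambda>\<omega>. V \<omega> * (W t \<omega> - W s \<omega>)\<^sup>2) = expectation V * (t - s)"
proof -
  let ?Z = "\<lambda>\<omega>. W t \<omega> - W s \<omega>"
  note m = increment_moments[OF st]
  have *: "integrable M (\<lambda>\<omega>. V \<omega> * ?Z \<omega>) \<and> expectation (\<lambda>\<omega>. V \<omega> * ?Z \<omega>) = 0 \<and>
    integrable M (\<lambda>\<omega>. V \<omega> * (?Z \<omega>)\<^sup>2) \<and> expectation (\<lambda>\<omega>. V \<omega> * (?Z \<omega>)\<^sup>2) = expectation V * (t - s)"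
  proof (cases "s = t")
    case False
    then have "indep_set (sets (F s)) (sets (vimage_algebra (space M) ?Z borel))"
      using standard_brownian st unfolding standard_brownian_motion_def by auto
    moreover have "sigma_sets (space M) {V -` A \<inter> space M |A. A \<in> sets borel} \<subseteq> sets (F s)"
      using measurable_sets[OF V(1)] space_F[OF st(1)]
      by (subst space_F[OF st(1), symmetric], intro sets.sigma_sets_subset) auto
    moreover have "sigma_sets (space M) {?Z -` A \<inter> space M |A. A \<in> sets borel}
      = sets (vimage_algebra (space M) ?Z borel)"
      by (simp add: sets_vimage_algebra)
    ultimately have "indep_set (sigma_sets (space M) {V -` A \<inter> space M |A. A \<in> sets borel})
        (sigma_sets (space M) {?Z -` A \<inter> space M |A. A \<in> sets borel})"
      unfolding indep_set_def by (elim indep_sets_mono_sets) (simp split: bool.split)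
    then have i1: "indep_var borel V borel ?Z"
      using V m by (simp add: indep_var_eq)
    have i2: "indep_var borel V borel (\<lambda>\<omega>. (?Z \<omega>)\<^sup>2)"
      using indep_var_compose[OF i1, of "\<lambda>z. z" borel "\<lambda>z. z\<^sup>2" borel] by (simp add: comp_def)
    show ?thesis
      using indep_var_lebesgue_integral[OF i1 V(2) m(1)] indep_var_integrable[OF i1 V(2) m(1)]
        indep_var_lebesgue_integral[OF i2 V(2) m(3)] indep_var_integrable[OF i2 V(2) m(3)] m by simp
  qed simp
  show "integrable M (\<lambda>\<omega>. V \<omega> * ?Z \<omega>)" "expectation (\<lambda>\<omega>. V \<omega> * ?Z \<omega>) = 0"
    "integrable M (\<lambda>\<omega>. V \<omega> * (?Z \<omega>)\<^sup>2)"
    "expectation (\<lambda>\<omega>. V \<omega> * (?Z \<omega>)\<^sup>2) = expectation V * (t - s)" using * by auto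
qed

end

section \<open>Ito integrals on small intervals\<close>
context brownian_motion
begin

text \<open>When the square of the sum up to \<open>Suc n\<close> is expanded, the cross term has mean zero, because the sum up to \<open>n\<close>
  and \<open>V n\<close> are known at time \<open>r n\<close>.\<close>

lemma martingale_transform_L2:
  fixes r :: "nat \<Rightarrow> real"
  assumes r0: "\<And>i. p \<le> i \<Longrightarrow> i \<le> q \<Longrightarrow> 0 \<le> r i"
    and r: "\<And>i. p \<le> i \<Longrightarrow> i < q \<Longrightarrow> r i \<le> r (Suc i)"
    and V: "\<And>i. p \<le> i \<Longrightarrow> i < q \<Longrightarrow> V i \<in> borel_measurable (F (r i))"
    and C: "\<And>i \<omega>. p \<le> i \<Longrightarrow> i < q \<Longrightarrow> \<omega> \<in> space M \<Longrightarrow> \<bar>V i \<omega>\<bar> \<le> C i"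
    and "p \<le> q"
  shows "integrable M (\<lambda>\<omega>. (\<Sum>i=p..<q. V i \<omega> * (W (r (Suc i)) \<omega> - W (r i) \<omega>))\<^sup>2)"
    "expectation (\<lambda>\<omega>. (\<Sum>i=p..<q. V i \<omega> * (W (r (Suc i)) \<omega> - W (r i) \<omega>))\<^sup>2) =
      expectation (\<lambda>\<omega>. \<Sum>i=p..<q. (V i \<omega>)\<^sup>2 * (r (Suc i) - r i))"
proof -
  define I where "I n \<omega> = (\<Sum>i=p..<n. V i \<omega> * (W (r (Suc i)) \<omega> - W (r i) \<omega>))" for n \<omega>
  have VM: "V i \<in> borel_measurable M" if "p \<le> i" "i < q" for i
    using measurable_F_imp_M[OF r0 V[OF that]] that by auto
  have V2: "integrable M (\<lambda>\<omega>. (V i \<omega>)\<^sup>2)" if "p \<le> i" "i < q" for i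
  proof (rule integrable_const_bound[where B = "(C i)\<^sup>2"])
    show "AE \<omega> in M. norm ((V i \<omega>)\<^sup>2) \<le> (C i)\<^sup>2"
      using C[OF that] power_mono[OF C[OF that] abs_ge_zero, of _ 2] by auto
  qed (use VM[OF that] in measurable)
  have rmono: "r i \<le> r n" if "p \<le> i" "i \<le> n" "n \<le> q" for i n
    using that(2,3) by (induction rule: dec_induct) (use r that in \<open>auto intro: order_trans\<close>)
  have IF: "I n \<in> borel_measurable (F (r n))" if "p \<le> n" "n \<le> q" for n
    unfolding I_def
  proof (rule borel_measurable_sum)
    fix i assume i: "i \<in> {p..<n}"
    then have "V i \<in> borel_measurable (F (r n))" "W (r i) \<in> borel_measurable (F (r n))"
      "W (r (Suc i)) \<in> borel_measurable (F (r n))"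
      using that by (auto intro!: W_F measurable_F_mono[OF _ _ V[of i]] rmono r0)
    then show "(\<lambda>\<omega>. V i \<omega> * (W (r (Suc i)) \<omega> - W (r i) \<omega>)) \<in> borel_measurable (F (r n))"
      by measurable
  qed
  have "integrable M (\<lambda>\<omega>. (I n \<omega>)\<^sup>2) \<and>
    expectation (\<lambda>\<omega>. (I n \<omega>)\<^sup>2) = expectation (\<lambda>\<omega>. \<Sum>i=p..<n. (V i \<omega>)\<^sup>2 * (r (Suc i) - r i))"
    if "p \<le> n" "n \<le> q" for n
    using that
  proof (induction n rule: dec_induct)
    case base then show ?case by (simp add: I_def)
  next
    case (step n)
    let ?Z = "\<lambda>\<omega>. W (r (Suc n)) \<omega> - W (r n) \<omega>"
    from step have IH: "integrable M (\<lambda>\<omega>. (I n \<omega>)\<^sup>2)"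
        "expectation (\<lambda>\<omega>. (I n \<omega>)\<^sup>2) = expectation (\<lambda>\<omega>. \<Sum>i=p..<n. (V i \<omega>)\<^sup>2 * (r (Suc i) - r i))" by auto
    have n: "p \<le> n" "n < q" "0 \<le> r n" "r n \<le> r (Suc n)" using step r r0 by auto
    have InM: "I n \<in> borel_measurable M" using measurable_F_imp_M[OF n(3) IF] n by auto
    have In: "integrable M (I n)" using square_integrable_imp_integrable[OF InM IH(1)] .
    have IV: "integrable M (\<lambda>\<omega>. I n \<omega> * V n \<omega>)"
    proof (rule Bochner_Integration.integrable_bound)
      show "integrable M (\<lambda>\<omega>. C n * I n \<omega>)" using In by simp
      show "AE \<omega> in M. norm (I n \<omega> * V n \<omega>) \<le> norm (C n * I n \<omega>)"
      proof (rule AE_I2)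
        fix \<omega> assume "\<omega> \<in> space M"
        then have "\<bar>V n \<omega>\<bar> \<le> \<bar>C n\<bar>" using C[OF n(1,2)] by force
        then show "norm (I n \<omega> * V n \<omega>) \<le> norm (C n * I n \<omega>)"
          by (simp add: abs_mult mult.commute[of "\<bar>C n\<bar>"] mult_left_mono)
      qed
    qed (use InM VM[OF n(1,2)] in measurable)
    have IVF: "(\<lambda>\<omega>. I n \<omega> * V n \<omega>) \<in> borel_measurable (F (r n))"
      using IF[of n] V[OF n(1,2)] n by auto
    have V2F: "(\<lambda>\<omega>. (V n \<omega>)\<^sup>2) \<in> borel_measurable (F (r n))" using V[OF n(1,2)] by auto
    note A = integral_mult_increment[OF n(3,4) IVF IV]
    note B = integral_mult_increment[OF n(3,4) V2F V2[OF n(1,2)]]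
    have eq: "(I (Suc n) \<omega>)\<^sup>2 = (I n \<omega>)\<^sup>2 + 2 * (I n \<omega> * V n \<omega> * ?Z \<omega>) + (V n \<omega>)\<^sup>2 * (?Z \<omega>)\<^sup>2" for \<omega>
      using n by (simp add: I_def power2_eq_square algebra_simps)
    have S: "integrable M (\<lambda>\<omega>. \<Sum>i=p..<n. (V i \<omega>)\<^sup>2 * (r (Suc i) - r i))"
      by (intro Bochner_Integration.integrable_sum integrable_mult_left) (use V2 n in auto)
    show ?case
      using IH A B S V2[OF n(1,2)] n unfolding eq by (auto simp: Bochner_Integration.integral_add)
  qed
  from this[OF \<open>p \<le> q\<close>] show "integrable M (\<lambda>\<omega>. (\<Sum>i=p..<q. V i \<omega> * (W (r (Suc i)) \<omega> - W (r i) \<omega>))\<^sup>2)"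
    "expectation (\<lambda>\<omega>. (\<Sum>i=p..<q. V i \<omega> * (W (r (Suc i)) \<omega> - W (r i) \<omega>))\<^sup>2) =
      expectation (\<lambda>\<omega>. \<Sum>i=p..<q. (V i \<omega>)\<^sup>2 * (r (Suc i) - r i))"
    by (auto simp: I_def)
qed

text \<open>Chebyshev's inequality for the sum stopped before \<open>\<Sum>i. (V i)\<^sup>2 * (r (Suc i) - r i)\<close> exceeds \<open>\<beta>\<close>.
  The stopped weights are still known at the left endpoints, and on the event in question
  nothing is stopped. Thus the bound needs control of the quadratic variation on that event only.\<close>

lemma martingale_transform_tail:
  fixes r :: "nat \<Rightarrow> real"
  assumes r0: "\<And>i. p \<le> i \<Longrightarrow> i \<le> q \<Longrightarrow> 0 \<le> r i"
    and r: "\<And>i. p \<le> i \<Longrightarrow> i < q \<Longrightarrow> r i \<le> r (Suc i)"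
    and V: "\<And>i. p \<le> i \<Longrightarrow> i < q \<Longrightarrow> V i \<in> borel_measurable (F (r i))"
    and C: "\<And>i \<omega>. p \<le> i \<Longrightarrow> i < q \<Longrightarrow> \<omega> \<in> space M \<Longrightarrow> \<bar>V i \<omega>\<bar> \<le> C i"
    and pq: "p \<le> q" and \<alpha>: "0 < \<alpha>" and \<beta>: "0 \<le> \<beta>"
  shows "prob {\<omega>\<in>space M. \<alpha> < \<bar>\<Sum>i=p..<q. V i \<omega> * (W (r (Suc i)) \<omega> - W (r i) \<omega>)\<bar> \<and>
      (\<Sum>i=p..<q. (V i \<omega>)\<^sup>2 * (r (Suc i) - r i)) \<le> \<beta>} \<le> \<beta> / \<alpha>\<^sup>2"
proof -
  define Q where "Q n \<omega> = (\<Sum>i=p..<n. (V i \<omega>)\<^sup>2 * (r (Suc i) - r i))" for n \<omega>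
  \<comment> \<open>the weight at \<open>i\<close> decides with its own contribution included, which is known at time \<open>r i\<close>\<close>
  define U where "U i \<omega> = (if Q (Suc i) \<omega> \<le> \<beta> then V i \<omega> else 0)" for i \<omega>
  let ?I = "\<lambda>\<omega>. \<Sum>i=p..<q. U i \<omega> * (W (r (Suc i)) \<omega> - W (r i) \<omega>)"
  have rmono: "r i \<le> r n" if "p \<le> i" "i \<le> n" "n \<le> q" for i n
    using that(2,3) by (induction rule: dec_induct) (use r that in \<open>auto intro: order_trans\<close>)
  have QF: "Q (Suc i) \<in> borel_measurable (F (r i))" if "p \<le> i" "i < q" for i
    unfolding Q_def
  proof (rule borel_measurable_sum)
    fix j assume j: "j \<in> {p..<Suc i}"
    then have "V j \<in> borel_measurable (F (r i))"
      using that by (auto intro!: measurable_F_mono[OF _ _ V[of j]] rmono r0)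
    then show "(\<lambda>\<omega>. (V j \<omega>)\<^sup>2 * (r (Suc j) - r j)) \<in> borel_measurable (F (r i))" by measurable
  qed
  have UF: "U i \<in> borel_measurable (F (r i))" if "p \<le> i" "i < q" for i
    unfolding U_def using QF[OF that] V[OF that] by measurable
  have UC: "\<bar>U i \<omega>\<bar> \<le> C i" if "p \<le> i" "i < q" "\<omega> \<in> space M" for i \<omega>
    using C[OF that] by (auto simp: U_def)
  note L = martingale_transform_L2[where V = U and r = r and C = C, OF r0 r UF UC pq]
  have Umono: "Q m \<omega> \<le> Q n \<omega>" if "m \<le> n" "n \<le> q" for m n \<omega>
    unfolding Q_def by (rule sum_mono2) (use that r in auto)
  have le: "(\<Sum>i=p..<n. (U i \<omega>)\<^sup>2 * (r (Suc i) - r i)) \<le> \<beta>" if "p \<le> n" "n \<le> q" for n \<omega>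
    using that
  proof (induction n rule: dec_induct)
    case base then show ?case using \<beta> by simp
  next
    case (step n)
    show ?case
    proof (cases "Q (Suc n) \<omega> \<le> \<beta>")
      case True
      have "U i \<omega> = V i \<omega>" if "i \<in> {p..<Suc n}" for i
        using Umono[of "Suc i" "Suc n" \<omega>] that step True by (auto simp: U_def)
      then have "(\<Sum>i=p..<Suc n. (U i \<omega>)\<^sup>2 * (r (Suc i) - r i)) = Q (Suc n) \<omega>"
        unfolding Q_def by (intro sum.cong) auto
      then show ?thesis using True by simp
    qed (use step in \<open>auto simp: U_def\<close>)
  qed
  have "prob {\<omega>\<in>space M. \<alpha> < \<bar>\<Sum>i=p..<q. V i \<omega> * (W (r (Suc i)) \<omega> - W (r i) \<omega>)\<bar> \<and> Q q \<omega> \<le> \<beta>}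
      \<le> prob {\<omega>\<in>space M. \<alpha>\<^sup>2 \<le> (?I \<omega>)\<^sup>2}"
  proof (rule finite_measure_mono)
    show "{\<omega>\<in>space M. \<alpha> < \<bar>\<Sum>i=p..<q. V i \<omega> * (W (r (Suc i)) \<omega> - W (r i) \<omega>)\<bar> \<and> Q q \<omega> \<le> \<beta>}
      \<subseteq> {\<omega>\<in>space M. \<alpha>\<^sup>2 \<le> (?I \<omega>)\<^sup>2}"
    proof safe
      fix \<omega> assume h: "\<alpha> < \<bar>\<Sum>i=p..<q. V i \<omega> * (W (r (Suc i)) \<omega> - W (r i) \<omega>)\<bar>" "Q q \<omega> \<le> \<beta>"
      have "U i \<omega> = V i \<omega>" if "i \<in> {p..<q}" for i
        using Umono[of "Suc i" q \<omega>] that h(2) by (auto simp: U_def)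
      then have "?I \<omega> = (\<Sum>i=p..<q. V i \<omega> * (W (r (Suc i)) \<omega> - W (r i) \<omega>))" by (intro sum.cong) auto
      then show "\<alpha>\<^sup>2 \<le> (?I \<omega>)\<^sup>2" using h(1) \<alpha> by (subst abs_le_square_iff[symmetric]) auto
    qed
    show "{\<omega>\<in>space M. \<alpha>\<^sup>2 \<le> (?I \<omega>)\<^sup>2} \<in> events"
      using borel_measurable_integrable[OF L(1)] by measurable
  qed
  also have "\<dots> \<le> expectation (\<lambda>\<omega>. (?I \<omega>)\<^sup>2) / \<alpha>\<^sup>2"
    by (rule integral_Markov_inequality_measure[where A = "space M", OF L(1), simplified]) (use \<alpha> in auto)
  also have "\<dots> \<le> \<beta> / \<alpha>\<^sup>2"
  proof (rule divide_right_mono)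
    note L(2)
    also have "expectation (\<lambda>\<omega>. \<Sum>i=p..<q. (U i \<omega>)\<^sup>2 * (r (Suc i) - r i)) \<le> expectation (\<lambda>_. \<beta>)"
      by (rule integral_mono_AE') (use le[OF pq] \<beta> in auto)
    finally show "expectation (\<lambda>\<omega>. (?I \<omega>)\<^sup>2) \<le> \<beta>" by (simp add: prob_space)
  qed simp
  finally show ?thesis by (simp add: Q_def)
qed

end

lemma finite_partition:
  fixes P :: "real set"
  assumes "finite P" "P \<noteq> {}"
  obtains r :: "nat \<Rightarrow> real" and N where "P = r ` {..N}" "\<forall>i j. i < j \<longrightarrow> j \<le> N \<longrightarrow> r i < r j"
proof -
  define xs where "xs = sorted_list_of_set P"
  have xs: "set xs = P" "xs \<noteq> []" "sorted_wrt (<) xs"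
    using assms by (auto simp: xs_def)
  have "set xs = (\<lambda>i. xs ! i) ` {..length xs - 1}"
  proof -
    have "{..length xs - 1} = {0..<length xs}" using xs(2) by (cases xs) auto
    then show ?thesis by (auto simp: set_conv_nth)
  qed
  moreover have "xs ! i < xs ! j" if "i < j" "j \<le> length xs - 1" for i j
    using sorted_wrt_nth_less[OF xs(3)] that xs(2) by (cases xs) auto
  ultimately show ?thesis using that xs(1) by metis
qed

definition no_jump :: "'a simple_process \<Rightarrow> real \<Rightarrow> real \<Rightarrow> bool" where
  "no_jump S s t \<longleftrightarrow> (\<forall>(a, b, \<eta>)\<in>set S. a \<le> b \<and> (a \<le> s \<or> t \<le> a) \<and> (b \<le> s \<or> t \<le> b))"

lemma simple_integral_no_jump:
  assumes "no_jump S s t" "s < t"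
  shows "simple_integral W S t \<omega> =
    simple_integral W S s \<omega> + simple_value S t \<omega> * (W t \<omega> - W s \<omega>)"
  using assms
proof (induction S)
  case (Cons x S)
  obtain a b \<eta> where x: "x = (a, b, \<eta>)" by (cases x)
  have IH: "simple_integral W S t \<omega> =
    simple_integral W S s \<omega> + simple_value S t \<omega> * (W t \<omega> - W s \<omega>)"
    using Cons by (auto simp: no_jump_def)
  have h: "a \<le> b" "a \<le> s \<or> t \<le> a" "b \<le> s \<or> t \<le> b" using Cons x by (auto simp: no_jump_def)
  have "\<eta> \<omega> * (W (min b t) \<omega> - W (min a t) \<omega>) = \<eta> \<omega> * (W (min b s) \<omega> - W (min a s) \<omega>) +
    \<eta> \<omega> * indicator {a<..b} t * (W t \<omega> - W s \<omega>)"
    using h Cons.prems(2) by (auto simp: min_def indicator_def algebra_simps)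
  then show ?case
    using IH unfolding simple_integral_def simple_value_def x by (simp add: algebra_simps)
qed (simp add: simple_integral_def simple_value_def)

lemma simple_value_no_jump:
  assumes "no_jump S s t" "v \<in> {s<..t}"
  shows "simple_value S v \<omega> = simple_value S t \<omega>"
  using assms
proof (induction S)
  case (Cons x S)
  obtain a b \<eta> where x: "x = (a, b, \<eta>)" by (cases x)
  have "indicator {a<..b} v = (indicator {a<..b} t :: real)"
    using Cons.prems x by (auto simp: no_jump_def indicator_def)
  then show ?case
    using Cons unfolding simple_value_def x by (auto simp: no_jump_def)
qed (simp add: simple_value_def)

lemma borel_measurable_simple_value:
  "(\<lambda>v. simple_value S v \<omega>) \<in> borel_measurable borel"
proof (induction S)
  case (Cons x S)
  obtain a b \<eta> where x: "x = (a, b, \<eta>)" by (cases x)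
  have "(\<lambda>v. \<eta> \<omega> * indicator {a<..b} v + simple_value S v \<omega>) \<in> borel_measurable borel"
    using Cons by measurable
  then show ?case by (simp add: simple_value_def x)
qed (simp add: simple_value_def)

context brownian_motion
begin

lemma simple_value_past:
  assumes "S \<in> simple_processes M F T" "no_jump S s t" "s < t" "0 \<le> s"
  shows "simple_value S t \<in> borel_measurable (F s)" "\<exists>C. \<forall>\<omega>\<in>space M. \<bar>simple_value S t \<omega>\<bar> \<le> C"
proof -
  have "simple_value S t \<in> borel_measurable (F s) \<and> (\<exists>C. \<forall>\<omega>\<in>space M. \<bar>simple_value S t \<omega>\<bar> \<le> C)"
    using assms(1,2)
  proof (induction S)
    case Nil then show ?case by (auto simp: simple_value_def)
  next
    case (Cons x S)
    obtain a b \<eta> where x: "x = (a, b, \<eta>)" by (cases x)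
    have S: "S \<in> simple_processes M F T" "no_jump S s t"
      using Cons.prems by (auto simp: simple_processes_def no_jump_def)
    have h: "0 \<le> a" "a \<le> s \<or> t \<le> a" "\<eta> \<in> borel_measurable (F a)" "\<exists>C. \<forall>\<omega>\<in>space M. \<bar>\<eta> \<omega>\<bar> \<le> C"
      using Cons.prems x by (auto simp: no_jump_def simple_processes_def)
    obtain C1 where C1: "\<forall>\<omega>\<in>space M. \<bar>simple_value S t \<omega>\<bar> \<le> C1" using Cons.IH[OF S] by auto
    obtain C2 where C2: "\<forall>\<omega>\<in>space M. \<bar>\<eta> \<omega>\<bar> \<le> C2" using h by auto
    have eq: "simple_value (x # S) t = (\<lambda>\<omega>. \<eta> \<omega> * indicator {a<..b} t + simple_value S t \<omega>)"
      by (simp add: simple_value_def x fun_eq_iff)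
    have "(\<lambda>\<omega>. \<eta> \<omega> * indicator {a<..b} t) \<in> borel_measurable (F s)"
    proof (cases "a \<le> s")
      case True
      then show ?thesis using measurable_F_mono[OF h(1) True h(3)] by measurable
    next
      case False
      then show ?thesis using h(2) assms(3) by (simp add: indicator_def)
    qed
    moreover have "\<bar>\<eta> \<omega> * indicator {a<..b} t + simple_value S t \<omega>\<bar> \<le> C2 + C1" if "\<omega> \<in> space M" for \<omega>
      using C1[rule_format, OF that] C2[rule_format, OF that] by (auto simp: indicator_def)
    ultimately show ?case unfolding eq using Cons.IH[OF S] by auto
  qed
  then show "simple_value S t \<in> borel_measurable (F s)" "\<exists>C. \<forall>\<omega>\<in>space M. \<bar>simple_value S t \<omega>\<bar> \<le> C"
    by auto
qed

text \<open>Cutting \<open>S\<close> at all its endpoints and at \<open>a\<close> and \<open>u\<close> turns the integral over \<open>(a, u]\<close> into a sum over a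
  partition, in which subtracting \<open>\<eta>\<close>, known at time \<open>a\<close>, merely shifts the weights.\<close>

lemma simple_increment_tail:
  assumes S: "S \<in> simple_processes M F T" and au: "0 \<le> a" "a < u"
    and \<eta>: "\<eta> \<in> borel_measurable (F a)" "\<And>\<omega>. \<omega> \<in> space M \<Longrightarrow> \<bar>\<eta> \<omega>\<bar> \<le> K"
    and pos: "0 < \<alpha>" "0 \<le> \<beta>"
  defines "D \<equiv> {\<omega>\<in>space M. \<alpha> < \<bar>simple_integral W S u \<omega> - simple_integral W S a \<omega> - \<eta> \<omega> * (W u \<omega> - W a \<omega>)\<bar> \<and>
      (\<integral>\<^sup>+v\<in>{a<..u}. ennreal ((simple_value S v \<omega> - \<eta> \<omega>)\<^sup>2) \<partial>lborel) \<le> ennreal \<beta>}"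
  shows "D \<in> events" "prob D \<le> \<beta> / \<alpha>\<^sup>2"
proof -
  define P where "P = {a, u} \<union> fst ` set S \<union> (fst \<circ> snd) ` set S"
  have "finite P" "P \<noteq> {}" by (simp_all add: P_def)
  then obtain r :: "nat \<Rightarrow> real" and N
    where r: "P = r ` {..N}" and r_all: "\<forall>i j. i < j \<longrightarrow> j \<le> N \<longrightarrow> r i < r j"
    by (rule finite_partition)
  from r_all have r_less: "r i < r j" if "i < j" "j \<le> N" for i j using that by blast
  have P0: "0 \<le> x" if "x \<in> P" for x
  proof -
    have "0 \<le> fst y \<and> 0 \<le> fst (snd y)" if "y \<in> set S" for y
    proof -
      obtain c d \<zeta> where y: "y = (c, d, \<zeta>)" by (cases y)
      then show ?thesis using S that by (auto simp: simple_processes_def)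
    qed
    then show ?thesis using that au unfolding P_def by auto
  qed
  have "a \<in> P" "u \<in> P" by (auto simp: P_def)
  then obtain p q where p: "p \<le> N" "r p = a" and q: "q \<le> N" "r q = u"
    unfolding r by blast
  have "p < q"
  proof (rule ccontr)
    assume "\<not> p < q"
    then have "r q \<le> r p" using r_less[of q p] p(1) by (cases "q = p") auto
    then show False using p q au by simp
  qed
  have sep: "x \<le> r i \<or> r (Suc i) \<le> x" if x: "x \<in> P" and i: "i < q" for x i
  proof -
    obtain j where j: "x = r j" "j \<le> N" using x r by auto
    show ?thesis
    proof (cases "j \<le> i")
      case True then show ?thesis using r_less[of j i] i q j by (cases "j = i") auto
    next
      case False then show ?thesis using r_less[of "Suc i" j] j by (cases "j = Suc i") auto
    qed
  qed
  have nj: "no_jump S (r i) (r (Suc i))" if "i < q" for i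
    unfolding no_jump_def
  proof safe
    fix c d \<zeta> assume cd: "(c, d, \<zeta>) \<in> set S"
    then have "c \<in> P" "d \<in> P" by (force simp: P_def)+
    then show "\<not> r (Suc i) \<le> c \<Longrightarrow> c \<le> r i" "\<not> r (Suc i) \<le> d \<Longrightarrow> d \<le> r i"
      using sep[OF _ that] by auto
    show "c \<le> d" using S cd by (auto simp: simple_processes_def)
  qed
  have rlt: "r i < r (Suc i)" if "i < q" for i using r_less that q by auto
  have r0: "0 \<le> r i" if "i \<le> q" for i using P0 r that q by auto
  define V where "V i \<omega> = simple_value S (r (Suc i)) \<omega> - \<eta> \<omega>" for i \<omega>
  have ra: "a \<le> r i" if "p \<le> i" "i \<le> q" for i
    using r_less[of p i] that p q by (cases "p = i") auto
  have VF: "V i \<in> borel_measurable (F (r i))" if "p \<le> i" "i < q" for i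
    unfolding V_def using simple_value_past(1)[OF S nj rlt r0] measurable_F_mono[OF au(1) ra \<eta>(1)] that
    by (intro borel_measurable_diff) auto
  obtain C where C: "\<bar>simple_value S (r (Suc i)) \<omega>\<bar> \<le> C i" if "i < q" "\<omega> \<in> space M" for i \<omega>
  proof -
    have "\<forall>i. \<exists>c. i < q \<longrightarrow> (\<forall>\<omega>\<in>space M. \<bar>simple_value S (r (Suc i)) \<omega>\<bar> \<le> c)"
      using simple_value_past(2)[OF S nj rlt r0] by (meson order_less_imp_le)
    from choice[OF this] show ?thesis using that by blast
  qed
  have VC: "\<bar>V i \<omega>\<bar> \<le> C i + K" if "p \<le> i" "i < q" "\<omega> \<in> space M" for i \<omega>
    using C[OF that(2,3)] \<eta>(2)[OF that(3)] unfolding V_def by linarith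
  have int: "simple_integral W S (r n) \<omega> - simple_integral W S a \<omega> - \<eta> \<omega> * (W (r n) \<omega> - W a \<omega>)
     = (\<Sum>i=p..<n. V i \<omega> * (W (r (Suc i)) \<omega> - W (r i) \<omega>))" if "p \<le> n" "n \<le> q" for n \<omega>
    using that
  proof (induction n rule: dec_induct)
    case (step n)
    then show ?case
      using simple_integral_no_jump[OF nj rlt, of n W \<omega>] by (simp add: V_def algebra_simps)
  qed (simp add: p)
  have sq: "(\<integral>\<^sup>+v\<in>{a<..r n}. ennreal ((simple_value S v \<omega> - \<eta> \<omega>)\<^sup>2) \<partial>lborel)
     = ennreal (\<Sum>i=p..<n. (V i \<omega>)\<^sup>2 * (r (Suc i) - r i))" if "p \<le> n" "n \<le> q" for n \<omega>
    using that
  proof (induction n rule: dec_induct)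
    case (step n)
    let ?f = "\<lambda>v. ennreal ((simple_value S v \<omega> - \<eta> \<omega>)\<^sup>2)"
    have f: "?f \<in> borel_measurable lborel" using borel_measurable_simple_value[of S \<omega>] by measurable
    have "{a<..r (Suc n)} = {a<..r n} \<union> {r n<..r (Suc n)}"
      using ra[of n] rlt[of n] step by auto
    then have "(\<integral>\<^sup>+v\<in>{a<..r (Suc n)}. ?f v \<partial>lborel)
        = (\<integral>\<^sup>+v\<in>{a<..r n}. ?f v \<partial>lborel) + (\<integral>\<^sup>+v\<in>{r n<..r (Suc n)}. ?f v \<partial>lborel)"
      using f by (simp add: nn_integral_disjoint_pair)
    also have "(\<integral>\<^sup>+v\<in>{r n<..r (Suc n)}. ?f v \<partial>lborel)
        = (\<integral>\<^sup>+v. ennreal ((V n \<omega>)\<^sup>2) * indicator {r n<..r (Suc n)} v \<partial>lborel)"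
    proof (rule nn_integral_cong)
      fix v
      show "?f v * indicator {r n<..r (Suc n)} v = ennreal ((V n \<omega>)\<^sup>2) * indicator {r n<..r (Suc n)} v"
      proof (cases "v \<in> {r n<..r (Suc n)}")
        case True
        then show ?thesis using simple_value_no_jump[OF nj True] step by (simp add: V_def)
      qed simp
    qed
    also have "\<dots> = ennreal ((V n \<omega>)\<^sup>2 * (r (Suc n) - r n))"
      using rlt[of n] step by (subst nn_integral_cmult_indicator) (auto simp: ennreal_mult)
    also have "(\<integral>\<^sup>+v\<in>{a<..r n}. ?f v \<partial>lborel) = ennreal (\<Sum>i=p..<n. (V i \<omega>)\<^sup>2 * (r (Suc i) - r i))"
      using step by auto
    also have "\<dots> + ennreal ((V n \<omega>)\<^sup>2 * (r (Suc n) - r n)) =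
        ennreal ((\<Sum>i=p..<n. (V i \<omega>)\<^sup>2 * (r (Suc i) - r i)) + (V n \<omega>)\<^sup>2 * (r (Suc n) - r n))"
      by (rule ennreal_plus[symmetric])
        (use step rlt in \<open>auto intro!: sum_nonneg mult_nonneg_nonneg simp: less_imp_le\<close>)
    finally show ?case using step by simp
  qed (simp add: p)
  have D: "D = {\<omega>\<in>space M. \<alpha> < \<bar>\<Sum>i=p..<q. V i \<omega> * (W (r (Suc i)) \<omega> - W (r i) \<omega>)\<bar> \<and>
      (\<Sum>i=p..<q. (V i \<omega>)\<^sup>2 * (r (Suc i) - r i)) \<le> \<beta>}"
    unfolding D_def using int[of q] sq[of q] \<open>p < q\<close> q(2) pos(2) by (simp add: ennreal_le_iff)
  show "prob D \<le> \<beta> / \<alpha>\<^sup>2"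
    unfolding D
    by (rule martingale_transform_tail[where C = "\<lambda>i. C i + K"])
      (use r0 rlt VF VC \<open>p < q\<close> pos in \<open>auto intro: less_imp_le\<close>)
  have VM: "V i \<in> borel_measurable M" if "i \<in> {p..<q}" for i
    using measurable_F_imp_M[OF r0 VF] that by auto
  have WM: "W (r i) \<in> borel_measurable M" if "i \<le> q" for i using W_M r0 that by auto
  have "(\<lambda>\<omega>. \<Sum>i=p..<q. V i \<omega> * (W (r (Suc i)) \<omega> - W (r i) \<omega>)) \<in> borel_measurable M"
    "(\<lambda>\<omega>. \<Sum>i=p..<q. (V i \<omega>)\<^sup>2 * (r (Suc i) - r i)) \<in> borel_measurable M"
    by (intro borel_measurable_sum borel_measurable_times borel_measurable_diff borel_measurable_power
        borel_measurable_const VM WM; simp)+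
  then show "D \<in> events" unfolding D by measurable
qed

text \<open>The event \<open>G\<close> is carried through the approximation by simple processes, which is itself in
  probability; on \<open>G\<close> the quadratic variation is small, as \<open>simple_increment_tail\<close> requires. The approximation costs \<open>\<alpha>\<close> at each of the two endpoints, whence \<open>3 * \<alpha>\<close>, and the inequality
  \<open>(x + y)\<^sup>2 \<le> 2 * x\<^sup>2 + 2 * y\<^sup>2\<close> turns \<open>\<beta>\<close> into \<open>4 * \<beta>\<close>.\<close>

lemma ito_increment_deviation:
  assumes Y: "has_ito_integral M F W T H Y" and au: "0 \<le> a" "a < u" "u \<le> T"
    and \<eta>: "\<eta> \<in> borel_measurable (F a)" "\<And>\<omega>. \<omega> \<in> space M \<Longrightarrow> \<bar>\<eta> \<omega>\<bar> \<le> K"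
    and G: "G \<in> events"
    and close: "\<And>\<omega>. \<omega> \<in> G \<Longrightarrow> (\<integral>\<^sup>+v\<in>{a<..u}. ennreal ((H v \<omega> - \<eta> \<omega>)\<^sup>2) \<partial>lborel) \<le> ennreal \<beta>"
    and pos: "0 < \<alpha>" "0 < \<beta>"
  shows "prob {\<omega>\<in>G. 3 * \<alpha> < \<bar>Y u \<omega> - Y a \<omega> - \<eta> \<omega> * (W u \<omega> - W a \<omega>)\<bar>} \<le> 4 * \<beta> / \<alpha>\<^sup>2"
proof -
  let ?B = "{\<omega>\<in>G. 3 * \<alpha> < \<bar>Y u \<omega> - Y a \<omega> - \<eta> \<omega> * (W u \<omega> - W a \<omega>)\<bar>}"
  obtain S where S: "\<And>k. S k \<in> simple_processes M F T"
    and n1: "null_in_probability M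
        (\<lambda>k \<omega>. \<integral>\<^sup>+s\<in>{0..T}. ennreal ((simple_value (S k) s \<omega> - H s \<omega>)\<^sup>2) \<partial>lborel)"
    and n2: "null_in_probability M
        (\<lambda>k \<omega>. SUP t\<in>{0..T}. ennreal \<bar>simple_integral W (S k) t \<omega> - Y t \<omega>\<bar>)"
    and H: "progressively_measurable_on F T H"
    using Y unfolding has_ito_integral_def by blast
  define E1 where "E1 k = {\<omega>\<in>space M. ennreal \<beta> <
    (\<integral>\<^sup>+s\<in>{0..T}. ennreal ((simple_value (S k) s \<omega> - H s \<omega>)\<^sup>2) \<partial>lborel)}" for k
  define E2 where "E2 k = {\<omega>\<in>space M. ennreal \<alpha> <
    (SUP t\<in>{0..T}. ennreal \<bar>simple_integral W (S k) t \<omega> - Y t \<omega>\<bar>)}" for k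
  define D where "D k = {\<omega>\<in>space M. \<alpha> < \<bar>simple_integral W (S k) u \<omega> - simple_integral W (S k) a \<omega> - \<eta> \<omega> * (W u \<omega> - W a \<omega>)\<bar> \<and>
      (\<integral>\<^sup>+v\<in>{a<..u}. ennreal ((simple_value (S k) v \<omega> - \<eta> \<omega>)\<^sup>2) \<partial>lborel) \<le> ennreal (4 * \<beta>)}" for k
  have E: "E1 k \<in> events" "E2 k \<in> events" for k
  proof -
    have "(\<lambda>\<omega>. \<integral>\<^sup>+s\<in>{0..T}. ennreal ((simple_value (S k) s \<omega> - H s \<omega>)\<^sup>2) \<partial>lborel) \<in> borel_measurable M"
      "(\<lambda>\<omega>. SUP t\<in>{0..T}. ennreal \<bar>simple_integral W (S k) t \<omega> - Y t \<omega>\<bar>) \<in> borel_measurable M"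
      using n1 n2 unfolding null_in_probability_def by blast+
    from borel_measurable_less[OF borel_measurable_const this(1)]
      borel_measurable_less[OF borel_measurable_const this(2)]
    show "E1 k \<in> events" "E2 k \<in> events" unfolding E1_def E2_def .
  qed
  have "0 < ennreal \<alpha>" "0 < ennreal \<beta>" using pos by auto
  then have lim: "(\<lambda>k. prob (E1 k)) \<longlonglongrightarrow> 0" "(\<lambda>k. prob (E2 k)) \<longlonglongrightarrow> 0"
    using n1 n2 unfolding null_in_probability_def E1_def E2_def by blast+
  have two: "2 * ennreal x + 2 * ennreal y = ennreal (2 * x + 2 * y)" if "0 \<le> x" "0 \<le> y" for x y
    using that by (simp add: ennreal_mult)
  have Dk: "D k \<in> events" "prob (D k) \<le> 4 * \<beta> / \<alpha>\<^sup>2" for k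
    unfolding D_def using simple_increment_tail[OF S au(1,2) \<eta> pos(1), of "4 * \<beta>"] pos by auto
  have sub: "?B \<subseteq> D k \<union> E1 k \<union> E2 k" for k
  proof
    fix \<omega> assume B: "\<omega> \<in> ?B"
    then have sp: "\<omega> \<in> space M" using sets.sets_into_space[OF G] by auto
    show "\<omega> \<in> D k \<union> E1 k \<union> E2 k"
    proof (rule ccontr)
      assume nin: "\<omega> \<notin> D k \<union> E1 k \<union> E2 k"
      let ?I = "\<lambda>t. simple_integral W (S k) t \<omega>" and ?V = "\<lambda>v. simple_value (S k) v \<omega>"
      have unif: "\<bar>?I t - Y t \<omega>\<bar> \<le> \<alpha>" if "t \<in> {0..T}" for t
      proof -
        have "ennreal \<bar>?I t - Y t \<omega>\<bar> \<le> (SUP t\<in>{0..T}. ennreal \<bar>?I t - Y t \<omega>\<bar>)"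
          using that by (rule SUP_upper)
        also have "\<dots> \<le> ennreal \<alpha>" using nin sp by (auto simp: E2_def not_less)
        finally show ?thesis using pos by (simp add: ennreal_le_iff)
      qed
      have far: "\<alpha> < \<bar>?I u - ?I a - \<eta> \<omega> * (W u \<omega> - W a \<omega>)\<bar>"
        using unif[of u] unif[of a] au B by auto
      have "0 \<le> T" using au by auto
      then have "(\<lambda>(s, \<omega>). H s \<omega>) \<in> borel_measurable (restrict_space borel {0..T} \<Otimes>\<^sub>M F T)"
        using H by (auto simp: progressively_measurable_on_def)
      from measurable_compose[OF measurable_Pair2'[of \<omega> "F T" "restrict_space borel {0..T}"] this]
      have "(\<lambda>s. H s \<omega>) \<in> borel_measurable (restrict_space borel {0..T})"
        using sp space_F[OF \<open>0 \<le> T\<close>] by simp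
      then have h: "(\<lambda>s. indicator {0..T} s *\<^sub>R H s \<omega>) \<in> borel_measurable borel" (is "?h \<in> _")
        by (subst (asm) borel_measurable_restrict_space_iff) auto
      have hm: "?h \<in> borel_measurable lborel" and Vm: "?V \<in> borel_measurable lborel"
        using h borel_measurable_simple_value by auto
      have "(\<integral>\<^sup>+v\<in>{a<..u}. ennreal ((?V v - \<eta> \<omega>)\<^sup>2) \<partial>lborel) \<le>
        (\<integral>\<^sup>+v. 2 * (ennreal ((?V v - ?h v)\<^sup>2) * indicator {0..T} v) +
           2 * (ennreal ((?h v - \<eta> \<omega>)\<^sup>2) * indicator {a<..u} v) \<partial>lborel)"
      proof (rule nn_integral_mono)
        fix v
        have "(?V v - \<eta> \<omega>)\<^sup>2 \<le> 2 * (?V v - ?h v)\<^sup>2 + 2 * (?h v - \<eta> \<omega>)\<^sup>2"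
          using sum_squares_bound[of "?V v - ?h v" "?h v - \<eta> \<omega>"]
          by (simp add: power2_eq_square algebra_simps)
        then have "ennreal ((?V v - \<eta> \<omega>)\<^sup>2) \<le> 2 * ennreal ((?V v - ?h v)\<^sup>2) + 2 * ennreal ((?h v - \<eta> \<omega>)\<^sup>2)"
          by (simp only: two zero_le_power2 ennreal_leI)
        then show "ennreal ((?V v - \<eta> \<omega>)\<^sup>2) * indicator {a<..u} v \<le>
          2 * (ennreal ((?V v - ?h v)\<^sup>2) * indicator {0..T} v) +
           2 * (ennreal ((?h v - \<eta> \<omega>)\<^sup>2) * indicator {a<..u} v)"
          using au by (auto simp: indicator_def)
      qed
      also have "\<dots> = 2 * (\<integral>\<^sup>+v\<in>{0..T}. ennreal ((?V v - ?h v)\<^sup>2) \<partial>lborel) +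
           2 * (\<integral>\<^sup>+v\<in>{a<..u}. ennreal ((?h v - \<eta> \<omega>)\<^sup>2) \<partial>lborel)"
        using hm Vm by (subst nn_integral_add) (auto simp: nn_integral_cmult)
      also have "(\<integral>\<^sup>+v\<in>{0..T}. ennreal ((?V v - ?h v)\<^sup>2) \<partial>lborel) =
          (\<integral>\<^sup>+v\<in>{0..T}. ennreal ((?V v - H v \<omega>)\<^sup>2) \<partial>lborel)"
        by (intro nn_integral_cong) (auto simp: indicator_def)
      also have "(\<integral>\<^sup>+v\<in>{a<..u}. ennreal ((?h v - \<eta> \<omega>)\<^sup>2) \<partial>lborel) =
          (\<integral>\<^sup>+v\<in>{a<..u}. ennreal ((H v \<omega> - \<eta> \<omega>)\<^sup>2) \<partial>lborel)"
        using au by (intro nn_integral_cong) (auto simp: indicator_def)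
      also have "2 * (\<integral>\<^sup>+v\<in>{0..T}. ennreal ((?V v - H v \<omega>)\<^sup>2) \<partial>lborel) +
          2 * (\<integral>\<^sup>+v\<in>{a<..u}. ennreal ((H v \<omega> - \<eta> \<omega>)\<^sup>2) \<partial>lborel) \<le> 2 * ennreal \<beta> + 2 * ennreal \<beta>"
        using nin sp close[of \<omega>] B by (intro add_mono mult_left_mono) (auto simp: E1_def not_less)
      also have "\<dots> = ennreal (4 * \<beta>)"
        using pos by (subst two) auto
      finally have "\<omega> \<in> D k" using far sp by (auto simp: D_def)
      then show False using nin by auto
    qed
  qed
  have "prob ?B \<le> 4 * \<beta> / \<alpha>\<^sup>2 + prob (E1 k) + prob (E2 k)" for k
  proof -
    have "prob ?B \<le> prob (D k \<union> E1 k \<union> E2 k)"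
      using sub E Dk by (intro finite_measure_mono) auto
    also have "\<dots> \<le> prob (D k \<union> E1 k) + prob (E2 k)"
      using E Dk by (intro measure_Un_le) auto
    also have "prob (D k \<union> E1 k) \<le> prob (D k) + prob (E1 k)"
      using E Dk by (intro measure_Un_le) auto
    finally show ?thesis using Dk(2)[of k] by auto
  qed
  moreover have "(\<lambda>k. 4 * \<beta> / \<alpha>\<^sup>2 + prob (E1 k) + prob (E2 k)) \<longlonglongrightarrow> 4 * \<beta> / \<alpha>\<^sup>2 + 0 + 0"
    by (intro tendsto_add tendsto_const lim)
  ultimately show ?thesis by (intro LIMSEQ_le_const) auto
qed

end

section \<open>Unpredictability of the midpoint\<close>

text \<open>The density is at most \<open>1 / (2 * sqrt h)\<close>, so the interval of length \<open>sqrt h\<close> around \<open>p\<close> carries at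
  most half of the mass, whatever \<open>p\<close> is.\<close>

lemma normal_density_spread:
  fixes p h c :: real
  assumes "0 < h" "0 < c"
  shows "ennreal (sqrt h * min (c / 2) 1 / 2) \<le>
    (\<integral>\<^sup>+z. ennreal (normal_density 0 (sqrt h) z) * ennreal (min (c * \<bar>p - z\<bar>) (sqrt h)) \<partial>lborel)"
proof -
  let ?N = "\<lambda>z. ennreal (normal_density 0 (sqrt h) z)"
  let ?r = "sqrt h / 2"
  let ?k = "sqrt h * min (c / 2) 1"
  let ?near = "{p - ?r..p + ?r}"
  have r: "0 < ?r" using assms by simp
  have k: "0 < ?k" using assms by simp
  have dens: "normal_density 0 (sqrt h) z \<le> 1 / (2 * sqrt h)" for z
  proof -
    have "2 \<le> sqrt (2 * pi)" using pi_gt3 by (intro real_le_rsqrt) auto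
    then have "2 * sqrt h \<le> sqrt (2 * pi) * sqrt h" using assms by (intro mult_right_mono) auto
    moreover have "sqrt (2 * pi * (sqrt h)\<^sup>2) = sqrt (2 * pi) * sqrt h"
      using assms by (simp add: real_sqrt_mult)
    moreover have "exp (- (z - 0)\<^sup>2 / (2 * (sqrt h)\<^sup>2)) \<le> 1"
      using assms by (simp add: divide_nonneg_nonneg)
    ultimately show ?thesis
      unfolding normal_density_def using assms
      by (metis frac_le mult_1 mult_le_one mult_pos_pos order_less_imp_le real_sqrt_gt_zero
        times_divide_eq_left zero_less_numeral less_eq_real_def zero_le_one)
  qed
  have "1 = (\<integral>\<^sup>+z. ?N z \<partial>lborel)"
    using assms prob_space.emeasure_space_1[OF prob_space_normal_density[of "sqrt h" 0]]
    by (simp add: emeasure_density)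
  also have "\<dots> \<le> (\<integral>\<^sup>+z. ?N z * indicator (- ?near) z + ennreal (1 / (2 * sqrt h)) * indicator ?near z \<partial>lborel)"
    using dens by (intro nn_integral_mono) (auto simp: indicator_def intro: ennreal_leI)
  also have "\<dots> = (\<integral>\<^sup>+z. ?N z * indicator (- ?near) z \<partial>lborel) + (\<integral>\<^sup>+z. ennreal (1 / (2 * sqrt h)) * indicator ?near z \<partial>lborel)"
    by (rule nn_integral_add) auto
  also have "(\<integral>\<^sup>+z. ennreal (1 / (2 * sqrt h)) * indicator ?near z \<partial>lborel) = ennreal (1 / (2 * sqrt h)) * ennreal (sqrt h)"
    using r by (subst nn_integral_cmult_indicator) auto
  also have "\<dots> = ennreal (1 / 2)"
    using assms by (simp add: ennreal_mult[symmetric])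
  finally have far: "ennreal (1 / 2) \<le> (\<integral>\<^sup>+z. ?N z * indicator (- ?near) z \<partial>lborel)" (is "_ \<le> ?x")
  proof (cases ?x)
    case (real x)
    assume "1 \<le> ?x + ennreal (1 / 2)"
    then have "ennreal 1 \<le> ennreal (x + 1 / 2)" using real by simp
    then have "1 \<le> x + 1 / 2" using real by (subst (asm) ennreal_le_iff) auto
    then show ?thesis unfolding real(2) by (intro ennreal_leI) simp
  qed auto
  have "ennreal (sqrt h * min (c / 2) 1 / 2) = ennreal ?k * ennreal (1 / 2)"
    using k by (subst ennreal_mult[symmetric]) auto
  also have "\<dots> \<le> ennreal ?k * ?x" using far by (intro mult_left_mono) auto
  also have "\<dots> = (\<integral>\<^sup>+z. ennreal ?k * (?N z * indicator (- ?near) z) \<partial>lborel)"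
    by (subst nn_integral_cmult) auto
  also have "\<dots> \<le> (\<integral>\<^sup>+z. ?N z * ennreal (min (c * \<bar>p - z\<bar>) (sqrt h)) \<partial>lborel)"
  proof (rule nn_integral_mono)
    fix z
    show "ennreal ?k * (?N z * indicator (- ?near) z) \<le> ?N z * ennreal (min (c * \<bar>p - z\<bar>) (sqrt h))"
    proof (cases "z \<in> ?near")
      case False
      then have "z < p - ?r \<or> p + ?r < z" by auto
      then have "?r \<le> \<bar>p - z\<bar>" by arith
      then have "c * ?r \<le> c * \<bar>p - z\<bar>" using assms by (intro mult_left_mono) auto
      moreover have "?k \<le> sqrt h * (c / 2)" "?k \<le> sqrt h * 1"
        using assms by (intro mult_left_mono; simp)+
      ultimately have "?k \<le> min (c * \<bar>p - z\<bar>) (sqrt h)" by (simp add: algebra_simps)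
      then show ?thesis using False
        by (subst mult.commute) (auto intro!: mult_left_mono ennreal_leI)
    qed simp
  qed
  finally show ?thesis .
qed

context brownian_motion
begin

text \<open>Without later observations this is Fubini's theorem for two independent normal variables of
  variance \<open>h\<close>. Later observations are removed one at a time, starting with the last: the increment
  of \<open>W\<close> between the last two of them is independent of everything else and is integrated out. The observations
  are encoded as one function on all times, equal to \<open>0\<close> outside \<open>J\<close>, so that the space in which they
  live does not change during the induction.\<close>

lemma exchange_increments:
  fixes f :: "'a \<times> real \<times> real \<times> (real \<Rightarrow> real) \<Rightarrow> ennreal"
  assumes a: "0 \<le> a" and h: "0 < h" and J: "finite J" "\<And>t. t \<in> J \<Longrightarrow> a + 2 * h < t"
    and f: "f \<in> borel_measurable (F a \<Otimes>\<^sub>M borel \<Otimes>\<^sub>M borel \<Otimes>\<^sub>M Pi\<^sub>M UNIV (\<lambda>_. borel))"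
  shows "(\<integral>\<^sup>+\<omega>. f (\<omega>, W (a + h) \<omega> - W a \<omega>, W (a + 2 * h) \<omega> - W (a + h) \<omega>,
      \<lambda>t. if t \<in> J then W t \<omega> - W (a + 2 * h) \<omega> else 0) \<partial>M) =
    (\<integral>\<^sup>+\<omega>. f (\<omega>, W (a + 2 * h) \<omega> - W (a + h) \<omega>, W (a + h) \<omega> - W a \<omega>,
      \<lambda>t. if t \<in> J then W t \<omega> - W (a + 2 * h) \<omega> else 0) \<partial>M)"
  using J f
proof (induction J arbitrary: f rule: finite_linorder_max_induct)
  case (empty f)
  let ?N = "\<lambda>z. ennreal (normal_density 0 (sqrt h) z)"
  let ?U = "\<lambda>\<omega>. W (a + h) \<omega> - W a \<omega>" and ?V = "\<lambda>\<omega>. W (a + 2 * h) \<omega> - W (a + h) \<omega>"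
  have *: "(\<integral>\<^sup>+\<omega>. g (\<omega>, ?U \<omega>, ?V \<omega>) \<partial>M) =
      (\<integral>\<^sup>+\<omega>. (\<integral>\<^sup>+u. ?N u * (\<integral>\<^sup>+v. ?N v * g (\<omega>, u, v) \<partial>lborel) \<partial>lborel) \<partial>M)"
    if g[measurable]: "g \<in> borel_measurable (F a \<Otimes>\<^sub>M borel \<Otimes>\<^sub>M borel)" for g
  proof -
    let ?g = "\<lambda>p. \<integral>\<^sup>+v. ?N v * g (fst p, snd p, v) \<partial>lborel"
    have U[measurable]: "?U \<in> borel_measurable (F (a + h))" using W_F a h by auto
    have I[measurable]: "(\<lambda>\<omega>. \<omega>) \<in> measurable (F (a + h)) (F a)"
      using a h by (intro measurable_F_mono[of a "a + h"]) auto
    have "(\<integral>\<^sup>+\<omega>. g (\<omega>, ?U \<omega>, ?V \<omega>) \<partial>M) = (\<integral>\<^sup>+\<omega>. ?g (\<omega>, ?U \<omega>) \<partial>M)"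
      using nn_integral_increment[of "a + h" "a + 2 * h" "\<lambda>(\<omega>, z). g (\<omega>, ?U \<omega>, z)"] a h by simp
    also have "\<dots> = (\<integral>\<^sup>+\<omega>. (\<integral>\<^sup>+u. ?N u * ?g (\<omega>, u) \<partial>lborel) \<partial>M)"
      using nn_integral_increment[of a "a + h" ?g] a h by simp
    finally show ?thesis by simp
  qed
  let ?g = "\<lambda>(\<omega>, u, v). f (\<omega>, u, v, \<lambda>t. 0)"
  have [measurable]: "(\<lambda>t. 0 :: real) \<in> space (Pi\<^sub>M UNIV (\<lambda>_. borel :: real measure))"
    by (simp add: space_PiM)
  note [measurable] = empty.prems(2)
  have fub: "(\<integral>\<^sup>+u. ?N u * (\<integral>\<^sup>+v. ?N v * f (\<omega>, u, v, \<lambda>t. 0) \<partial>lborel) \<partial>lborel) =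
      (\<integral>\<^sup>+u. ?N u * (\<integral>\<^sup>+v. ?N v * f (\<omega>, v, u, \<lambda>t. 0) \<partial>lborel) \<partial>lborel)" if "\<omega> \<in> space M" for \<omega>
  proof -
    have [measurable]: "\<omega> \<in> space (F a)" using that space_F[OF a] by simp
    have "(\<integral>\<^sup>+u. ?N u * (\<integral>\<^sup>+v. ?N v * f (\<omega>, u, v, \<lambda>t. 0) \<partial>lborel) \<partial>lborel) =
      (\<integral>\<^sup>+u. (\<integral>\<^sup>+v. ?N u * (?N v * f (\<omega>, u, v, \<lambda>t. 0)) \<partial>lborel) \<partial>lborel)"
      by (intro nn_integral_cong nn_integral_cmult[symmetric]) measurable
    also have "\<dots> = (\<integral>\<^sup>+v. (\<integral>\<^sup>+u. ?N u * (?N v * f (\<omega>, u, v, \<lambda>t. 0)) \<partial>lborel) \<partial>lborel)"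
      by (rule lborel_pair.Fubini') measurable
    also have "\<dots> = (\<integral>\<^sup>+v. (\<integral>\<^sup>+u. ?N v * (?N u * f (\<omega>, u, v, \<lambda>t. 0)) \<partial>lborel) \<partial>lborel)"
      by (simp add: mult.left_commute)
    also have "\<dots> = (\<integral>\<^sup>+v. ?N v * (\<integral>\<^sup>+u. ?N u * f (\<omega>, u, v, \<lambda>t. 0) \<partial>lborel) \<partial>lborel)"
      by (intro nn_integral_cong nn_integral_cmult) measurable
    finally show ?thesis .
  qed
  have "(\<integral>\<^sup>+\<omega>. f (\<omega>, ?U \<omega>, ?V \<omega>, \<lambda>t. 0) \<partial>M) = (\<integral>\<^sup>+\<omega>. f (\<omega>, ?V \<omega>, ?U \<omega>, \<lambda>t. 0) \<partial>M)"
    using *[of "\<lambda>(\<omega>, u, v). f (\<omega>, u, v, \<lambda>t. 0)"] *[of "\<lambda>(\<omega>, u, v). f (\<omega>, v, u, \<lambda>t. 0)"]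
    by (simp add: fub cong: nn_integral_cong)
  then show ?case by simp
next
  case (insert t J f)
  let ?b = "a + 2 * h"
  let ?U = "\<lambda>\<omega>. W (a + h) \<omega> - W a \<omega>" and ?V = "\<lambda>\<omega>. W ?b \<omega> - W (a + h) \<omega>"
  let ?inc = "\<lambda>J \<omega> t. if t \<in> J then W t \<omega> - W ?b \<omega> else (0::real)"
  let ?PI = "Pi\<^sub>M UNIV (\<lambda>_::real. borel :: real measure)"
  let ?E = "F a \<Otimes>\<^sub>M (borel :: real measure) \<Otimes>\<^sub>M (borel :: real measure) \<Otimes>\<^sub>M ?PI"
  \<comment> \<open>the last time before \<open>t\<close> at which \<open>W\<close> is recorded, if only as the base point \<open>a + 2 * h\<close>\<close>
  define t' where "t' = (if J = {} then ?b else Max J)"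
  have t': "?b \<le> t'" "t' < t" "\<And>j. j \<in> J \<Longrightarrow> j \<le> t'"
    using insert.hyps insert.prems(1) by (auto simp: t'_def less_imp_le)
  have inc_t': "?inc J \<omega> t' = W t' \<omega> - W ?b \<omega>" for \<omega>
    using insert.hyps(1) by (auto simp: t'_def)
  let ?N = "\<lambda>z. ennreal (normal_density 0 (sqrt (t - t')) z)"
  define upd where "upd = (\<lambda>(p :: 'a \<times> real \<times> real \<times> (real \<Rightarrow> real), z::real).
    (fst p, fst (snd p), fst (snd (snd p)), (\<lambda>i. if i = t then snd (snd (snd p)) t' + z else snd (snd (snd p)) i)))"
  have upd[measurable]: "upd \<in> measurable (?E \<Otimes>\<^sub>M borel) ?E"
    unfolding upd_def split_beta
  proof (intro measurable_Pair)
    show "(\<lambda>x. \<lambda>i. if i = t then snd (snd (snd (fst x))) t' + snd x else snd (snd (snd (fst x))) i)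
        \<in> measurable (?E \<Otimes>\<^sub>M borel) ?PI"
    proof (rule measurable_PiM_single')
      fix i
      have [measurable]: "(\<lambda>x. snd (snd (snd (fst x))) j) \<in> borel_measurable (?E \<Otimes>\<^sub>M borel)" for j
      proof (rule measurable_compose[where g = "\<lambda>y. y j" and N = ?PI])
        show "(\<lambda>x. snd (snd (snd (fst x)))) \<in> measurable (?E \<Otimes>\<^sub>M borel) ?PI" by measurable
        show "(\<lambda>y. y j) \<in> borel_measurable ?PI" by (rule measurable_component_singleton) simp
      qed
      show "(\<lambda>x. if i = t then snd (snd (snd (fst x))) t' + snd x else snd (snd (snd (fst x))) i)
        \<in> borel_measurable (?E \<Otimes>\<^sub>M borel)" by measurable
    qed auto
  qed measurable
  define g where "g p = (\<integral>\<^sup>+z. ?N z * f (upd (p, z)) \<partial>lborel)" for p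
  note [measurable] = insert.prems(2)
  have g: "g \<in> borel_measurable ?E"
    unfolding g_def by measurable
  have key: "(\<integral>\<^sup>+\<omega>. f (\<omega>, A \<omega>, B \<omega>, ?inc (insert t J) \<omega>) \<partial>M) = (\<integral>\<^sup>+\<omega>. g (\<omega>, A \<omega>, B \<omega>, ?inc J \<omega>) \<partial>M)"
    if [measurable]: "A \<in> borel_measurable (F ?b)" "B \<in> borel_measurable (F ?b)" for A B
  proof -
    have t'0: "0 \<le> t'" using t'(1) a h by simp
    have [measurable]: "A \<in> borel_measurable (F t')" "B \<in> borel_measurable (F t')"
      using that a h t'(1) by (auto intro!: measurable_F_mono[of ?b t'])
    have [measurable]: "(\<lambda>\<omega>. \<omega>) \<in> measurable (F t') (F a)"
      using a h t'(1) by (intro measurable_F_mono[of a t']) auto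
    have [measurable]: "?inc J \<in> measurable (F t') ?PI"
    proof (rule measurable_PiM_single')
      fix i
      have [measurable]: "i \<in> J \<Longrightarrow> W i \<in> borel_measurable (F t')" "W ?b \<in> borel_measurable (F t')"
        using t' insert.prems(1)[of i] a h by (auto intro!: W_F)
      show "(\<lambda>\<omega>. ?inc J \<omega> i) \<in> borel_measurable (F t')" by (cases "i \<in> J") auto
    qed auto
    have m: "(\<lambda>(\<omega>, z). f (upd ((\<omega>, A \<omega>, B \<omega>, ?inc J \<omega>), z))) \<in> borel_measurable (F t' \<Otimes>\<^sub>M borel)"
      by measurable
    have "(\<omega>, A \<omega>, B \<omega>, ?inc (insert t J) \<omega>) = upd ((\<omega>, A \<omega>, B \<omega>, ?inc J \<omega>), W t \<omega> - W t' \<omega>)" for \<omega>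
    proof -
      have "?inc (insert t J) \<omega> i = (if i = t then ?inc J \<omega> t' + (W t \<omega> - W t' \<omega>) else ?inc J \<omega> i)" for i
        unfolding inc_t' by simp
      then show ?thesis unfolding upd_def by (simp only: split_conv fst_conv snd_conv)
    qed
    then have "(\<integral>\<^sup>+\<omega>. f (\<omega>, A \<omega>, B \<omega>, ?inc (insert t J) \<omega>) \<partial>M) =
        (\<integral>\<^sup>+\<omega>. f (upd ((\<omega>, A \<omega>, B \<omega>, ?inc J \<omega>), W t \<omega> - W t' \<omega>)) \<partial>M)" by (simp only:)
    also have "\<dots> = (\<integral>\<^sup>+\<omega>. g (\<omega>, A \<omega>, B \<omega>, ?inc J \<omega>) \<partial>M)"
      using nn_integral_increment[OF t'0 t'(2) m] by (simp add: g_def)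
    finally show ?thesis .
  qed
  have UV: "?U \<in> borel_measurable (F ?b)" "?V \<in> borel_measurable (F ?b)"
    using a h by (auto intro!: borel_measurable_diff W_F)
  show ?case
    unfolding key[OF UV] key[OF UV(2,1)]
    by (rule insert.IH) (use insert.prems(1) g in auto)
qed

text \<open>The function \<open>\<Phi> w y\<close> stands for the error made at the value \<open>y\<close> by the prediction from the
  observations \<open>w\<close>. The values of \<open>W\<close> at times outside \<open>(a, a + 2 * h)\<close> are unaffected by the exchange
  of the two half increments, so the expected error at \<open>x + \<eta> * V\<close> is the one at \<open>x + \<eta> * U\<close>, while
  the assumption \<open>separates\<close>, a triangle inequality, bounds their sum from below.\<close>

lemma midpoint_unpredictable:
  fixes \<Phi> :: "(nat \<Rightarrow> real) \<Rightarrow> real \<Rightarrow> ennreal"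
  assumes a: "0 \<le> a" and h: "0 < h" and c: "0 < c" and \<theta>: "0 \<le> \<theta>"
    and A: "A \<in> sets (F a)" and x: "x \<in> borel_measurable (F a)" and \<eta>: "\<eta> \<in> borel_measurable (F a)"
    and nondeg: "\<And>\<omega>. \<omega> \<in> A \<Longrightarrow> c \<le> \<bar>\<eta> \<omega>\<bar>"
    and \<tau>: "\<And>i. i \<in> {1..n} \<Longrightarrow> 0 \<le> \<tau> i \<and> (\<tau> i \<le> a \<or> a + 2 * h \<le> \<tau> i)"
    and \<Phi>: "(\<lambda>(w, y). \<Phi> w y) \<in> borel_measurable (Pi\<^sub>M {1..n} (\<lambda>_. borel) \<Otimes>\<^sub>M borel)"
    and separates: "\<And>w y z. w \<in> space (Pi\<^sub>M {1..n} (\<lambda>_. borel)) \<Longrightarrow>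
      ennreal (\<theta> * min \<bar>y - z\<bar> (sqrt h)) \<le> \<Phi> w y + \<Phi> w z"
  shows "ennreal (\<theta> * sqrt h * min (c / 2) 1 / 4 * prob A) \<le>
    (\<integral>\<^sup>+\<omega>. \<Phi> (\<lambda>i\<in>{1..n}. W (\<tau> i) \<omega>) (x \<omega> + \<eta> \<omega> * (W (a + h) \<omega> - W a \<omega>)) * indicator A \<omega> \<partial>M)"
proof -
  let ?U = "\<lambda>\<omega>. W (a + h) \<omega> - W a \<omega>" and ?V = "\<lambda>\<omega>. W (a + 2 * h) \<omega> - W (a + h) \<omega>"
  let ?w = "\<lambda>\<omega>. \<lambda>i\<in>{1..n}. W (\<tau> i) \<omega>"
  let ?PI = "Pi\<^sub>M UNIV (\<lambda>_::real. borel :: real measure)"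
  let ?E = "F a \<Otimes>\<^sub>M (borel :: real measure) \<Otimes>\<^sub>M (borel :: real measure) \<Otimes>\<^sub>M ?PI"
  define J where "J = {t \<in> \<tau> ` {1..n}. a + 2 * h < t}"
  let ?inc = "\<lambda>\<omega> t. if t \<in> J then W t \<omega> - W (a + 2 * h) \<omega> else (0::real)"
  define w where "w = (\<lambda>(\<omega>, u, v, y). \<lambda>i\<in>{1..n}.
    if \<tau> i \<le> a then W (\<tau> i) \<omega> else W a \<omega> + (u + v) + y (\<tau> i))"
  define f where "f p = \<Phi> (w p) (x (fst p) + \<eta> (fst p) * fst (snd p)) * indicator A (fst p)" for p
  note [measurable] = A x \<eta>
  have w[measurable]: "w \<in> measurable ?E (Pi\<^sub>M {1..n} (\<lambda>_. borel))"
    unfolding w_def split_beta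
  proof (rule measurable_restrict)
    fix i assume i: "i \<in> {1..n}"
    have [measurable]: "(\<lambda>p. snd (snd (snd p)) (\<tau> i)) \<in> borel_measurable ?E"
    proof (rule measurable_compose[where g = "\<lambda>y. y (\<tau> i)" and N = ?PI])
      show "(\<lambda>x. snd (snd (snd x))) \<in> measurable ?E ?PI" by measurable
      show "(\<lambda>y. y (\<tau> i)) \<in> borel_measurable ?PI" by (rule measurable_component_singleton) simp
    qed
    have [measurable]: "\<tau> i \<le> a \<Longrightarrow> W (\<tau> i) \<in> borel_measurable (F a)" "W a \<in> borel_measurable (F a)"
      using \<tau>[OF i] a by (auto intro: W_F)
    show "(\<lambda>p. if \<tau> i \<le> a then W (\<tau> i) (fst p) else W a (fst p) +
        (fst (snd p) + fst (snd (snd p))) + snd (snd (snd p)) (\<tau> i)) \<in> borel_measurable ?E"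
      by (cases "\<tau> i \<le> a") simp_all
  qed
  have f: "f \<in> borel_measurable ?E"
  proof -
    have "(\<lambda>p. (w p, x (fst p) + \<eta> (fst p) * fst (snd p))) \<in>
        measurable ?E (Pi\<^sub>M {1..n} (\<lambda>_. borel) \<Otimes>\<^sub>M borel)"
      by measurable
    from measurable_compose[OF this \<Phi>]
    have [measurable]: "(\<lambda>p. \<Phi> (w p) (x (fst p) + \<eta> (fst p) * fst (snd p))) \<in> borel_measurable ?E"
      by simp
    show ?thesis unfolding f_def by measurable
  qed
  have weq: "w (\<omega>, ?U \<omega>, ?V \<omega>, ?inc \<omega>) = ?w \<omega>" "w (\<omega>, ?V \<omega>, ?U \<omega>, ?inc \<omega>) = ?w \<omega>" for \<omega>
  proof -
    have eq: "(if \<tau> i \<le> a then W (\<tau> i) \<omega> else W a \<omega> + d + ?inc \<omega> (\<tau> i)) = W (\<tau> i) \<omega>"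
      if "i \<in> {1..n}" "d = W (a + 2 * h) \<omega> - W a \<omega>" for i d
    proof (cases "\<tau> i \<le> a \<or> a + 2 * h < \<tau> i")
      case True
      then show ?thesis using that h by (auto simp: J_def)
    next
      case False
      then have "\<tau> i = a + 2 * h" using \<tau>[OF that(1)] by linarith
      then show ?thesis using that h by (auto simp: J_def)
    qed
    show "w (\<omega>, ?U \<omega>, ?V \<omega>, ?inc \<omega>) = ?w \<omega>"
      unfolding w_def split_conv by (intro restrict_ext eq) auto
    show "w (\<omega>, ?V \<omega>, ?U \<omega>, ?inc \<omega>) = ?w \<omega>"
      unfolding w_def split_conv by (intro restrict_ext eq) auto
  qed
  have ex: "(\<integral>\<^sup>+\<omega>. f (\<omega>, ?U \<omega>, ?V \<omega>, ?inc \<omega>) \<partial>M) = (\<integral>\<^sup>+\<omega>. f (\<omega>, ?V \<omega>, ?U \<omega>, ?inc \<omega>) \<partial>M)"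
    by (rule exchange_increments[OF a h _ _ f]) (auto simp: J_def)
  have [measurable]: "(\<lambda>\<omega>. \<omega>) \<in> measurable M (F a)"
    using a by (intro measurable_F_imp_M[of a]) auto
  have [measurable]: "?U \<in> borel_measurable M" "?V \<in> borel_measurable M" using W_M a h by auto
  have [measurable]: "?inc \<in> measurable M ?PI"
  proof (rule measurable_PiM_single')
    fix i
    have [measurable]: "i \<in> J \<Longrightarrow> W i \<in> borel_measurable M" "W (a + 2 * h) \<in> borel_measurable M"
      using a h \<tau> by (auto intro!: W_M simp: J_def)
    show "(\<lambda>\<omega>. ?inc \<omega> i) \<in> borel_measurable M" by (cases "i \<in> J") auto
  qed auto
  note [measurable] = f
  have AM: "A \<in> events" using A subalgebra_F[OF a] by (auto simp: subalgebra_def)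
  let ?k = "\<theta> * (sqrt h * min (c / 2) 1 / 2)"
  have "ennreal (?k * prob A) = (\<integral>\<^sup>+\<omega>. ennreal ?k * indicator A \<omega> \<partial>M)"
    using AM \<theta> h c by (subst nn_integral_cmult_indicator) (auto simp: emeasure_eq_measure ennreal_mult[symmetric])
  also have "\<dots> \<le> (\<integral>\<^sup>+\<omega>. (\<integral>\<^sup>+z. ennreal (normal_density 0 (sqrt h) z) *
      (ennreal (\<theta> * min (c * \<bar>?U \<omega> - z\<bar>) (sqrt h)) * indicator A \<omega>) \<partial>lborel) \<partial>M)"
  proof (rule nn_integral_mono)
    fix \<omega>
    have "ennreal ?k \<le> ennreal \<theta> * (\<integral>\<^sup>+z. ennreal (normal_density 0 (sqrt h) z) *
        ennreal (min (c * \<bar>?U \<omega> - z\<bar>) (sqrt h)) \<partial>lborel)"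
      using normal_density_spread[OF h c, of "?U \<omega>"] \<theta> h c
      by (subst ennreal_mult) (auto intro: mult_left_mono)
    also have "\<dots> = (\<integral>\<^sup>+z. ennreal \<theta> * (ennreal (normal_density 0 (sqrt h) z) *
        ennreal (min (c * \<bar>?U \<omega> - z\<bar>) (sqrt h))) \<partial>lborel)"
      by (rule nn_integral_cmult[symmetric]) auto
    also have "\<dots> = (\<integral>\<^sup>+z. ennreal (normal_density 0 (sqrt h) z) *
        ennreal (\<theta> * min (c * \<bar>?U \<omega> - z\<bar>) (sqrt h)) \<partial>lborel)"
      using \<theta> h c by (intro nn_integral_cong) (simp add: ennreal_mult mult.left_commute)
    finally show "ennreal ?k * indicator A \<omega> \<le> (\<integral>\<^sup>+z. ennreal (normal_density 0 (sqrt h) z) *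
      (ennreal (\<theta> * min (c * \<bar>?U \<omega> - z\<bar>) (sqrt h)) * indicator A \<omega>) \<partial>lborel)"
      by (auto simp: indicator_def)
  qed
  also have "\<dots> = (\<integral>\<^sup>+\<omega>. ennreal (\<theta> * min (c * \<bar>?U \<omega> - ?V \<omega>\<bar>) (sqrt h)) * indicator A \<omega> \<partial>M)"
  proof -
    have [measurable]: "?U \<in> borel_measurable (F (a + h))" using W_F a h by auto
    have [measurable]: "A \<in> sets (F (a + h))" using A mono_F[of a "a + h"] a h by auto
    show ?thesis
      using nn_integral_increment[of "a + h" "a + 2 * h"
          "\<lambda>(\<omega>, z). ennreal (\<theta> * min (c * \<bar>?U \<omega> - z\<bar>) (sqrt h)) * indicator A \<omega>"] a h by simp
  qed
  also have "\<dots> \<le> (\<integral>\<^sup>+\<omega>. f (\<omega>, ?U \<omega>, ?V \<omega>, ?inc \<omega>) + f (\<omega>, ?V \<omega>, ?U \<omega>, ?inc \<omega>) \<partial>M)"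
  proof (rule nn_integral_mono)
    fix \<omega>
    show "ennreal (\<theta> * min (c * \<bar>?U \<omega> - ?V \<omega>\<bar>) (sqrt h)) * indicator A \<omega> \<le>
        f (\<omega>, ?U \<omega>, ?V \<omega>, ?inc \<omega>) + f (\<omega>, ?V \<omega>, ?U \<omega>, ?inc \<omega>)"
    proof (cases "\<omega> \<in> A")
      case True
      let ?y = "x \<omega> + \<eta> \<omega> * ?U \<omega>" and ?z = "x \<omega> + \<eta> \<omega> * ?V \<omega>"
      have "?y - ?z = \<eta> \<omega> * (?U \<omega> - ?V \<omega>)" by (simp add: algebra_simps)
      then have "c * \<bar>?U \<omega> - ?V \<omega>\<bar> \<le> \<bar>?y - ?z\<bar>"
        using nondeg[OF True] by (simp add: abs_mult mult_right_mono)
      then have "min (c * \<bar>?U \<omega> - ?V \<omega>\<bar>) (sqrt h) \<le> min \<bar>?y - ?z\<bar> (sqrt h)"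
        by (intro min.mono order_refl)
      then have "\<theta> * min (c * \<bar>?U \<omega> - ?V \<omega>\<bar>) (sqrt h) \<le> \<theta> * min \<bar>?y - ?z\<bar> (sqrt h)"
        using \<theta> by (rule mult_left_mono)
      then have "ennreal (\<theta> * min (c * \<bar>?U \<omega> - ?V \<omega>\<bar>) (sqrt h)) \<le> ennreal (\<theta> * min \<bar>?y - ?z\<bar> (sqrt h))"
        by (rule ennreal_leI)
      also have "\<dots> \<le> \<Phi> (?w \<omega>) ?y + \<Phi> (?w \<omega>) ?z"
        by (rule separates) (auto simp: space_PiM)
      finally show ?thesis using True by (simp only: f_def weq fst_conv snd_conv indicator_simps mult_1_right)
    qed simp
  qed
  also have "\<dots> = (\<integral>\<^sup>+\<omega>. f (\<omega>, ?U \<omega>, ?V \<omega>, ?inc \<omega>) \<partial>M) + (\<integral>\<^sup>+\<omega>. f (\<omega>, ?V \<omega>, ?U \<omega>, ?inc \<omega>) \<partial>M)"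
    by (rule nn_integral_add) measurable
  also have "\<dots> = 2 * (\<integral>\<^sup>+\<omega>. f (\<omega>, ?U \<omega>, ?V \<omega>, ?inc \<omega>) \<partial>M)"
    unfolding ex by (rule mult_2[symmetric])
  also have "(\<integral>\<^sup>+\<omega>. f (\<omega>, ?U \<omega>, ?V \<omega>, ?inc \<omega>) \<partial>M) =
      (\<integral>\<^sup>+\<omega>. \<Phi> (?w \<omega>) (x \<omega> + \<eta> \<omega> * ?U \<omega>) * indicator A \<omega> \<partial>M)" (is "_ = ?R")
    by (simp only: f_def weq fst_conv snd_conv)
  finally have *: "ennreal (?k * prob A) \<le> 2 * ?R" .
  show ?thesis
  proof (cases ?R)
    case (real r)
    then have "ennreal (?k * prob A) \<le> ennreal (2 * r)" using * by (simp add: ennreal_mult)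
    then have "?k * prob A \<le> 2 * r" using real by (subst (asm) ennreal_le_iff) auto
    then have "\<theta> * sqrt h * min (c / 2) 1 / 4 * prob A \<le> r" by (simp add: algebra_simps)
    then show ?thesis unfolding real(2) by (rule ennreal_leI)
  qed simp
qed

end

section \<open>Truncated distances in L1\<close>

text \<open>Truncation at \<open>R\<close> allows an error to be controlled through its probability of being large.\<close>

definition truncated_norm :: "real \<Rightarrow> real measure \<Rightarrow> (real \<Rightarrow> real) \<Rightarrow> ennreal" where
  "truncated_norm R N p = (\<integral>\<^sup>+u. ennreal (min \<bar>p u\<bar> R) \<partial>N)"

lemma truncated_norm_triangle:
  assumes "p \<in> borel_measurable N" "q \<in> borel_measurable N" "0 \<le> R"
  shows "truncated_norm R N p \<le> truncated_norm R N q + truncated_norm R N (\<lambda>u. p u - q u)"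
proof -
  have "truncated_norm R N p \<le> (\<integral>\<^sup>+u. ennreal (min \<bar>q u\<bar> R) + ennreal (min \<bar>p u - q u\<bar> R) \<partial>N)"
    unfolding truncated_norm_def
  proof (rule nn_integral_mono)
    fix u
    have "min \<bar>p u\<bar> R \<le> min \<bar>q u\<bar> R + min \<bar>p u - q u\<bar> R" using assms(3) by arith
    then have "ennreal (min \<bar>p u\<bar> R) \<le> ennreal (min \<bar>q u\<bar> R + min \<bar>p u - q u\<bar> R)"
      by (rule ennreal_leI)
    also have "\<dots> = ennreal (min \<bar>q u\<bar> R) + ennreal (min \<bar>p u - q u\<bar> R)"
      by (rule ennreal_plus) (use assms(3) in auto)
    finally show "ennreal (min \<bar>p u\<bar> R) \<le> ennreal (min \<bar>q u\<bar> R) + ennreal (min \<bar>p u - q u\<bar> R)" .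
  qed
  also have "\<dots> = truncated_norm R N q + truncated_norm R N (\<lambda>u. p u - q u)"
    unfolding truncated_norm_def
    by (intro nn_integral_add measurable_compose[OF _ measurable_ennreal] borel_measurable_min
        borel_measurable_abs borel_measurable_diff borel_measurable_const assms)
  finally show ?thesis .
qed

lemma truncated_norm_le_nn_integral: "truncated_norm R N p \<le> (\<integral>\<^sup>+u. ennreal \<bar>p u\<bar> \<partial>N)"
  unfolding truncated_norm_def by (intro nn_integral_mono ennreal_leI) simp

lemma truncated_norm_const: "0 \<le> R \<Longrightarrow> truncated_norm R N (\<lambda>u. c) = ennreal (min \<bar>c\<bar> R) * emeasure N (space N)"
  by (simp add: truncated_norm_def)

lemma truncated_norm_bound: "0 \<le> R \<Longrightarrow> truncated_norm R N p \<le> ennreal R * emeasure N (space N)"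
proof -
  assume "0 \<le> R"
  have "truncated_norm R N p \<le> (\<integral>\<^sup>+u. ennreal R \<partial>N)"
    unfolding truncated_norm_def by (intro nn_integral_mono ennreal_leI) simp
  then show ?thesis by simp
qed

abbreviation cell_measure :: "real \<Rightarrow> real \<Rightarrow> real measure" where
  "cell_measure s \<theta> \<equiv> restrict_space lborel {s..<s + \<theta>}"

lemma emeasure_cell_measure: "0 \<le> \<theta> \<Longrightarrow> emeasure (cell_measure s \<theta>) (space (cell_measure s \<theta>)) = ennreal \<theta>"
  by (simp add: space_restrict_space emeasure_restrict_space)

lemma nn_integral_cell_measure: "nn_integral (cell_measure s \<theta>) f = (\<integral>\<^sup>+u\<in>{s..<s + \<theta>}. f u \<partial>lborel)"
  by (simp add: nn_integral_restrict_space)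

lemma borel_measurable_cell:
  assumes "f \<in> borel_measurable (restrict_space borel {0..T})" "0 \<le> s" "s + \<theta> \<le> T"
  shows "f \<in> borel_measurable (cell_measure s \<theta>)"
proof -
  have "f \<in> borel_measurable (restrict_space borel {s..<s + \<theta>})"
    by (rule measurable_restrict_mono[OF assms(1)]) (use assms in auto)
  moreover have "sets (restrict_space borel {s..<s + \<theta>}) = sets (cell_measure s \<theta>)"
    by (rule sets_restrict_space_cong) simp
  ultimately show ?thesis using measurable_cong_sets by blast
qed

lemma nn_integral_cell_le_L1_norm:
  assumes "0 \<le> s" "s + \<theta> \<le> T"
  shows "(\<integral>\<^sup>+u. ennreal \<bar>f u\<bar> \<partial>cell_measure s \<theta>) \<le> L1_norm T f"
  unfolding nn_integral_cell_measure L1_norm_def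
  by (intro nn_integral_mono) (use assms in \<open>auto simp: indicator_def\<close>)

lemma space_L1_borel: "space (L1_borel T) = L1_space T"
  unfolding L1_borel_def by (intro space_measure_of) auto

text \<open>The functional is 1-Lipschitz for the seminorm, hence its strict sublevel sets are open.\<close>

lemma L1_borel_measurable_truncated_norm:
  assumes s: "0 \<le> s" "s + \<theta> \<le> T" "0 \<le> \<theta>" and R: "0 \<le> R"
  shows "(\<lambda>f. truncated_norm R (cell_measure s \<theta>) (\<lambda>u. y - f u)) \<in> borel_measurable (L1_borel T)"
proof (rule borel_measurableI_less)
  fix c :: ennreal
  let ?N = "cell_measure s \<theta>"
  let ?U = "{f \<in> space (L1_borel T). truncated_norm R ?N (\<lambda>u. y - f u) < c}"
  have "?U \<in> {U. U \<subseteq> L1_space T \<and>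
      (\<forall>f\<in>U. \<exists>\<epsilon>>0. \<forall>h\<in>L1_space T. L1_norm T (\<lambda>s. h s - f s) < \<epsilon> \<longrightarrow> h \<in> U)}"
  proof (intro CollectI conjI ballI)
    fix f assume f: "f \<in> ?U"
    have fm: "h \<in> borel_measurable ?N" if "h \<in> L1_space T" for h
      using that s by (intro borel_measurable_cell) (auto simp: L1_space_def)
    show "\<exists>\<epsilon>>0. \<forall>h\<in>L1_space T. L1_norm T (\<lambda>s. h s - f s) < \<epsilon> \<longrightarrow> h \<in> ?U"
    proof (intro exI conjI ballI impI)
      let ?e = "c - truncated_norm R ?N (\<lambda>u. y - f u)"
      show "0 < ?e" using f by (simp add: diff_gr0_ennreal)
      fix h assume h: "h \<in> L1_space T" "L1_norm T (\<lambda>s. h s - f s) < ?e"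
      have "truncated_norm R ?N (\<lambda>u. y - h u) \<le> truncated_norm R ?N (\<lambda>u. y - f u) +
          truncated_norm R ?N (\<lambda>u. (y - h u) - (y - f u))"
        using f h R by (intro truncated_norm_triangle borel_measurable_diff borel_measurable_const fm)
          (auto simp: space_L1_borel)
      also have "truncated_norm R ?N (\<lambda>u. (y - h u) - (y - f u)) \<le> (\<integral>\<^sup>+u. ennreal \<bar>h u - f u\<bar> \<partial>?N)"
        using truncated_norm_le_nn_integral[of R ?N "\<lambda>u. (y - h u) - (y - f u)"]
        by (simp add: abs_minus_commute)
      also have "\<dots> \<le> L1_norm T (\<lambda>s. h s - f s)" by (rule nn_integral_cell_le_L1_norm[OF s(1,2)])
      finally have "truncated_norm R ?N (\<lambda>u. y - h u) \<le> L1_norm T (\<lambda>s. h s - f s) + truncated_norm R ?N (\<lambda>u. y - f u)"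
        by (simp add: add.commute add_left_mono)
      also have "\<dots> < c"
      proof -
        have "truncated_norm R ?N (\<lambda>u. y - f u) < top"
          using f by (auto intro: less_le_trans)
        then show ?thesis using h(2) by (simp add: less_diff_eq_ennreal)
      qed
      finally show "h \<in> ?U" using h by (simp add: space_L1_borel)
    qed
  qed (auto simp: space_L1_borel)
  then show "?U \<in> sets (L1_borel T)"
    unfolding L1_borel_def by (subst sets_measure_of) (auto simp only: intro: sigma_sets.Basic)
qed

text \<open>Since \<open>g\<close> is measurable only as a map into the space of functions, \<open>g w u\<close> need not be jointly
  measurable in \<open>w\<close> and \<open>u\<close>, and Tonelli's theorem does not apply. Instead, the integral is
  measurable in \<open>w\<close> for fixed \<open>y\<close> and Lipschitz continuous in \<open>y\<close>.\<close>

lemma borel_measurable_truncated_distance: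
  assumes s: "0 \<le> s" "s + \<theta> \<le> T" "0 \<le> \<theta>" and R: "0 \<le> R"
    and g: "g \<in> measurable Q (L1_borel T)"
  shows "(\<lambda>(w, y). truncated_norm R (cell_measure s \<theta>) (\<lambda>u. y - g w u)) \<in> borel_measurable (Q \<Otimes>\<^sub>M borel)"
proof -
  let ?N = "cell_measure s \<theta>"
  let ?d = "\<lambda>w y. truncated_norm R ?N (\<lambda>u. y - g w u)"
  have fin: "truncated_norm R ?N p < top" for p
  proof -
    have "truncated_norm R ?N p \<le> ennreal R * ennreal \<theta>"
      using truncated_norm_bound[OF R, of ?N p] emeasure_cell_measure[OF s(3)] by simp
    also have "\<dots> < top" by (simp add: ennreal_mult_less_top)
    finally show ?thesis .
  qed
  have "(\<lambda>(w, y). enn2real (?d w y)) \<in> borel_measurable (Q \<Otimes>\<^sub>M borel)"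
  proof (rule borel_measurable_Caratheodory)
    show "(\<lambda>w. enn2real (?d w y)) \<in> borel_measurable Q" for y
      using measurable_compose[OF g L1_borel_measurable_truncated_norm[OF s R, of y]] by simp
    fix w assume "w \<in> space Q"
    then have "g w \<in> L1_space T" using measurable_space[OF g] by (simp add: space_L1_borel)
    then have [measurable]: "g w \<in> borel_measurable ?N"
      using s by (intro borel_measurable_cell) (auto simp: L1_space_def)
    have le: "enn2real (?d w y) \<le> enn2real (?d w z) + \<theta> * \<bar>y - z\<bar>" for y z
    proof -
      have "?d w y \<le> ?d w z + truncated_norm R ?N (\<lambda>u. (y - g w u) - (z - g w u))"
        by (rule truncated_norm_triangle) (use R in auto)
      also have "truncated_norm R ?N (\<lambda>u. (y - g w u) - (z - g w u)) \<le> ennreal \<bar>y - z\<bar> * ennreal \<theta>"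
        using truncated_norm_le_nn_integral[of R ?N "\<lambda>u. (y - g w u) - (z - g w u)"]
          emeasure_cell_measure[OF s(3)] by simp
      also have "\<dots> = ennreal (\<theta> * \<bar>y - z\<bar>)" using s by (simp add: ennreal_mult mult.commute)
      finally have "?d w y \<le> ?d w z + ennreal (\<theta> * \<bar>y - z\<bar>)" by (simp add: add_left_mono)
      also have "\<dots> = ennreal (enn2real (?d w z) + \<theta> * \<bar>y - z\<bar>)"
        using fin s by (simp add: less_top)
      finally have "?d w y \<le> ennreal (enn2real (?d w z) + \<theta> * \<bar>y - z\<bar>)" .
      then show ?thesis using s
        by (intro enn2real_leI) auto
    qed
    have "\<theta>-lipschitz_on UNIV (\<lambda>y. enn2real (?d w y))"
    proof (rule lipschitz_onI)
      fix y z
      show "dist (enn2real (?d w y)) (enn2real (?d w z)) \<le> \<theta> * dist y z"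
        using le[of y z] le[of z y] by (simp add: dist_real_def abs_le_iff abs_minus_commute)
    qed (use s in auto)
    then show "continuous_on UNIV (\<lambda>y. enn2real (?d w y))" by (rule lipschitz_on_continuous_on)
  qed
  then have "(\<lambda>p. ennreal ((\<lambda>(w, y). enn2real (?d w y)) p)) \<in> borel_measurable (Q \<Otimes>\<^sub>M borel)"
    by (rule measurable_compose[OF _ measurable_ennreal])
  then show ?thesis using fin by (simp add: split_beta less_top)
qed

section \<open>Linearisation of the solution\<close>

context brownian_motion
begin

lemma coefficient_past:
  assumes "\<sigma> \<in> borel_measurable (restrict_space borel ({0..T} \<times> UNIV))" "0 \<le> a" "a \<le> T"
    and "x \<in> borel_measurable (F a)"
  shows "(\<lambda>\<omega>. \<sigma> (a, x \<omega> :: real)) \<in> borel_measurable (F a)"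
proof (rule measurable_compose[OF _ assms(1)])
  have "(\<lambda>\<omega>. (a, x \<omega>)) \<in> measurable (F a) borel"
    using assms(4) unfolding borel_prod[symmetric] by measurable
  then show "(\<lambda>\<omega>. (a, x \<omega>)) \<in> measurable (F a) (restrict_space borel ({0..T} \<times> UNIV))"
    by (rule measurable_restrict_space2[rotated]) (use assms in auto)
qed

text \<open>On \<open>A \<inter> G\<close> the path stays in the region where the coefficients are bounded and Lipschitz. The terms
  of the bound come, in this order, from the drift, from the threshold \<open>\<alpha> = \<epsilon> * sqrt h\<close> used for the two random
  deviations, from the complement of \<open>G\<close>, from freezing \<open>\<sigma>\<close> at time \<open>a\<close>, and from the
  increment of \<open>W\<close> between the midpoint \<open>a + h\<close> and \<open>u\<close>.\<close>

lemma sde_increment_linear: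
  assumes sde: "sde_solution M F W T \<mu> \<sigma> X"
    and \<sigma>m: "\<sigma> \<in> borel_measurable (restrict_space borel ({0..T} \<times> UNIV))"
    and times: "0 \<le> a" "t0 \<le> a" "a + 2 * h \<le> T0" "T0 \<le> T" "0 < h" "0 \<le> \<theta>" "a + h \<le> u" "u \<le> a + h + \<theta>" "\<theta> \<le> h"
    and bounds: "\<And>p. p \<in> {t0..T0} \<times> {\<xi> - \<delta>..\<xi> + \<delta>} \<Longrightarrow> \<bar>\<mu> p\<bar> \<le> K \<and> \<bar>\<sigma> p\<bar> \<le> K"
    and lip: "L-lipschitz_on ({t0..T0} \<times> {\<xi> - \<delta>..\<xi> + \<delta>}) \<sigma>"
    and pos: "0 < K" "0 < L" "0 < \<rho>" "0 < \<epsilon>" and d: "d + \<rho> \<le> \<delta>"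
    and G: "G \<in> events" "\<And>\<omega> v. \<omega> \<in> G \<Longrightarrow> v \<in> {a..a + 2 * h} \<Longrightarrow> \<bar>X v \<omega> - X a \<omega>\<bar> \<le> \<rho>"
  defines "A \<equiv> {\<omega>\<in>space M. \<bar>X a \<omega> - \<xi>\<bar> < d}"
    and "\<eta> \<equiv> \<lambda>\<omega>. if \<bar>X a \<omega> - \<xi>\<bar> < d then \<sigma> (a, X a \<omega>) else 0"
  shows "(\<integral>\<^sup>+\<omega>. ennreal (min \<bar>X u \<omega> - (X a \<omega> + \<eta> \<omega> * (W (a + h) \<omega> - W a \<omega>))\<bar> (sqrt h)) * indicator A \<omega> \<partial>M)
    \<le> ennreal (sqrt h * (2 * K * sqrt h + 4 * \<epsilon> + prob (space M - G) +
        8 * L\<^sup>2 * (2 * h + \<rho>)\<^sup>2 / \<epsilon>\<^sup>2 + K\<^sup>2 * \<theta> / (h * \<epsilon>\<^sup>2)))"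
proof -
  let ?Q = "{t0..T0} \<times> {\<xi> - \<delta>..\<xi> + \<delta>}"
  define \<alpha> where "\<alpha> = \<epsilon> * sqrt h"
  define \<beta> where "\<beta> = 2 * h * (L\<^sup>2 * (2 * h + \<rho>)\<^sup>2)"
  have ab: "0 < \<alpha>" "0 < \<beta>" using pos times by (auto simp: \<alpha>_def \<beta>_def)
  have \<alpha>2: "\<alpha>\<^sup>2 = h * \<epsilon>\<^sup>2" using times by (simp add: \<alpha>_def power_mult_distrib)
  obtain Y where Y: "has_ito_integral M F W T (\<lambda>s \<omega>. \<sigma> (s, X s \<omega>)) Y"
    and XY: "AE \<omega> in M. \<forall>t\<in>{0..T}. X t \<omega> = X 0 \<omega> + (LBINT s:{0..t}. \<mu> (s, X s \<omega>)) + Y t \<omega>"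
    and \<mu>i: "AE \<omega> in M. set_integrable lborel {0..T} (\<lambda>s. \<mu> (s, X s \<omega>))"
    and XF: "\<And>t. 0 \<le> t \<Longrightarrow> t \<le> T \<Longrightarrow> X t \<in> borel_measurable (F t)"
    using sde unfolding sde_solution_def adapted_on_def by auto
  have aT: "a \<le> T" "a < u" "u \<le> T" "u \<le> a + 2 * h" using times by auto
  have YF: "Y t \<in> borel_measurable (F t)" if "0 \<le> t" "t \<le> T" for t
    using Y that unfolding has_ito_integral_def adapted_on_def by auto
  have XM[measurable]: "X a \<in> borel_measurable M" "X u \<in> borel_measurable M"
    "Y a \<in> borel_measurable M" "Y u \<in> borel_measurable M"
    using measurable_F_imp_M[OF _ XF] measurable_F_imp_M[OF _ YF] times aT by auto
  have [measurable]: "W a \<in> borel_measurable M" "W u \<in> borel_measurable M" "W (a + h) \<in> borel_measurable M"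
    using W_M times by auto
  have [measurable]: "A \<in> events" unfolding A_def by measurable
  note [measurable] = G(1)
  have XaF[measurable]: "X a \<in> borel_measurable (F a)" using XF times aT by auto
  have [measurable]: "(\<lambda>\<omega>. \<sigma> (a, X a \<omega>)) \<in> borel_measurable (F a)"
    by (rule coefficient_past[OF \<sigma>m _ _ XaF]) (use times aT in auto)
  have \<eta>F: "\<eta> \<in> borel_measurable (F a)" unfolding \<eta>_def by measurable
  have [measurable]: "\<eta> \<in> borel_measurable M" using measurable_F_imp_M[OF _ \<eta>F] times by auto
  have inQ: "(v, X v \<omega>) \<in> ?Q" if "\<omega> \<in> A \<inter> G" "v \<in> {a..a + 2 * h}" for \<omega> v
    using G(2)[of \<omega> v] that times d by (auto simp: A_def abs_le_iff abs_less_iff)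
  have inQa: "(a, X a \<omega>) \<in> ?Q" if "\<bar>X a \<omega> - \<xi>\<bar> < d" for \<omega>
    using that times d pos by (auto simp: abs_less_iff)
  have \<eta>K: "\<bar>\<eta> \<omega>\<bar> \<le> K" for \<omega>
    using bounds[OF inQa] pos by (auto simp: \<eta>_def)
  have \<eta>eq: "\<eta> \<omega> = \<sigma> (a, X a \<omega>)" if "\<omega> \<in> A" for \<omega> using that by (simp add: \<eta>_def A_def)
  define B1 where "B1 = {\<omega>\<in>A \<inter> G. 3 * \<alpha> < \<bar>Y u \<omega> - Y a \<omega> - \<eta> \<omega> * (W u \<omega> - W a \<omega>)\<bar>}"
  define B2 where "B2 = {\<omega>\<in>space M. (\<alpha> / K)\<^sup>2 \<le> (W u \<omega> - W (a + h) \<omega>)\<^sup>2}"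
  have [measurable]: "B1 \<in> events" unfolding B1_def by measurable
  have [measurable]: "B2 \<in> events" unfolding B2_def by measurable
  have PB1: "prob B1 \<le> 8 * L\<^sup>2 * (2 * h + \<rho>)\<^sup>2 / \<epsilon>\<^sup>2"
  proof -
    have "prob B1 \<le> 4 * \<beta> / \<alpha>\<^sup>2"
      unfolding B1_def
    proof (rule ito_increment_deviation[OF Y times(1) aT(2,3) \<eta>F \<eta>K _ _ ab])
      fix \<omega> assume \<omega>: "\<omega> \<in> A \<inter> G"
      have "(\<integral>\<^sup>+v\<in>{a<..u}. ennreal ((\<sigma> (v, X v \<omega>) - \<eta> \<omega>)\<^sup>2) \<partial>lborel) \<le>
          (\<integral>\<^sup>+v. ennreal (L\<^sup>2 * (2 * h + \<rho>)\<^sup>2) * indicator {a<..u} v \<partial>lborel)"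
      proof (rule nn_integral_mono)
        fix v
        have "(\<sigma> (v, X v \<omega>) - \<eta> \<omega>)\<^sup>2 \<le> L\<^sup>2 * (2 * h + \<rho>)\<^sup>2" if v: "v \<in> {a<..u}"
        proof -
          have va: "v \<in> {a..a + 2 * h}" "a \<in> {a..a + 2 * h}" using v aT times by auto
          have "\<bar>\<sigma> (v, X v \<omega>) - \<eta> \<omega>\<bar> \<le> L * dist (v, X v \<omega>) (a, X a \<omega>)"
            using lipschitz_onD[OF lip inQ[OF \<omega> va(1)] inQ[OF \<omega> va(2)]] \<eta>eq \<omega> by (simp add: dist_real_def)
          also have "dist (v, X v \<omega>) (a, X a \<omega>) \<le> \<bar>v - a\<bar> + \<bar>X v \<omega> - X a \<omega>\<bar>"
            unfolding dist_Pair_Pair using sqrt_sum_squares_le_sum_abs[of "dist v a" "dist (X v \<omega>) (X a \<omega>)"]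
            by (simp add: dist_real_def)
          also have "\<dots> \<le> 2 * h + \<rho>" using G(2)[of \<omega> v] va \<omega> by auto
          finally have "\<bar>\<sigma> (v, X v \<omega>) - \<eta> \<omega>\<bar> \<le> L * (2 * h + \<rho>)" using pos by (simp add: mult_left_mono)
          then show ?thesis using power_mono[of "\<bar>\<sigma> (v, X v \<omega>) - \<eta> \<omega>\<bar>" "L * (2 * h + \<rho>)" 2]
            by (simp add: power_mult_distrib)
        qed
        then show "ennreal ((\<sigma> (v, X v \<omega>) - \<eta> \<omega>)\<^sup>2) * indicator {a<..u} v \<le>
          ennreal (L\<^sup>2 * (2 * h + \<rho>)\<^sup>2) * indicator {a<..u} v"
          by (auto simp: indicator_def intro: ennreal_leI)
      qed
      also have "\<dots> = ennreal (L\<^sup>2 * (2 * h + \<rho>)\<^sup>2 * (u - a))"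
        using aT by (subst nn_integral_cmult_indicator) (auto simp: ennreal_mult)
      also have "\<dots> \<le> ennreal \<beta>"
        using aT unfolding \<beta>_def by (subst mult.commute) (auto intro!: ennreal_leI mult_right_mono)
      finally show "(\<integral>\<^sup>+v\<in>{a<..u}. ennreal ((\<sigma> (v, X v \<omega>) - \<eta> \<omega>)\<^sup>2) \<partial>lborel) \<le> ennreal \<beta>" .
    qed measurable
    also have "\<dots> = 8 * L\<^sup>2 * (2 * h + \<rho>)\<^sup>2 / \<epsilon>\<^sup>2"
      unfolding \<alpha>2 \<beta>_def using times by (simp add: field_simps)
    finally show ?thesis .
  qed
  have PB2: "prob B2 \<le> K\<^sup>2 * \<theta> / (h * \<epsilon>\<^sup>2)"
  proof -
    have m: "integrable M (\<lambda>\<omega>. (W u \<omega> - W (a + h) \<omega>)\<^sup>2)"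
      "expectation (\<lambda>\<omega>. (W u \<omega> - W (a + h) \<omega>)\<^sup>2) = u - (a + h)"
      using increment_moments[of "a + h" u] times by auto
    have "prob B2 \<le> expectation (\<lambda>\<omega>. (W u \<omega> - W (a + h) \<omega>)\<^sup>2) / (\<alpha> / K)\<^sup>2"
      unfolding B2_def
      by (rule integral_Markov_inequality_measure[where A = "space M", OF m(1), simplified])
        (use ab pos in auto)
    also have "\<dots> \<le> \<theta> / (\<alpha> / K)\<^sup>2"
      unfolding m(2) using times by (intro divide_right_mono) auto
    also have "\<dots> = K\<^sup>2 * \<theta> / (h * \<epsilon>\<^sup>2)" using \<alpha>2 by (simp add: power_divide)
    finally show ?thesis .
  qed
  let ?bad = "(space M - G) \<union> B1 \<union> B2"
  let ?D = "\<lambda>\<omega>. X u \<omega> - (X a \<omega> + \<eta> \<omega> * (W (a + h) \<omega> - W a \<omega>))"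
  have Pbad: "prob ?bad \<le> prob (space M - G) + 8 * L\<^sup>2 * (2 * h + \<rho>)\<^sup>2 / \<epsilon>\<^sup>2 + K\<^sup>2 * \<theta> / (h * \<epsilon>\<^sup>2)"
  proof -
    have "prob ?bad \<le> prob ((space M - G) \<union> B1) + prob B2" by (intro measure_Un_le) measurable
    also have "prob ((space M - G) \<union> B1) \<le> prob (space M - G) + prob B1" by (intro measure_Un_le) measurable
    finally show ?thesis using PB1 PB2 by linarith
  qed
  have AE_D: "AE \<omega> in M. \<omega> \<in> A - ?bad \<longrightarrow> \<bar>?D \<omega>\<bar> \<le> 2 * h * K + 4 * \<alpha>"
    using XY \<mu>i
  proof eventually_elim
    case (elim \<omega>)
    show ?case
    proof
      assume \<omega>: "\<omega> \<in> A - ?bad"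
      then have AG: "\<omega> \<in> A \<inter> G" by (auto simp: A_def)
      let ?m = "\<lambda>s. \<mu> (s, X s \<omega>)"
      have i1: "set_integrable lborel {0..a} ?m" "set_integrable lborel {a<..u} ?m"
        by (rule set_integrable_subset[OF elim(2)]; use times aT in auto)+
      have "{0..u} = {0..a} \<union> {a<..u}" using times aT by auto
      then have "(LBINT s:{0..u}. ?m s) = (LBINT s:{0..a}. ?m s) + (LBINT s:{a<..u}. ?m s)"
        using set_integral_Un[OF _ i1] by (simp add: disjoint_iff)
      moreover have "X u \<omega> = X 0 \<omega> + (LBINT s:{0..u}. ?m s) + Y u \<omega>"
        "X a \<omega> = X 0 \<omega> + (LBINT s:{0..a}. ?m s) + Y a \<omega>"
        by (rule bspec[OF elim(1)]; use times aT in simp)+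
      ultimately have inc: "X u \<omega> - X a \<omega> = (LBINT s:{a<..u}. ?m s) + (Y u \<omega> - Y a \<omega>)" by simp
      have drift: "\<bar>LBINT s:{a<..u}. ?m s\<bar> \<le> 2 * h * K"
      proof -
        have ic: "set_integrable lborel {a<..u} (\<lambda>s. K)" using aT by (simp add: set_integrable_def)
        have "\<bar>LBINT s:{a<..u}. ?m s\<bar> \<le> (LBINT s:{a<..u}. \<bar>?m s\<bar>)"
          using set_integral_norm_bound[OF i1(2)] by simp
        also have "\<dots> \<le> (LBINT s:{a<..u}. K)"
        proof (rule set_integral_mono[OF set_integrable_abs[OF i1(2)] ic])
          fix v assume "v \<in> {a<..u}"
          then have "v \<in> {a..a + 2 * h}" using aT by auto
          from bounds[OF inQ[OF AG this]] show "\<bar>?m v\<bar> \<le> K" by simp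
        qed
        also have "\<dots> = (u - a) * K" using aT by (simp add: set_lebesgue_integral_def)
        also have "\<dots> \<le> 2 * h * K" using aT pos by (intro mult_right_mono) auto
        finally show ?thesis .
      qed
      have B1': "\<bar>Y u \<omega> - Y a \<omega> - \<eta> \<omega> * (W u \<omega> - W a \<omega>)\<bar> \<le> 3 * \<alpha>"
        using \<omega> AG by (auto simp: B1_def)
      have "\<not> (\<alpha> / K)\<^sup>2 \<le> (W u \<omega> - W (a + h) \<omega>)\<^sup>2" using \<omega> by (auto simp: B2_def A_def)
      then have "\<not> \<bar>\<alpha> / K\<bar> \<le> \<bar>W u \<omega> - W (a + h) \<omega>\<bar>" unfolding abs_le_square_iff .
      then have "\<bar>W u \<omega> - W (a + h) \<omega>\<bar> \<le> \<alpha> / K" using ab pos by simp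
      then have "\<bar>\<eta> \<omega>\<bar> * \<bar>W u \<omega> - W (a + h) \<omega>\<bar> \<le> K * (\<alpha> / K)"
        using \<eta>K pos by (intro mult_mono) auto
      then have B2': "\<bar>\<eta> \<omega> * (W u \<omega> - W (a + h) \<omega>)\<bar> \<le> \<alpha>" using pos by (simp add: abs_mult)
      have "?D \<omega> = (LBINT s:{a<..u}. ?m s) + (Y u \<omega> - Y a \<omega> - \<eta> \<omega> * (W u \<omega> - W a \<omega>))
          + \<eta> \<omega> * (W u \<omega> - W (a + h) \<omega>)"
        using inc by (simp add: algebra_simps)
      then show "\<bar>?D \<omega>\<bar> \<le> 2 * h * K + 4 * \<alpha>" using drift B1' B2' by linarith
    qed
  qed
  have "(\<integral>\<^sup>+\<omega>. ennreal (min \<bar>?D \<omega>\<bar> (sqrt h)) * indicator A \<omega> \<partial>M) \<le>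
      (\<integral>\<^sup>+\<omega>. ennreal (2 * h * K + 4 * \<alpha>) + ennreal (sqrt h) * indicator ?bad \<omega> \<partial>M)"
  proof (rule nn_integral_mono_AE)
    show "AE \<omega> in M. ennreal (min \<bar>?D \<omega>\<bar> (sqrt h)) * indicator A \<omega> \<le>
        ennreal (2 * h * K + 4 * \<alpha>) + ennreal (sqrt h) * indicator ?bad \<omega>"
      using AE_D
    proof eventually_elim
      case (elim \<omega>)
      show ?case
      proof (cases "\<omega> \<in> ?bad")
        case True
        have "ennreal (min \<bar>?D \<omega>\<bar> (sqrt h)) * indicator A \<omega> \<le> ennreal (sqrt h)"
          by (auto simp: indicator_def intro: ennreal_leI)
        also have "\<dots> \<le> ennreal (2 * h * K + 4 * \<alpha>) + ennreal (sqrt h)" by simp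
        finally show ?thesis unfolding indicator_simps(1)[OF True] by simp
      next
        case False
        then have "ennreal (min \<bar>?D \<omega>\<bar> (sqrt h)) * indicator A \<omega> \<le> ennreal (2 * h * K + 4 * \<alpha>)"
          using elim by (cases "\<omega> \<in> A") (auto intro!: ennreal_leI)
        also have "\<dots> \<le> ennreal (2 * h * K + 4 * \<alpha>) + ennreal (sqrt h) * indicator ?bad \<omega>" by simp
        finally show ?thesis .
      qed
    qed
  qed
  also have "\<dots> = ennreal (2 * h * K + 4 * \<alpha>) + ennreal (sqrt h) * ennreal (prob ?bad)"
    by (subst nn_integral_add) (simp_all add: nn_integral_cmult_indicator emeasure_eq_measure prob_space)
  also have "\<dots> = ennreal (2 * h * K + 4 * \<alpha> + sqrt h * prob ?bad)"
    using times pos ab by (simp add: ennreal_mult)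
  also have "2 * h * K + 4 * \<alpha> + sqrt h * prob ?bad = sqrt h * (2 * K * sqrt h + 4 * \<epsilon> + prob ?bad)"
    using times by (simp add: \<alpha>_def algebra_simps)
  also have "ennreal \<dots> \<le> ennreal (sqrt h * (2 * K * sqrt h + 4 * \<epsilon> + prob (space M - G) +
        8 * L\<^sup>2 * (2 * h + \<rho>)\<^sup>2 / \<epsilon>\<^sup>2 + K\<^sup>2 * \<theta> / (h * \<epsilon>\<^sup>2)))"
    using Pbad times by (intro ennreal_leI mult_left_mono) auto
  finally show ?thesis .
qed

end

section \<open>Moduli of continuity in probability\<close>

lemma (in prob_space) incseq_prob_large:
  assumes A: "range A \<subseteq> events" "incseq A" and p: "p < prob (\<Union>i. A i)"
  obtains k :: nat where "p < prob (A k)"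
proof -
  have "(\<lambda>i. prob (A i)) \<longlonglongrightarrow> prob (\<Union>i. A i)" by (rule finite_Lim_measure_incseq[OF A])
  from order_tendstoD(1)[OF this p] obtain k where "p < prob (A k)"
    by (auto simp: eventually_sequentially)
  then show ?thesis by (rule that)
qed

text \<open>For each sample point this is uniform continuity on a compact interval. Restricting the
  modulus to rational times makes it an event, and continuity of the paths removes the restriction; times are clamped to
  \<open>[0, T]\<close>, so that all rational times can be used.\<close>

lemma (in prob_space) path_modulus:
  fixes X :: "real \<Rightarrow> 'a \<Rightarrow> real"
  assumes T: "0 \<le> T" and X: "\<And>t. t \<in> {0..T} \<Longrightarrow> X t \<in> borel_measurable M"
    and cont: "\<And>\<omega>. \<omega> \<in> space M \<Longrightarrow> continuous_on {0..T} (\<lambda>t. X t \<omega>)"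
    and pos: "0 < \<rho>" "0 < q"
  obtains \<kappa> G where "0 < \<kappa>" "G \<in> events" "prob (space M - G) \<le> q"
    "\<And>\<omega> u v. \<omega> \<in> G \<Longrightarrow> u \<in> {0..T} \<Longrightarrow> v \<in> {0..T} \<Longrightarrow> \<bar>u - v\<bar> < \<kappa> \<Longrightarrow> \<bar>X u \<omega> - X v \<omega>\<bar> \<le> \<rho>"
proof -
  define cl where "cl u = max 0 (min T u)" for u :: real
  have cl: "cl u \<in> {0..T}" for u using T by (auto simp: cl_def)
  have cl_id: "u \<in> {0..T} \<Longrightarrow> cl u = u" for u by (auto simp: cl_def)
  have cl_lip: "\<bar>cl u - cl v\<bar> \<le> \<bar>u - v\<bar>" for u v by (auto simp: cl_def)
  have cont': "continuous_on S (\<lambda>p. X (cl (f p)) \<omega>)" if "\<omega> \<in> space M" "continuous_on S f" for S and f :: "real \<times> real \<Rightarrow> real" and \<omega>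
    using that cl by (intro continuous_on_compose2[OF cont[OF that(1)]]) (auto simp: cl_def intro!: continuous_intros)
  define G where "G k = {\<omega>\<in>space M. \<forall>u v :: rat. \<bar>of_rat u - of_rat v\<bar> < 1 / real (Suc k) \<longrightarrow>
    \<bar>X (cl (of_rat u)) \<omega> - X (cl (of_rat v)) \<omega>\<bar> \<le> \<rho>}" for k :: nat
  have [measurable]: "X (cl u) \<in> borel_measurable M" for u using X cl by blast
  have GM: "G k \<in> events" for k unfolding G_def by measurable
  have Gmono: "incseq G"
  proof (rule incseq_SucI, rule subsetI)
    fix k \<omega> assume \<omega>: "\<omega> \<in> G k"
    have "1 / real (Suc (Suc k)) \<le> 1 / real (Suc k)" by (simp add: frac_le)
    then show "\<omega> \<in> G (Suc k)" using \<omega> unfolding G_def by (auto dest: order_less_le_trans)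
  qed
  have "(\<Union>k. G k) = space M"
  proof (intro equalityI subsetI)
    fix \<omega> assume \<omega>: "\<omega> \<in> space M"
    have "uniformly_continuous_on {0..T} (\<lambda>t. X t \<omega>)"
      by (intro compact_uniformly_continuous cont[OF \<omega>]) auto
    then obtain d where d: "0 < d" "\<And>u v. u \<in> {0..T} \<Longrightarrow> v \<in> {0..T} \<Longrightarrow> dist v u < d \<Longrightarrow> dist (X v \<omega>) (X u \<omega>) < \<rho>"
      unfolding uniformly_continuous_on_def using pos(1) by metis
    obtain k :: nat where k: "1 / real (Suc k) < d" using nat_approx_posE[OF d(1)] by auto
    have "\<bar>X (cl u) \<omega> - X (cl v) \<omega>\<bar> \<le> \<rho>" if "\<bar>u - v\<bar> < 1 / real (Suc k)" for u v
      using d(2)[of "cl v" "cl u"] cl_lip[of u v] that k cl by (auto simp: dist_real_def)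
    then show "\<omega> \<in> (\<Union>k. G k)" using \<omega> by (auto simp: G_def)
  qed (auto simp: G_def)
  then have "1 - q < prob (\<Union>k. G k)" using pos by (simp add: prob_space)
  then obtain k where k: "1 - q < prob (G k)"
    using incseq_prob_large[of G] GM Gmono by blast
  show ?thesis
  proof
    show "0 < 1 / real (Suc k)" by simp
    show "G k \<in> events" by (rule GM)
    show "prob (space M - G k) \<le> q" using k GM by (simp add: prob_compl)
    fix \<omega> u v assume \<omega>: "\<omega> \<in> G k" and uv: "u \<in> {0..T}" "v \<in> {0..T}" "\<bar>u - v\<bar> < 1 / real (Suc k)"
    have sp: "\<omega> \<in> space M" using \<omega> by (auto simp: G_def)
    show "\<bar>X u \<omega> - X v \<omega>\<bar> \<le> \<rho>"
    proof (rule ccontr)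
      assume n: "\<not> ?thesis"
      let ?S = "{p. \<bar>fst p - snd p\<bar> < 1 / real (Suc k)} \<inter> {p. \<rho> < \<bar>X (cl (fst p)) \<omega> - X (cl (snd p)) \<omega>\<bar>}"
      have "open ?S"
        by (intro open_Int open_Collect_less continuous_intros cont'[OF sp])
      moreover have "(u, v) \<in> ?S" using n uv by (simp add: cl_id)
      ultimately obtain e where e: "0 < e" "ball (u, v) e \<subseteq> ?S" unfolding open_contains_ball by blast
      obtain r where r: "u < of_rat r" "of_rat r < u + e / 2" using of_rat_dense[of u "u + e / 2"] e by auto
      obtain r' where r': "v < of_rat r'" "of_rat r' < v + e / 2" using of_rat_dense[of v "v + e / 2"] e by auto
      have "dist (u, v) (of_rat r, of_rat r') \<le> \<bar>u - of_rat r\<bar> + \<bar>v - of_rat r'\<bar>"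
        unfolding dist_Pair_Pair using sqrt_sum_squares_le_sum_abs[of "dist u (of_rat r)" "dist v (of_rat r')"]
        by (simp add: dist_real_def)
      also have "\<dots> < e" using r r' by auto
      finally have "(of_rat r, of_rat r') \<in> ?S" using e(2) by (auto simp: mem_ball)
      moreover from \<omega> have "\<bar>of_rat r - of_rat r'\<bar> < 1 / real (Suc k) \<longrightarrow>
          \<bar>X (cl (of_rat r)) \<omega> - X (cl (of_rat r')) \<omega>\<bar> \<le> \<rho>" unfolding G_def by blast
      ultimately show False by auto
    qed
  qed
qed

section \<open>The error on one cell\<close>

text \<open>The difference \<open>P - Q\<close> is a measurable function below \<open>Z\<close>; additivity of the integral is used
  for it and not for \<open>Z\<close>, which will be the \<open>L\<^sup>1\<close> error.\<close>

lemma nn_integral_le_add: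
  assumes P: "P \<in> borel_measurable M" and Q: "Q \<in> borel_measurable M" "(\<integral>\<^sup>+\<omega>. Q \<omega> \<partial>M) \<noteq> \<infinity>"
    and le: "\<And>\<omega>. \<omega> \<in> space M \<Longrightarrow> P \<omega> \<le> Z \<omega> + Q \<omega>"
  shows "(\<integral>\<^sup>+\<omega>. P \<omega> \<partial>M) \<le> (\<integral>\<^sup>+\<omega>. Z \<omega> \<partial>M) + (\<integral>\<^sup>+\<omega>. Q \<omega> \<partial>M)"
proof -
  have fin: "AE \<omega> in M. Q \<omega> \<noteq> \<infinity>" by (rule nn_integral_PInf_AE[OF Q])
  have "(\<integral>\<^sup>+\<omega>. P \<omega> \<partial>M) \<le> (\<integral>\<^sup>+\<omega>. (P \<omega> - Q \<omega>) + Q \<omega> \<partial>M)"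
  proof (rule nn_integral_mono)
    fix \<omega>
    show "P \<omega> \<le> P \<omega> - Q \<omega> + Q \<omega>"
      using diff_add_cancel_ennreal[of "Q \<omega>" "P \<omega>"] by (cases "Q \<omega> \<le> P \<omega>") (auto intro: add_increasing)
  qed
  also have "\<dots> = (\<integral>\<^sup>+\<omega>. P \<omega> - Q \<omega> \<partial>M) + (\<integral>\<^sup>+\<omega>. Q \<omega> \<partial>M)"
    using P Q by (intro nn_integral_add) measurable
  also have "(\<integral>\<^sup>+\<omega>. P \<omega> - Q \<omega> \<partial>M) \<le> (\<integral>\<^sup>+\<omega>. Z \<omega> \<partial>M)"
  proof (rule nn_integral_mono_AE)
    show "AE \<omega> in M. P \<omega> - Q \<omega> \<le> Z \<omega>"
      using fin AE_space
    proof eventually_elim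
      case (elim \<omega>)
      then show ?case using le[of \<omega>] by (simp add: ennreal_minus_le_iff add.commute)
    qed
  qed
  finally show ?thesis by (simp add: add_right_mono)
qed

lemma sum_cells_le_L1_norm:
  assumes I: "finite I" and disj: "disjoint_family_on (\<lambda>l. {s l..<s l + \<theta>}) I"
    and s: "\<And>l. l \<in> I \<Longrightarrow> 0 \<le> s l \<and> s l + \<theta> \<le> T"
    and f: "f \<in> borel_measurable (restrict_space borel {0..T})"
  shows "(\<Sum>l\<in>I. \<integral>\<^sup>+u. ennreal \<bar>f u\<bar> \<partial>cell_measure (s l) \<theta>) \<le> L1_norm T f"
proof -
  let ?C = "\<lambda>l. {s l..<s l + \<theta>}"
  have m: "(\<lambda>u. ennreal \<bar>f u\<bar> * indicator (?C l) u) \<in> borel_measurable lborel" if "l \<in> I" for l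
  proof -
    have [measurable]: "f \<in> borel_measurable (cell_measure (s l) \<theta>)"
      using s[OF that] by (intro borel_measurable_cell[OF f]) auto
    have "(\<lambda>u. ennreal \<bar>f u\<bar>) \<in> borel_measurable (cell_measure (s l) \<theta>)" by measurable
    then show ?thesis by (subst (asm) borel_measurable_restrict_space_iff_ennreal) auto
  qed
  have "(\<Sum>l\<in>I. \<integral>\<^sup>+u. ennreal \<bar>f u\<bar> \<partial>cell_measure (s l) \<theta>) =
      (\<Sum>l\<in>I. \<integral>\<^sup>+u. ennreal \<bar>f u\<bar> * indicator (?C l) u \<partial>lborel)"
    unfolding nn_integral_cell_measure ..
  also have "\<dots> = (\<integral>\<^sup>+u. (\<Sum>l\<in>I. ennreal \<bar>f u\<bar> * indicator (?C l) u) \<partial>lborel)"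
    by (rule nn_integral_sum[symmetric]) (rule m)
  also have "\<dots> \<le> (\<integral>\<^sup>+u. ennreal \<bar>f u\<bar> * indicator {0..T} u \<partial>lborel)"
  proof (rule nn_integral_mono)
    fix u
    have "(\<Sum>l\<in>I. ennreal \<bar>f u\<bar> * indicator (?C l) u) = ennreal \<bar>f u\<bar> * indicator (\<Union>l\<in>I. ?C l) u"
      unfolding indicator_UN_disjoint[OF I disj] by (simp add: sum_distrib_left)
    also have "\<dots> \<le> ennreal \<bar>f u\<bar> * indicator {0..T} u"
      using s by (intro mult_left_mono) (fastforce simp: indicator_def)+
    finally show "(\<Sum>l\<in>I. ennreal \<bar>f u\<bar> * indicator (?C l) u) \<le> ennreal \<bar>f u\<bar> * indicator {0..T} u" .
  qed
  finally show ?thesis unfolding L1_norm_def .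
qed

context brownian_motion
begin

text \<open>The witnesses are the truncated errors over the cell, restricted to the event that \<open>X a\<close> is near
  \<open>\<xi>\<close>: \<open>P\<close> compares the prediction with the linearised value at the midpoint, \<open>Q\<close> compares \<open>X\<close> with
  that value. The last clause is the triangle inequality. It is kept for each sample point, so that the cells
  can be added before expectations are taken.\<close>

lemma cell_error:
  fixes g :: "(nat \<Rightarrow> real) \<Rightarrow> real \<Rightarrow> real" and \<tau> :: "nat \<Rightarrow> real"
  assumes sde: "sde_solution M F W T \<mu> \<sigma> X"
    and \<sigma>m: "\<sigma> \<in> borel_measurable (restrict_space borel ({0..T} \<times> UNIV))"
    and times: "0 \<le> a" "t0 \<le> a" "a + 2 * h \<le> T0" "T0 \<le> T" "0 < h" "0 < \<theta>" "\<theta> \<le> h"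
    and bounds: "\<And>p. p \<in> {t0..T0} \<times> {\<xi> - \<delta>..\<xi> + \<delta>} \<Longrightarrow> \<bar>\<mu> p\<bar> \<le> K \<and> \<bar>\<sigma> p\<bar> \<le> K"
    and nondeg: "\<And>p. p \<in> {t0..T0} \<times> ball \<xi> \<delta> \<Longrightarrow> c \<le> \<bar>\<sigma> p\<bar>" "0 < c"
    and lip: "L-lipschitz_on ({t0..T0} \<times> {\<xi> - \<delta>..\<xi> + \<delta>}) \<sigma>"
    and pos: "0 < K" "0 < L" "0 < \<rho>" "0 < \<epsilon>" and d: "d + \<rho> \<le> \<delta>"
    and G: "G \<in> events" "\<And>\<omega> v. \<omega> \<in> G \<Longrightarrow> v \<in> {a..a + 2 * h} \<Longrightarrow> \<bar>X v \<omega> - X a \<omega>\<bar> \<le> \<rho>"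
    and \<tau>: "\<And>i. i \<in> {1..n} \<Longrightarrow> 0 \<le> \<tau> i \<and> (\<tau> i \<le> a \<or> a + 2 * h \<le> \<tau> i)"
    and g: "g \<in> measurable (Pi\<^sub>M {1..n} (\<lambda>_. borel)) (L1_borel T)"
  shows "\<exists>P Q. P \<in> borel_measurable M \<and> Q \<in> borel_measurable M \<and>
    ennreal (\<theta> * sqrt h * min (c / 2) 1 / 4 * prob {\<omega>\<in>space M. \<bar>X a \<omega> - \<xi>\<bar> < d}) \<le> (\<integral>\<^sup>+\<omega>. P \<omega> \<partial>M) \<and>
    (\<integral>\<^sup>+\<omega>. Q \<omega> \<partial>M) \<le> ennreal (\<theta> * (sqrt h * (2 * K * sqrt h + 4 * \<epsilon> + prob (space M - G) +
        8 * L\<^sup>2 * (2 * h + \<rho>)\<^sup>2 / \<epsilon>\<^sup>2 + K\<^sup>2 * \<theta> / (h * \<epsilon>\<^sup>2)))) \<and>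
    (\<forall>\<omega>\<in>space M. P \<omega> \<le> (\<integral>\<^sup>+u. ennreal \<bar>X u \<omega> - g (\<lambda>i\<in>{1..n}. W (\<tau> i) \<omega>) u\<bar> \<partial>cell_measure (a + h) \<theta>) + Q \<omega>)"
proof -
  let ?N = "cell_measure (a + h) \<theta>"
  let ?PI = "Pi\<^sub>M {1..n} (\<lambda>_::nat. borel :: real measure)"
  let ?w = "\<lambda>\<omega>. \<lambda>i\<in>{1..n}. W (\<tau> i) \<omega>"
  define A where "A = {\<omega>\<in>space M. \<bar>X a \<omega> - \<xi>\<bar> < d}"
  define \<eta> where "\<eta> \<omega> = (if \<bar>X a \<omega> - \<xi>\<bar> < d then \<sigma> (a, X a \<omega>) else 0)" for \<omega>
  define y where "y \<omega> = X a \<omega> + \<eta> \<omega> * (W (a + h) \<omega> - W a \<omega>)" for \<omega>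
  define P where "P \<omega> = truncated_norm (sqrt h) ?N (\<lambda>u. y \<omega> - g (?w \<omega>) u) * indicator A \<omega>" for \<omega>
  define Q where "Q \<omega> = truncated_norm (sqrt h) ?N (\<lambda>u. X u \<omega> - y \<omega>) * indicator A \<omega>" for \<omega>
  define E where "E = sqrt h * (2 * K * sqrt h + 4 * \<epsilon> + prob (space M - G) +
        8 * L\<^sup>2 * (2 * h + \<rho>)\<^sup>2 / \<epsilon>\<^sup>2 + K\<^sup>2 * \<theta> / (h * \<epsilon>\<^sup>2))"
  have XF: "X t \<in> borel_measurable (F t)" if "0 \<le> t" "t \<le> T" for t
    using sde that unfolding sde_solution_def adapted_on_def by auto
  have XM: "X t \<in> borel_measurable M" if "0 \<le> t" "t \<le> T" for t
    using measurable_F_imp_M[OF that(1) XF[OF that]] .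
  have Xc: "continuous_on {0..T} (\<lambda>t. X t \<omega>)" if "\<omega> \<in> space M" for \<omega>
    using sde that unfolding sde_solution_def continuous_paths_on_def by auto
  have aT: "a \<le> T" "a + h + \<theta> \<le> T" "0 \<le> T" using times by auto
  have XaF[measurable]: "X a \<in> borel_measurable (F a)" using XF times aT by auto
  have [measurable]: "(\<lambda>\<omega>. \<sigma> (a, X a \<omega>)) \<in> borel_measurable (F a)"
    by (rule coefficient_past[OF \<sigma>m _ _ XaF]) (use times aT in auto)
  have \<eta>F: "\<eta> \<in> borel_measurable (F a)" unfolding \<eta>_def by measurable
  have AF: "A \<in> sets (F a)" unfolding A_def space_F[OF times(1), symmetric] by measurable
  have [measurable]: "A \<in> events" using AF subalgebra_F[OF times(1)] by (auto simp: subalgebra_def)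
  have [measurable]: "\<eta> \<in> borel_measurable M" "X a \<in> borel_measurable M"
    using measurable_F_imp_M[OF _ \<eta>F] measurable_F_imp_M[OF _ XaF] times by auto
  have [measurable]: "W a \<in> borel_measurable M" "W (a + h) \<in> borel_measurable M" using W_M times by auto
  have y[measurable]: "y \<in> borel_measurable M" unfolding y_def by measurable
  have w[measurable]: "?w \<in> measurable M ?PI"
    by (rule measurable_restrict) (use W_M \<tau> in auto)
  have gm: "g v \<in> borel_measurable ?N" if "v \<in> space ?PI" for v
    using measurable_space[OF g that] times aT
    by (intro borel_measurable_cell) (auto simp: L1_space_def space_L1_borel)
  have td: "(\<lambda>(v, z). truncated_norm (sqrt h) ?N (\<lambda>u. z - g v u)) \<in> borel_measurable (?PI \<Otimes>\<^sub>M borel)"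
    by (rule borel_measurable_truncated_distance[OF _ _ _ _ g]) (use times aT in auto)
  have PM: "P \<in> borel_measurable M"
  proof -
    have "(\<lambda>\<omega>. (?w \<omega>, y \<omega>)) \<in> measurable M (?PI \<Otimes>\<^sub>M borel)" by measurable
    from measurable_compose[OF this td]
    have [measurable]: "(\<lambda>\<omega>. truncated_norm (sqrt h) ?N (\<lambda>u. y \<omega> - g (?w \<omega>) u)) \<in> borel_measurable M"
      by simp
    show ?thesis unfolding P_def by measurable
  qed
  have h0: "0 \<le> sqrt h" using times by simp
  have mass: "emeasure ?N (space ?N) = ennreal \<theta>" by (rule emeasure_cell_measure) (use times in simp)
  have PI: "ennreal (\<theta> * sqrt h * min (c / 2) 1 / 4 * prob A) \<le> (\<integral>\<^sup>+\<omega>. P \<omega> \<partial>M)"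
    unfolding P_def y_def
  proof (rule midpoint_unpredictable[OF times(1,5) nondeg(2) _ AF XaF \<eta>F _ \<tau> td])
    show "c \<le> \<bar>\<eta> \<omega>\<bar>" if "\<omega> \<in> A" for \<omega>
      using that nondeg(1)[of "(a, X a \<omega>)"] times d pos by (auto simp: A_def \<eta>_def dist_real_def)
    fix v y z assume v: "v \<in> space ?PI"
    have "ennreal (\<theta> * min \<bar>y - z\<bar> (sqrt h)) = truncated_norm (sqrt h) ?N (\<lambda>u. y - z)"
      using times unfolding truncated_norm_const[OF h0] mass by (simp add: ennreal_mult mult.commute)
    also have "\<dots> \<le> truncated_norm (sqrt h) ?N (\<lambda>u. y - g v u) +
        truncated_norm (sqrt h) ?N (\<lambda>u. (y - z) - (y - g v u))"
      by (intro truncated_norm_triangle borel_measurable_diff borel_measurable_const gm v h0)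
    also have "truncated_norm (sqrt h) ?N (\<lambda>u. (y - z) - (y - g v u)) =
        truncated_norm (sqrt h) ?N (\<lambda>u. z - g v u)"
      unfolding truncated_norm_def by (simp add: abs_minus_commute)
    finally show "ennreal (\<theta> * min \<bar>y - z\<bar> (sqrt h)) \<le>
        truncated_norm (sqrt h) ?N (\<lambda>u. y - g v u) + truncated_norm (sqrt h) ?N (\<lambda>u. z - g v u)" .
  qed (use times in auto)
  let ?C = "{a + h..<a + h + \<theta>}"
  define H where "H \<omega> u = ennreal (min \<bar>X (max 0 (min T u)) \<omega> - y \<omega>\<bar> (sqrt h)) * indicator A \<omega> * indicator ?C u" for \<omega> u
  have "(\<lambda>(\<omega>, u). X (max 0 (min T u)) \<omega>) \<in> borel_measurable (M \<Otimes>\<^sub>M borel)"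
  proof (rule borel_measurable_Caratheodory)
    show "(\<lambda>\<omega>. X (max 0 (min T u)) \<omega>) \<in> borel_measurable M" for u using aT by (intro XM) auto
    show "continuous_on UNIV (\<lambda>u. X (max 0 (min T u)) \<omega>)" if "\<omega> \<in> space M" for \<omega>
      using aT by (intro continuous_on_compose2[OF Xc[OF that]]) (auto intro!: continuous_intros)
  qed
  then have [measurable]: "(\<lambda>p. X (max 0 (min T (snd p))) (fst p)) \<in> borel_measurable (M \<Otimes>\<^sub>M lborel)"
    by (simp add: split_beta cong: measurable_cong_sets)
  have H: "(\<lambda>(\<omega>, u). H \<omega> u) \<in> borel_measurable (M \<Otimes>\<^sub>M lborel)"
    unfolding H_def split_beta by measurable
  have Q_H: "Q \<omega> = (\<integral>\<^sup>+u. H \<omega> u \<partial>lborel)" for \<omega>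
  proof -
    have "Q \<omega> = (\<integral>\<^sup>+u. ennreal (min \<bar>X u \<omega> - y \<omega>\<bar> (sqrt h)) * indicator ?C u \<partial>lborel) * indicator A \<omega>"
      by (simp add: Q_def truncated_norm_def nn_integral_cell_measure)
    also have "\<dots> = (\<integral>\<^sup>+u. H \<omega> u \<partial>lborel)"
    proof (cases "\<omega> \<in> A")
      case True
      have "X (max 0 (min T u)) \<omega> = X u \<omega>" if "u \<in> ?C" for u
        using that times aT by (auto simp: min_def max_def)
      then show ?thesis using True by (auto simp: H_def indicator_def intro!: nn_integral_cong)
    qed (simp add: H_def)
    finally show ?thesis .
  qed
  have QM: "Q \<in> borel_measurable M"
    unfolding Q_H[abs_def] using lborel.borel_measurable_nn_integral[OF H] .
  have QI: "(\<integral>\<^sup>+\<omega>. Q \<omega> \<partial>M) \<le> ennreal (\<theta> * E)"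
  proof -
    interpret pair_sigma_finite M lborel ..
    have "(\<integral>\<^sup>+\<omega>. Q \<omega> \<partial>M) = (\<integral>\<^sup>+u. (\<integral>\<^sup>+\<omega>. H \<omega> u \<partial>M) \<partial>lborel)"
      unfolding Q_H using Fubini'[OF H] by simp
    also have "\<dots> \<le> (\<integral>\<^sup>+u. ennreal E * indicator ?C u \<partial>lborel)"
    proof (rule nn_integral_mono)
      fix u
      show "(\<integral>\<^sup>+\<omega>. H \<omega> u \<partial>M) \<le> ennreal E * indicator ?C u"
      proof (cases "u \<in> ?C")
        case True
        have "max 0 (min T u) = u" using True times aT by (auto simp: min_def max_def)
        then have "(\<integral>\<^sup>+\<omega>. H \<omega> u \<partial>M) = (\<integral>\<^sup>+\<omega>. ennreal (min \<bar>X u \<omega> - y \<omega>\<bar> (sqrt h)) * indicator A \<omega> \<partial>M)"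
          using True by (simp add: H_def)
        also have "\<dots> \<le> ennreal E"
          unfolding y_def \<eta>_def A_def E_def
          by (rule sde_increment_linear[OF sde \<sigma>m _ _ _ _ _ _ _ _ _ bounds lip pos d G])
            (use times True in auto)
        finally show ?thesis using True by simp
      qed (simp add: H_def)
    qed
    also have "\<dots> = ennreal E * ennreal \<theta>" using times by (subst nn_integral_cmult_indicator) auto
    also have "\<dots> = ennreal (\<theta> * E)" using times ennreal_mult'[of \<theta> E] by (simp add: mult.commute)
    finally show ?thesis .
  qed
  have PQ: "P \<omega> \<le> (\<integral>\<^sup>+u. ennreal \<bar>X u \<omega> - g (?w \<omega>) u\<bar> \<partial>?N) + Q \<omega>" if \<omega>: "\<omega> \<in> space M" for \<omega>
  proof -
    have Xm: "(\<lambda>u. X u \<omega>) \<in> borel_measurable ?N"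
      using borel_measurable_continuous_on_restrict[OF Xc[OF \<omega>]] times aT
      by (intro borel_measurable_cell) auto
    have gw: "g (?w \<omega>) \<in> borel_measurable ?N" by (rule gm) (use measurable_space[OF w \<omega>] in simp)
    have "truncated_norm (sqrt h) ?N (\<lambda>u. (y \<omega> - g (?w \<omega>) u) - (X u \<omega> - g (?w \<omega>) u)) =
        truncated_norm (sqrt h) ?N (\<lambda>u. X u \<omega> - y \<omega>)"
      unfolding truncated_norm_def by (simp add: abs_minus_commute)
    then have "truncated_norm (sqrt h) ?N (\<lambda>u. y \<omega> - g (?w \<omega>) u) \<le>
        truncated_norm (sqrt h) ?N (\<lambda>u. X u \<omega> - g (?w \<omega>) u) +
        truncated_norm (sqrt h) ?N (\<lambda>u. X u \<omega> - y \<omega>)"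
      using truncated_norm_triangle[OF borel_measurable_diff[OF borel_measurable_const gw]
          borel_measurable_diff[OF Xm gw] h0, of "y \<omega>"] by (simp only:)
    from order_trans[OF this add_right_mono[OF truncated_norm_le_nn_integral]]
    have "truncated_norm (sqrt h) ?N (\<lambda>u. y \<omega> - g (?w \<omega>) u) \<le>
        (\<integral>\<^sup>+u. ennreal \<bar>X u \<omega> - g (?w \<omega>) u\<bar> \<partial>?N) + truncated_norm (sqrt h) ?N (\<lambda>u. X u \<omega> - y \<omega>)" .
    moreover have "p * indicator A \<omega> \<le> z + q * indicator A \<omega>" if "p \<le> z + q" for p q z :: ennreal
      using that by (cases "\<omega> \<in> A") simp_all
    ultimately show ?thesis unfolding P_def Q_def by blast
  qed
  show ?thesis
    using PM QM PI QI PQ unfolding A_def E_def by blast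
qed

end

section \<open>Counting the unobserved cells\<close>

lemma card_nat_open_interval_le:
  fixes x :: real
  shows "card {l::nat. x - real k < real l \<and> real l < x} \<le> k" (is "card ?A \<le> k")
proof (cases "?A = {}")
  case False
  define l0 where "l0 = (LEAST l. l \<in> ?A)"
  have l0: "l0 \<in> ?A" unfolding l0_def using False by (metis LeastI ex_in_conv)
  have "?A \<subseteq> {l0..<l0 + k}"
  proof
    fix l assume l: "l \<in> ?A"
    then have "l0 \<le> l" unfolding l0_def by (rule Least_le)
    moreover have "real l < real (l0 + k)" using l l0 by simp
    ultimately show "l \<in> {l0..<l0 + k}" by (simp only: of_nat_less_iff atLeastLessThan_iff)
  qed
  then show ?thesis using card_mono[of "{l0..<l0 + k}" ?A] by simp
qed (metis card.empty le0)

text \<open>An observation at \<open>\<tau> i\<close> spoils the windows that contain it in their interior. For these, \<open>l\<close> lies in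
  an open interval of length \<open>2 * h / \<theta> = 2 * m\<close>, so there are at most \<open>2 * m\<close> of them.\<close>

lemma many_unobserved_cells:
  fixes \<tau> :: "nat \<Rightarrow> real" and t0 \<theta> :: real
  assumes "0 < \<theta>" "h = real m * \<theta>"
  shows "2 * m * n \<le> card {l. l < 4 * m * n \<and>
    (\<forall>i\<in>{1..n}. \<tau> i \<le> t0 + real l * \<theta> \<or> t0 + real l * \<theta> + 2 * h \<le> \<tau> i)}" (is "_ \<le> card ?I")
proof -
  let ?B = "\<lambda>i. {l::nat. (\<tau> i - t0) / \<theta> - real (2 * m) < real l \<and> real l < (\<tau> i - t0) / \<theta>}"
  have fin: "finite (?B i)" for i
  proof (rule finite_subset)
    show "?B i \<subseteq> {..nat \<lceil>(\<tau> i - t0) / \<theta>\<rceil>}"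
    proof
      fix l assume "l \<in> ?B i"
      then have "int l \<le> \<lceil>(\<tau> i - t0) / \<theta>\<rceil>" by (simp add: le_ceiling_iff)
      then show "l \<in> {..nat \<lceil>(\<tau> i - t0) / \<theta>\<rceil>}" by simp
    qed
  qed simp
  have "{..<4 * m * n} \<subseteq> ?I \<union> (\<Union>i\<in>{1..n}. ?B i)"
  proof
    fix l assume l: "l \<in> {..<4 * m * n}"
    show "l \<in> ?I \<union> (\<Union>i\<in>{1..n}. ?B i)"
    proof (cases "l \<in> ?I")
      case False
      then obtain i where i: "i \<in> {1..n}" "t0 + real l * \<theta> < \<tau> i" "\<tau> i < t0 + real l * \<theta> + 2 * h"
        using l by (auto simp: not_le)
      then have "real l * \<theta> < \<tau> i - t0" "\<tau> i - t0 < (real l + real (2 * m)) * \<theta>"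
        using assms(2) by (auto simp: algebra_simps)
      then have "l \<in> ?B i"
        using assms(1) by (auto simp: pos_less_divide_eq pos_divide_less_eq less_diff_eq diff_less_eq)
      then show ?thesis using i(1) by blast
    qed simp
  qed
  then have "card {..<4 * m * n} \<le> card (?I \<union> (\<Union>i\<in>{1..n}. ?B i))"
    using fin by (intro card_mono) auto
  also have "\<dots> \<le> card ?I + card (\<Union>i\<in>{1..n}. ?B i)" by (rule card_Un_le)
  also have "card (\<Union>i\<in>{1..n}. ?B i) \<le> (\<Sum>i\<in>{1..n}. card (?B i))" by (rule card_UN_le) simp
  also have "\<dots> \<le> (\<Sum>i\<in>{1..n}. 2 * m)" by (intro sum_mono card_nat_open_interval_le)
  finally show ?thesis by simp
qed

section \<open>The lower bound\<close>

context brownian_motion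
begin

text \<open>The hypothesis \<open>error\<close> says that replacing \<open>X\<close> by its linearisation loses at most half of the lower
  bound on each cell. Summing the other half over \<open>2 * m * n\<close> cells of length \<open>h / m\<close> gives a bound
  without \<open>m\<close>.\<close>

lemma observation_error:
  fixes g :: "(nat \<Rightarrow> real) \<Rightarrow> real \<Rightarrow> real" and \<tau> :: "nat \<Rightarrow> real"
  assumes sde: "sde_solution M F W T \<mu> \<sigma> X"
    and \<sigma>m: "\<sigma> \<in> borel_measurable (restrict_space borel ({0..T} \<times> UNIV))"
    and times: "0 \<le> t0" "t0 + 6 * real n * h \<le> T0" "T0 \<le> T" "0 < h" "1 \<le> n" "1 \<le> m"
    and bounds: "\<And>p. p \<in> {t0..T0} \<times> {\<xi> - \<delta>..\<xi> + \<delta>} \<Longrightarrow> \<bar>\<mu> p\<bar> \<le> K \<and> \<bar>\<sigma> p\<bar> \<le> K"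
    and nondeg: "\<And>p. p \<in> {t0..T0} \<times> ball \<xi> \<delta> \<Longrightarrow> c \<le> \<bar>\<sigma> p\<bar>" "0 < c"
    and lip: "L-lipschitz_on ({t0..T0} \<times> {\<xi> - \<delta>..\<xi> + \<delta>}) \<sigma>"
    and pos: "0 < K" "0 < L" "0 < \<rho>" "0 < \<epsilon>" and d: "d + \<rho> \<le> \<delta>"
    and G: "G \<in> events" "\<And>\<omega> u v. \<omega> \<in> G \<Longrightarrow> u \<in> {t0..t0 + 6 * real n * h} \<Longrightarrow>
        v \<in> {t0..t0 + 6 * real n * h} \<Longrightarrow> \<bar>X u \<omega> - X v \<omega>\<bar> \<le> \<rho>"
    and reach: "\<And>a. a \<in> {t0..t0 + 6 * real n * h} \<Longrightarrow> p \<le> prob {\<omega>\<in>space M. \<bar>X a \<omega> - \<xi>\<bar> < d}"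
    and error: "2 * K * sqrt h + 4 * \<epsilon> + prob (space M - G) +
        8 * L\<^sup>2 * (2 * h + \<rho>)\<^sup>2 / \<epsilon>\<^sup>2 + K\<^sup>2 / (real m * \<epsilon>\<^sup>2) \<le> min (c / 2) 1 / 8 * p"
    and \<tau>: "\<tau> \<in> {1..n} \<rightarrow> {0..T}"
    and g: "g \<in> measurable (Pi\<^sub>M {1..n} (\<lambda>_. borel)) (L1_borel T)"
  shows "ennreal (real n * (h * sqrt h) * (min (c / 2) 1 / 4 * p)) \<le>
    (\<integral>\<^sup>+\<omega>. L1_norm T (\<lambda>s. X s \<omega> - g (\<lambda>i\<in>{1..n}. W (\<tau> i) \<omega>) s) \<partial>M)"
proof -
  let ?w = "\<lambda>\<omega>. \<lambda>i\<in>{1..n}. W (\<tau> i) \<omega>"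
  define \<theta> where "\<theta> = h / real m"
  define a where "a l = t0 + real l * \<theta>" for l
  define I where "I = {l. l < 4 * m * n \<and> (\<forall>i\<in>{1..n}. \<tau> i \<le> a l \<or> a l + 2 * h \<le> \<tau> i)}"
  define k where "k = \<theta> * sqrt h * (min (c / 2) 1 / 4 * p)"
  have m: "0 < real m" using times by simp
  have \<theta>: "0 < \<theta>" "\<theta> \<le> h" "h = real m * \<theta>"
    using m times by (auto simp: \<theta>_def divide_le_eq)
  have I: "finite I" "2 * m * n \<le> card I"
    using many_unobserved_cells[OF \<theta>(1,3), of n \<tau> t0] by (auto simp: I_def a_def)
  have al: "t0 \<le> a l" "0 \<le> a l" "a l + 2 * h \<le> t0 + 6 * real n * h" if "l \<in> I" for l
  proof -
    show "t0 \<le> a l" "0 \<le> a l" using \<theta> times by (auto simp: a_def)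
    have "real l \<le> real (4 * m * n)" using that unfolding I_def by (intro of_nat_mono) auto
    then have "real l \<le> 4 * real m * real n" by simp
    then have "real l * \<theta> \<le> 4 * real m * real n * \<theta>" using \<theta> by (intro mult_right_mono) auto
    also have "\<dots> = 4 * real n * h" using \<theta>(3) by simp
    finally have "a l + 2 * h \<le> t0 + 4 * real n * h + 2 * h" by (simp add: a_def)
    also have "2 * h \<le> 2 * real n * h" using times by simp
    finally show "a l + 2 * h \<le> t0 + 6 * real n * h" by (simp add: algebra_simps)
  qed
  have p0: "0 \<le> p" and k0: "0 \<le> k"
  proof -
    have "0 \<le> min (c / 2) 1 / 8 * p"
      using error pos times measure_nonneg[of M "space M - G"] by (intro order_trans[OF _ error]) auto
    then show "0 \<le> p" using nondeg(2) by (simp add: zero_le_mult_iff min_def split: if_splits)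
    then show "0 \<le> k" using \<theta> times nondeg(2) by (simp add: k_def)
  qed
  let ?cell = "\<lambda>l P Q. P \<in> borel_measurable M \<and> Q \<in> borel_measurable M \<and>
    ennreal k \<le> (\<integral>\<^sup>+\<omega>. P \<omega> \<partial>M) \<and> (\<integral>\<^sup>+\<omega>. Q \<omega> \<partial>M) \<le> ennreal (k / 2) \<and>
    (\<forall>\<omega>\<in>space M. P \<omega> \<le> (\<integral>\<^sup>+u. ennreal \<bar>X u \<omega> - g (?w \<omega>) u\<bar> \<partial>cell_measure (a l + h) \<theta>) + Q \<omega>)"
  have "\<forall>l\<in>I. \<exists>P Q. ?cell l P Q"
  proof
    fix l assume l: "l \<in> I"
    have G': "\<bar>X v \<omega> - X (a l) \<omega>\<bar> \<le> \<rho>" if "\<omega> \<in> G" "v \<in> {a l..a l + 2 * h}" for \<omega> v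
      using G(2)[of \<omega> v "a l"] that al[OF l] times(4) by auto
    have \<tau>': "0 \<le> \<tau> i \<and> (\<tau> i \<le> a l \<or> a l + 2 * h \<le> \<tau> i)" if "i \<in> {1..n}" for i
      using \<tau> l that by (auto simp: I_def)
    have T0: "a l + 2 * h \<le> T0" using al(3)[OF l] times(2) by linarith
    have "\<exists>P Q. P \<in> borel_measurable M \<and> Q \<in> borel_measurable M \<and>
      ennreal (\<theta> * sqrt h * min (c / 2) 1 / 4 * prob {\<omega>\<in>space M. \<bar>X (a l) \<omega> - \<xi>\<bar> < d}) \<le> (\<integral>\<^sup>+\<omega>. P \<omega> \<partial>M) \<and>
      (\<integral>\<^sup>+\<omega>. Q \<omega> \<partial>M) \<le> ennreal (\<theta> * (sqrt h * (2 * K * sqrt h + 4 * \<epsilon> + prob (space M - G) +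
        8 * L\<^sup>2 * (2 * h + \<rho>)\<^sup>2 / \<epsilon>\<^sup>2 + K\<^sup>2 * \<theta> / (h * \<epsilon>\<^sup>2)))) \<and>
      (\<forall>\<omega>\<in>space M. P \<omega> \<le> (\<integral>\<^sup>+u. ennreal \<bar>X u \<omega> - g (?w \<omega>) u\<bar> \<partial>cell_measure (a l + h) \<theta>) + Q \<omega>)"
      by (rule cell_error[OF sde \<sigma>m al(2,1)[OF l] T0 times(3,4) \<theta>(1,2) _ _ nondeg(2) lip pos d G(1) _ _ g])
        (rule bounds nondeg(1) G' \<tau>'; assumption)+
    then obtain P Q where PQ: "P \<in> borel_measurable M" "Q \<in> borel_measurable M"
      "ennreal (\<theta> * sqrt h * min (c / 2) 1 / 4 * prob {\<omega>\<in>space M. \<bar>X (a l) \<omega> - \<xi>\<bar> < d}) \<le> (\<integral>\<^sup>+\<omega>. P \<omega> \<partial>M)"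
      "(\<integral>\<^sup>+\<omega>. Q \<omega> \<partial>M) \<le> ennreal (\<theta> * (sqrt h * (2 * K * sqrt h + 4 * \<epsilon> + prob (space M - G) +
        8 * L\<^sup>2 * (2 * h + \<rho>)\<^sup>2 / \<epsilon>\<^sup>2 + K\<^sup>2 * \<theta> / (h * \<epsilon>\<^sup>2))))"
      "\<forall>\<omega>\<in>space M. P \<omega> \<le> (\<integral>\<^sup>+u. ennreal \<bar>X u \<omega> - g (?w \<omega>) u\<bar> \<partial>cell_measure (a l + h) \<theta>) + Q \<omega>"
      by blast
    have "k \<le> \<theta> * sqrt h * min (c / 2) 1 / 4 * prob {\<omega>\<in>space M. \<bar>X (a l) \<omega> - \<xi>\<bar> < d}"
    proof -
      have "a l \<in> {t0..t0 + 6 * real n * h}" using al[OF l] times(4) by auto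
      from reach[OF this]
      have "\<theta> * sqrt h * min (c / 2) 1 / 4 * p \<le>
          \<theta> * sqrt h * min (c / 2) 1 / 4 * prob {\<omega>\<in>space M. \<bar>X (a l) \<omega> - \<xi>\<bar> < d}"
        using \<theta> times nondeg(2) by (intro mult_left_mono) auto
      then show ?thesis by (simp add: k_def algebra_simps)
    qed
    then have P: "ennreal k \<le> (\<integral>\<^sup>+\<omega>. P \<omega> \<partial>M)" using PQ(3) by (blast intro: order_trans ennreal_leI)
    have "K\<^sup>2 * \<theta> / (h * \<epsilon>\<^sup>2) = K\<^sup>2 / (real m * \<epsilon>\<^sup>2)"
      using m times by (simp add: \<theta>_def)
    then have "\<theta> * (sqrt h * (2 * K * sqrt h + 4 * \<epsilon> + prob (space M - G) +
        8 * L\<^sup>2 * (2 * h + \<rho>)\<^sup>2 / \<epsilon>\<^sup>2 + K\<^sup>2 * \<theta> / (h * \<epsilon>\<^sup>2))) \<le> \<theta> * (sqrt h * (min (c / 2) 1 / 8 * p))"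
      using error \<theta> times by (intro mult_left_mono) auto
    also have "\<dots> = k / 2" by (simp add: k_def)
    finally have Q: "(\<integral>\<^sup>+\<omega>. Q \<omega> \<partial>M) \<le> ennreal (k / 2)" using PQ(4) by (blast intro: order_trans ennreal_leI)
    show "\<exists>P Q. ?cell l P Q"
      using PQ P Q by blast
  qed
  from bchoice[OF this] obtain P where "\<forall>l\<in>I. \<exists>Q. ?cell l (P l) Q" ..
  from bchoice[OF this] obtain Q where cell: "\<forall>l\<in>I. ?cell l (P l) (Q l)" ..
  have PQ: "P l \<in> borel_measurable M" "Q l \<in> borel_measurable M"
    "ennreal k \<le> (\<integral>\<^sup>+\<omega>. P l \<omega> \<partial>M)" "(\<integral>\<^sup>+\<omega>. Q l \<omega> \<partial>M) \<le> ennreal (k / 2)" if "l \<in> I" for l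
    using bspec[OF cell that] by blast+
  have PQ_le: "P l \<omega> \<le> (\<integral>\<^sup>+u. ennreal \<bar>X u \<omega> - g (?w \<omega>) u\<bar> \<partial>cell_measure (a l + h) \<theta>) + Q l \<omega>"
    if "l \<in> I" "\<omega> \<in> space M" for l \<omega>
    using bspec[OF cell that(1)] that(2) by blast
  let ?Z = "\<lambda>\<omega>. L1_norm T (\<lambda>s. X s \<omega> - g (?w \<omega>) s)"
  have disj: "disjoint_family_on (\<lambda>l. {a l + h..<a l + h + \<theta>}) I"
  proof -
    have "{a i + h..<a i + h + \<theta>} \<inter> {a j + h..<a j + h + \<theta>} = {}" if "i < j" for i j
    proof -
      have "(real i + 1) * \<theta> \<le> real j * \<theta>" using that \<theta> by (intro mult_right_mono) auto
      then have "a i + h + \<theta> \<le> a j + h" by (simp add: a_def algebra_simps)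
      then show ?thesis by auto
    qed
    then show ?thesis unfolding disjoint_family_on_def by (metis inf_commute linorder_neqE_nat)
  qed
  have Z: "(\<Sum>l\<in>I. P l \<omega>) \<le> ?Z \<omega> + (\<Sum>l\<in>I. Q l \<omega>)" if \<omega>: "\<omega> \<in> space M" for \<omega>
  proof -
    have "continuous_on {0..T} (\<lambda>t. X t \<omega>)"
      using sde \<omega> unfolding sde_solution_def continuous_paths_on_def by auto
    then have X: "(\<lambda>t. X t \<omega>) \<in> borel_measurable (restrict_space borel {0..T})"
      by (rule borel_measurable_continuous_on_restrict)
    have "?w \<omega> \<in> space (Pi\<^sub>M {1..n} (\<lambda>_. borel))" by (simp add: space_PiM)
    then have "g (?w \<omega>) \<in> borel_measurable (restrict_space borel {0..T})"
      using measurable_space[OF g] by (auto simp: space_L1_borel L1_space_def)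
    with X have f: "(\<lambda>s. X s \<omega> - g (?w \<omega>) s) \<in> borel_measurable (restrict_space borel {0..T})"
      by (rule borel_measurable_diff)
    have "(\<Sum>l\<in>I. P l \<omega>) \<le> (\<Sum>l\<in>I. (\<integral>\<^sup>+u. ennreal \<bar>X u \<omega> - g (?w \<omega>) u\<bar> \<partial>cell_measure (a l + h) \<theta>) + Q l \<omega>)"
      by (intro sum_mono PQ_le \<omega>)
    also have "\<dots> = (\<Sum>l\<in>I. \<integral>\<^sup>+u. ennreal \<bar>X u \<omega> - g (?w \<omega>) u\<bar> \<partial>cell_measure (a l + h) \<theta>) + (\<Sum>l\<in>I. Q l \<omega>)"
      by (rule sum.distrib)
    also have "(\<Sum>l\<in>I. \<integral>\<^sup>+u. ennreal \<bar>X u \<omega> - g (?w \<omega>) u\<bar> \<partial>cell_measure (a l + h) \<theta>) \<le> ?Z \<omega>"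
    proof (rule sum_cells_le_L1_norm[OF I(1) disj _ f])
      fix l assume "l \<in> I"
      then show "0 \<le> a l + h \<and> a l + h + \<theta> \<le> T" using al[of l] times \<theta> by linarith
    qed
    finally show ?thesis by (simp add: add_right_mono)
  qed
  have IP: "(\<integral>\<^sup>+\<omega>. (\<Sum>l\<in>I. P l \<omega>) \<partial>M) = (\<Sum>l\<in>I. \<integral>\<^sup>+\<omega>. P l \<omega> \<partial>M)"
    by (rule nn_integral_sum) (rule PQ(1))
  have IQ: "(\<integral>\<^sup>+\<omega>. (\<Sum>l\<in>I. Q l \<omega>) \<partial>M) = (\<Sum>l\<in>I. \<integral>\<^sup>+\<omega>. Q l \<omega> \<partial>M)"
    by (rule nn_integral_sum) (rule PQ(2))
  have SP: "ennreal (real (card I) * k) \<le> (\<integral>\<^sup>+\<omega>. (\<Sum>l\<in>I. P l \<omega>) \<partial>M)"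
  proof -
    have "ennreal (real (card I) * k) = (\<Sum>l\<in>I. ennreal k)" using k0 by (simp add: ennreal_mult ennreal_of_nat_eq_real_of_nat)
    also have "\<dots> \<le> (\<Sum>l\<in>I. \<integral>\<^sup>+\<omega>. P l \<omega> \<partial>M)" by (intro sum_mono PQ(3))
    finally show ?thesis unfolding IP .
  qed
  have SQ: "(\<integral>\<^sup>+\<omega>. (\<Sum>l\<in>I. Q l \<omega>) \<partial>M) \<le> ennreal (real (card I) * (k / 2))"
  proof -
    have "(\<Sum>l\<in>I. \<integral>\<^sup>+\<omega>. Q l \<omega> \<partial>M) \<le> (\<Sum>l\<in>I. ennreal (k / 2))" by (intro sum_mono PQ(4))
    also have "\<dots> = ennreal (real (card I) * (k / 2))"
      using k0 by (subst ennreal_mult) (auto simp: ennreal_of_nat_eq_real_of_nat)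
    finally show ?thesis unfolding IQ .
  qed
  have "ennreal (real (card I) * k) \<le> (\<integral>\<^sup>+\<omega>. ?Z \<omega> \<partial>M) + (\<integral>\<^sup>+\<omega>. (\<Sum>l\<in>I. Q l \<omega>) \<partial>M)"
    by (rule order_trans[OF SP nn_integral_le_add])
      (use PQ Z SQ in \<open>auto intro!: borel_measurable_sum simp: top_unique\<close>)
  also have "\<dots> \<le> (\<integral>\<^sup>+\<omega>. ?Z \<omega> \<partial>M) + ennreal (real (card I) * (k / 2))"
    using SQ by (intro add_left_mono)
  finally have *: "ennreal (real (card I) * k) \<le> (\<integral>\<^sup>+\<omega>. ?Z \<omega> \<partial>M) + ennreal (real (card I) * (k / 2))" .
  have "ennreal (real (card I) * (k / 2)) \<le> (\<integral>\<^sup>+\<omega>. ?Z \<omega> \<partial>M)"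
  proof (cases "\<integral>\<^sup>+\<omega>. ?Z \<omega> \<partial>M")
    case (real z)
    have "ennreal (real (card I) * k) \<le> ennreal (z + real (card I) * (k / 2))"
      using * k0 real by simp
    then have "real (card I) * k \<le> z + real (card I) * (k / 2)"
      using k0 real by (subst (asm) ennreal_le_iff) auto
    then have "real (card I) * (k / 2) \<le> z" by simp
    then show ?thesis unfolding real(2) by (rule ennreal_leI)
  qed simp
  moreover have "real n * (h * sqrt h) * (min (c / 2) 1 / 4 * p) \<le> real (card I) * (k / 2)"
  proof -
    have "real n * (h * sqrt h) * (min (c / 2) 1 / 4 * p) = real (2 * m * n) * (k / 2)"
      unfolding k_def using \<theta>(3) by (simp add: algebra_simps)
    also have "\<dots> \<le> real (card I) * (k / 2)" using I(2) k0 by (intro mult_right_mono) (auto simp del: of_nat_mult)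
    finally show ?thesis .
  qed
  ultimately show ?thesis by (blast intro: order_trans ennreal_leI)
qed

text \<open>The gap between \<open>d\<close> and \<open>\<delta>\<close> is the room in which the path may move after time \<open>t0\<close>.\<close>

lemma reach_smaller_ball:
  assumes X: "X \<in> borel_measurable M" and \<delta>: "0 < \<delta>"
    and reach: "0 < prob {\<omega>\<in>space M. X \<omega> \<in> ball \<xi> \<delta>}"
  obtains d p where "0 < p" "d < \<delta>" "2 * p \<le> prob {\<omega>\<in>space M. \<bar>X \<omega> - \<xi>\<bar> < d}"
proof -
  let ?A = "\<lambda>k::nat. {\<omega>\<in>space M. \<bar>X \<omega> - \<xi>\<bar> < \<delta> - \<delta> / real (Suc k)}"
  note [measurable] = X
  have mono: "incseq ?A"
  proof (rule incseq_SucI, rule subsetI)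
    fix k \<omega> assume \<omega>: "\<omega> \<in> ?A k"
    have "\<delta> / real (Suc (Suc k)) \<le> \<delta> / real (Suc k)" using \<delta> by (intro divide_left_mono) auto
    then show "\<omega> \<in> ?A (Suc k)" using \<omega> by auto
  qed
  have "(\<Union>k. ?A k) = {\<omega>\<in>space M. X \<omega> \<in> ball \<xi> \<delta>}"
  proof (intro equalityI subsetI)
    fix \<omega> assume "\<omega> \<in> (\<Union>k. ?A k)"
    then obtain k where "\<omega> \<in> ?A k" by blast
    moreover have "0 < \<delta> / real (Suc k)" using \<delta> by simp
    ultimately show "\<omega> \<in> {\<omega>\<in>space M. X \<omega> \<in> ball \<xi> \<delta>}" by (auto simp: dist_real_def abs_minus_commute)
  next
    fix \<omega> assume \<omega>: "\<omega> \<in> {\<omega>\<in>space M. X \<omega> \<in> ball \<xi> \<delta>}"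
    then have "0 < (\<delta> - \<bar>X \<omega> - \<xi>\<bar>) / \<delta>" using \<delta> by (auto simp: dist_real_def abs_minus_commute)
    then obtain k where "1 / real (Suc k) < (\<delta> - \<bar>X \<omega> - \<xi>\<bar>) / \<delta>" by (rule nat_approx_posE)
    then have "1 / real (Suc k) * \<delta> < \<delta> - \<bar>X \<omega> - \<xi>\<bar>" using \<delta> by (simp add: pos_less_divide_eq)
    then have "\<omega> \<in> ?A k" using \<omega> by simp
    then show "\<omega> \<in> (\<Union>k. ?A k)" by blast
  qed
  then have "0 < prob (\<Union>k. ?A k)" using reach by simp
  moreover have "range ?A \<subseteq> events" by (rule image_subsetI) measurable
  ultimately obtain k where k: "0 < prob (?A k)" using incseq_prob_large[of ?A 0] mono by blast
  show ?thesis
    by (rule that[of "prob (?A k) / 2" "\<delta> - \<delta> / real (Suc k)"]) (use k \<delta> in auto)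
qed

end

theorem theorem2:
  fixes M :: "'a measure" and F :: "real \<Rightarrow> 'a measure" and W X :: "real \<Rightarrow> 'a \<Rightarrow> real"
    and \<mu> \<sigma> :: "real \<times> real \<Rightarrow> real" and T t0 T0 \<delta> \<xi> :: real
  assumes "usual_filtered_prob_space M F"
    and "standard_brownian_motion M F W"
    and "0 < T"
    and "\<mu> \<in> borel_measurable (restrict_space borel ({0..T} \<times> UNIV))"
    and "\<sigma> \<in> borel_measurable (restrict_space borel ({0..T} \<times> UNIV))"
    and "sde_solution M F W T \<mu> \<sigma> X"
    and "t0 \<in> {0..<T}" and "T0 \<in> {t0<..T}" and "0 < \<delta>"
    and local_Lip: "\<exists>L. L-lipschitz_on ({t0..T0} \<times> {\<xi> - \<delta>..\<xi> + \<delta>}) \<mu>"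
                   "\<exists>L. L-lipschitz_on ({t0..T0} \<times> {\<xi> - \<delta>..\<xi> + \<delta>}) \<sigma>"
    and non_deg: "0 < (INF p\<in>{t0..T0} \<times> ball \<xi> \<delta>. \<bar>\<sigma> p\<bar>)"
    and reach: "0 < measure M {\<omega>\<in>space M. X t0 \<omega> \<in> ball \<xi> \<delta>}"
  shows "\<exists>c>0. \<forall>n\<ge>1::nat.
    ennreal (c / sqrt (real n)) \<le>
      (INF (\<tau>, g)\<in>({1..n} \<rightarrow> {0..T}) \<times> ((\<Pi>\<^sub>M i\<in>{1..n}. borel) \<rightarrow>\<^sub>M L1_borel T).
        \<integral>\<^sup>+\<omega>. L1_norm T (\<lambda>s. X s \<omega> - g (\<lambda>i\<in>{1..n}. W (\<tau> i) \<omega>) s) \<partial>M)"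
proof -
  interpret usual_filtered_prob_space M F by fact
  interpret brownian_motion M F W by unfold_locales fact
  note sde = \<open>sde_solution M F W T \<mu> \<sigma> X\<close>
  have t0: "0 \<le> t0" "t0 < T0" "T0 \<le> T" using assms(7,8) by auto
  have XM: "X t \<in> borel_measurable M" if "t \<in> {0..T}" for t
  proof (rule measurable_F_imp_M[of t])
    show "0 \<le> t" using that by simp
    show "X t \<in> borel_measurable (F t)" using sde that unfolding sde_solution_def adapted_on_def by blast
  qed
  have Xc: "continuous_on {0..T} (\<lambda>t. X t \<omega>)" if "\<omega> \<in> space M" for \<omega>
    using sde that unfolding sde_solution_def continuous_paths_on_def by auto
  let ?Q = "{t0..T0} \<times> {\<xi> - \<delta>..\<xi> + \<delta>}"
  obtain L1 L2 where L12: "L1-lipschitz_on ?Q \<mu>" "L2-lipschitz_on ?Q \<sigma>" using local_Lip by blast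
  define L where "L = max L2 1"
  have L: "0 < L" "L-lipschitz_on ?Q \<sigma>"
    using lipschitz_on_le[OF L12(2), of L] by (auto simp: L_def)
  have bdd: "bounded (f ` ?Q)" if "C-lipschitz_on ?Q f" for C and f :: "real \<times> real \<Rightarrow> real"
    by (intro compact_imp_bounded compact_continuous_image lipschitz_on_continuous_on[OF that]
        compact_Times compact_Icc)
  obtain K1 where K1: "\<forall>p\<in>?Q. \<bar>\<mu> p\<bar> \<le> K1" using bdd[OF L12(1)] unfolding bounded_iff by auto
  obtain K2 where K2: "\<forall>p\<in>?Q. \<bar>\<sigma> p\<bar> \<le> K2" using bdd[OF L12(2)] unfolding bounded_iff by auto
  define K where "K = max 1 (max K1 K2)"
  have K: "0 < K" "\<And>p. p \<in> ?Q \<Longrightarrow> \<bar>\<mu> p\<bar> \<le> K \<and> \<bar>\<sigma> p\<bar> \<le> K"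
  proof -
    show "0 < K" by (simp add: K_def)
    fix p assume "p \<in> ?Q"
    with K1 K2 have "\<bar>\<mu> p\<bar> \<le> K1" "\<bar>\<sigma> p\<bar> \<le> K2" by blast+
    then show "\<bar>\<mu> p\<bar> \<le> K \<and> \<bar>\<sigma> p\<bar> \<le> K" by (simp add: K_def le_max_iff_disj)
  qed
  define c where "c = (INF p\<in>{t0..T0} \<times> ball \<xi> \<delta>. \<bar>\<sigma> p\<bar>)"
  have c: "0 < c" "\<And>p. p \<in> {t0..T0} \<times> ball \<xi> \<delta> \<Longrightarrow> c \<le> \<bar>\<sigma> p\<bar>"
    using non_deg unfolding c_def by (auto intro!: cINF_lower bdd_belowI2[where m = 0])
  have "X t0 \<in> borel_measurable M" using XM t0 by simp
  then obtain d' p where p: "0 < p" "d' < \<delta>" "2 * p \<le> prob {\<omega>\<in>space M. \<bar>X t0 \<omega> - \<xi>\<bar> < d'}"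
    by (rule reach_smaller_ball[OF _ \<open>0 < \<delta>\<close> reach])
  \<comment> \<open>the admissible size of each of the five error terms in \<open>observation_error\<close>\<close>
  define b where "b = min (c / 2) 1 / 40 * p"
  have b: "0 < b" using c p by (simp add: b_def)
  define \<epsilon> where "\<epsilon> = b / 4"
  have \<epsilon>: "0 < \<epsilon>" using b by (simp add: \<epsilon>_def)
  \<comment> \<open>the first bound gives \<open>d' + 2 * \<rho> \<le> \<delta>\<close>, the second keeps the effect of freezing \<open>\<sigma>\<close> below \<open>b\<close>\<close>
  define \<rho> where "\<rho> = min ((\<delta> - d') / 2) (\<epsilon> * sqrt b / (6 * L))"
  have \<rho>: "0 < \<rho>" using p \<epsilon> b L by (simp add: \<rho>_def)
  define d where "d = d' + \<rho>"
  have d: "d + \<rho> \<le> \<delta>" by (simp add: d_def \<rho>_def min_def field_simps)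
  have "0 < min p b" using p b by simp
  then obtain \<kappa> G where G: "0 < \<kappa>" "G \<in> events" "prob (space M - G) \<le> min p b"
    "\<And>\<omega> u v. \<omega> \<in> G \<Longrightarrow> u \<in> {0..T} \<Longrightarrow> v \<in> {0..T} \<Longrightarrow> \<bar>u - v\<bar> < \<kappa> \<Longrightarrow> \<bar>X u \<omega> - X v \<omega>\<bar> \<le> \<rho>"
    using path_modulus[of T X \<rho> "min p b"] XM Xc \<rho> \<open>0 < T\<close> by (metis less_imp_le)
  obtain m0 :: nat where m0: "K\<^sup>2 / (\<epsilon>\<^sup>2 * b) < real m0" using reals_Archimedean2 by blast
  define m where "m = max 1 m0"
  have m: "1 \<le> m" "K\<^sup>2 / (real m * \<epsilon>\<^sup>2) \<le> b"
  proof -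
    show "1 \<le> m" by (simp add: m_def)
    have "K\<^sup>2 / (\<epsilon>\<^sup>2 * b) \<le> real m" using m0 by (auto simp: m_def)
    then have "K\<^sup>2 \<le> real m * (\<epsilon>\<^sup>2 * b)" using \<epsilon> b by (subst (asm) pos_divide_le_eq) auto
    then show "K\<^sup>2 / (real m * \<epsilon>\<^sup>2) \<le> b"
      using \<epsilon> \<open>1 \<le> m\<close> by (subst pos_divide_le_eq) (auto simp: algebra_simps)
  qed
  \<comment> \<open>the windows lie in \<open>[t0, t0 + D]\<close>, and \<open>h = D / (6 * n)\<close>\<close>
  define D where "D = min (min (T0 - t0) (\<kappa> / 2)) (min \<rho> ((b / (2 * K))\<^sup>2))"
  have D: "0 < D" "D \<le> T0 - t0" "D < \<kappa>" "D \<le> \<rho>" "D \<le> (b / (2 * K))\<^sup>2"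
    using t0 G(1) \<rho> b K(1) by (auto simp: D_def min_def)
  have reach': "p \<le> prob {\<omega>\<in>space M. \<bar>X a \<omega> - \<xi>\<bar> < d}" if a: "a \<in> {t0..t0 + D}" for a
  proof -
    have [measurable]: "X a \<in> borel_measurable M" "X t0 \<in> borel_measurable M" using XM a t0 D by auto
    note [measurable] = G(2)
    have "2 * p \<le> prob {\<omega>\<in>space M. \<bar>X t0 \<omega> - \<xi>\<bar> < d'}" by (rule p)
    also have "\<dots> \<le> prob ({\<omega>\<in>space M. \<bar>X a \<omega> - \<xi>\<bar> < d} \<union> (space M - G))"
    proof (rule finite_measure_mono)
      show "{\<omega>\<in>space M. \<bar>X t0 \<omega> - \<xi>\<bar> < d'} \<subseteq> {\<omega>\<in>space M. \<bar>X a \<omega> - \<xi>\<bar> < d} \<union> (space M - G)"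
      proof safe
        fix \<omega> assume "\<bar>X t0 \<omega> - \<xi>\<bar> < d'" "\<omega> \<in> G"
        then show "\<bar>X a \<omega> - \<xi>\<bar> < d" using G(4)[of \<omega> a t0] a t0 D unfolding d_def by auto
      qed
    qed measurable
    also have "\<dots> \<le> prob {\<omega>\<in>space M. \<bar>X a \<omega> - \<xi>\<bar> < d} + prob (space M - G)"
      by (intro measure_Un_le) measurable
    finally show ?thesis using G(3) by simp
  qed
  define C where "C = D / 6 * sqrt (D / 6) * (min (c / 2) 1 / 4 * p)"
  have "0 < C" using D c p by (simp add: C_def)
  moreover have "ennreal (C / sqrt (real n)) \<le>
      (INF (\<tau>, g)\<in>({1..n} \<rightarrow> {0..T}) \<times> ((\<Pi>\<^sub>M i\<in>{1..n}. borel) \<rightarrow>\<^sub>M L1_borel T).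
        \<integral>\<^sup>+\<omega>. L1_norm T (\<lambda>s. X s \<omega> - g (\<lambda>i\<in>{1..n}. W (\<tau> i) \<omega>) s) \<partial>M)" if n: "1 \<le> n" for n
  proof (rule INF_greatest, clarify)
    fix \<tau> :: "nat \<Rightarrow> real" and g :: "(nat \<Rightarrow> real) \<Rightarrow> real \<Rightarrow> real"
    assume \<tau>: "\<tau> \<in> {1..n} \<rightarrow> {0..T}" and g: "g \<in> measurable (\<Pi>\<^sub>M i\<in>{1..n}. borel) (L1_borel T)"
    define h where "h = D / (6 * real n)"
    have nr: "0 < real n" "1 \<le> real n" using n by auto
    have h: "0 < h" "6 * real n * h = D" using D nr by (auto simp: h_def)
    have hD: "6 * h \<le> D"
    proof -
      have "6 * h * 1 \<le> 6 * h * real n" using h(1) nr by (intro mult_left_mono) auto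
      also have "6 * h * real n = D" using h(2) by (simp only: ac_simps)
      finally show ?thesis by simp
    qed
    have e1: "2 * K * sqrt h \<le> b"
    proof -
      have "sqrt h \<le> sqrt ((b / (2 * K))\<^sup>2)" using hD h D by (intro real_sqrt_le_mono) linarith
      also have "\<dots> = b / (2 * K)" using b K by (intro real_sqrt_unique) auto
      finally show ?thesis using K by (simp add: pos_le_divide_eq mult.commute)
    qed
    have e4: "8 * L\<^sup>2 * (2 * h + \<rho>)\<^sup>2 / \<epsilon>\<^sup>2 \<le> b"
    proof -
      have "2 * h + \<rho> \<le> 2 * (\<epsilon> * sqrt b / (6 * L))" using hD h D unfolding \<rho>_def by linarith
      then have "3 * L * (2 * h + \<rho>) \<le> \<epsilon> * sqrt b" using L by (simp add: field_simps)
      then have "(3 * L * (2 * h + \<rho>))\<^sup>2 \<le> (\<epsilon> * sqrt b)\<^sup>2"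
        using L h \<rho> by (intro power_mono) auto
      then have "9 * (L\<^sup>2 * (2 * h + \<rho>)\<^sup>2) \<le> \<epsilon>\<^sup>2 * b" using b by (simp add: power_mult_distrib)
      moreover have "0 \<le> L\<^sup>2 * (2 * h + \<rho>)\<^sup>2" by simp
      ultimately have "8 * L\<^sup>2 * (2 * h + \<rho>)\<^sup>2 \<le> b * \<epsilon>\<^sup>2"
        unfolding mult.assoc mult.commute[of b] by linarith
      then show ?thesis using \<epsilon> by (simp add: pos_divide_le_eq)
    qed
    have "2 * K * sqrt h + 4 * \<epsilon> + prob (space M - G) + 8 * L\<^sup>2 * (2 * h + \<rho>)\<^sup>2 / \<epsilon>\<^sup>2 + K\<^sup>2 / (real m * \<epsilon>\<^sup>2)
        \<le> b + b + b + b + b"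
      using e1 e4 m(2) G(3) by (intro add_mono) (auto simp: \<epsilon>_def)
    also have "\<dots> = min (c / 2) 1 / 8 * p" by (simp add: b_def)
    finally have error: "2 * K * sqrt h + 4 * \<epsilon> + prob (space M - G) +
        8 * L\<^sup>2 * (2 * h + \<rho>)\<^sup>2 / \<epsilon>\<^sup>2 + K\<^sup>2 / (real m * \<epsilon>\<^sup>2) \<le> min (c / 2) 1 / 8 * p" .
    have G': "\<bar>X u \<omega> - X v \<omega>\<bar> \<le> \<rho>"
      if "\<omega> \<in> G" "u \<in> {t0..t0 + 6 * real n * h}" "v \<in> {t0..t0 + 6 * real n * h}" for \<omega> u v
      using that t0 D unfolding h(2) by (intro G(4)) auto
    have "C / sqrt (real n) = real n * (h * sqrt h) * (min (c / 2) 1 / 4 * p)"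
    proof -
      have "real n * (h * sqrt h) = (real n * h) * sqrt (D / 6 / real n)" by (simp add: h_def)
      also have "\<dots> = D / 6 * (sqrt (D / 6) / sqrt (real n))"
      proof -
        have "real n * h = D / 6" using h(2) by simp
        then show ?thesis by (simp only: real_sqrt_divide)
      qed
      finally show ?thesis by (simp add: C_def)
    qed
    moreover have "ennreal (real n * (h * sqrt h) * (min (c / 2) 1 / 4 * p)) \<le>
        (\<integral>\<^sup>+\<omega>. L1_norm T (\<lambda>s. X s \<omega> - g (\<lambda>i\<in>{1..n}. W (\<tau> i) \<omega>) s) \<partial>M)"
    proof (rule observation_error[OF sde assms(5) t0(1) _ t0(3) h(1) n m(1) _ _ c(1) L(2) K(1) L(1)
            \<rho> \<epsilon> d G(2) _ _ error \<tau> g])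
      show "t0 + 6 * real n * h \<le> T0" using h(2) D(2) by simp
      show "p \<le> prob {\<omega>\<in>space M. \<bar>X a \<omega> - \<xi>\<bar> < d}" if "a \<in> {t0..t0 + 6 * real n * h}" for a
        using that reach' unfolding h(2) by blast
    qed (rule K(2) c(2) G'; assumption)+
    ultimately show "ennreal (C / sqrt (real n)) \<le>
        (\<integral>\<^sup>+\<omega>. L1_norm T (\<lambda>s. X s \<omega> - g (\<lambda>i\<in>{1..n}. W (\<tau> i) \<omega>) s) \<partial>M)" by (simp only:)
  qed
  ultimately show ?thesis by blast
qed

end
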